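(* Fix $\delta>0$ and a graph $K$ which is not a forest and whose $2$-core is not a disjoint union of cycles, and let $p\to0$. Then \[p^{2+\gamma(K)}\lesssim\inf_{\substack{W\ p\text{-regular}\\ \mathrm{Hom}(K,W)\geq (1+\delta)p^{e(K)}}}I_p(W)\leq (2+o(1))\rho(K,\delta)p^{2+\gamma(K)}\log\frac{1}{p}.\] Furthermore, if $n\to\infty$ and $p=p(n)$ satisfies $(n^{-1}\log n)^{\frac{1}{2e(K)-2-\gamma(K)}}\ll p\ll 1$, the upper bound is attained by a graphon $W=W(n)$ which is a block graphon on $O(1)$ blocks satisfying Conditions (1)–(10) below (with respect to $K$).
   Context: Graphs have no isolated vertices; subgraphs are edge subsets (empty subgraph included); $2$-core: repeatedly delete degree-$1$ vertices. Fractional vertex cover of $H$: $(c_v)$, $c_v\ge0$, $c_v+c_w\ge1$ on edges; $c(H)$ its minimum total weight; minimum covers attain it. $\gamma(K)=\max_{\emptyset\ne H\subseteq K}\frac{e(H)-v(H)}{c(H)}$. $H$ contributing: min degree $\ge2$ and $e(H)-v(H)=c(H)\gamma(K)$. $A\subseteq V(H)$ valid: some minimum cover has $c_v=1$ on $A$, $c_v\in\{0,\frac12\}$ off $A$. $P_K(z,w)=\sum_{H\text{ contr.}}\sum_{A\text{ valid}}z^{|A|}w^{c(H)-|A|}$; $\rho(K,\delta)=\min\{z+\frac w2:z,w\ge0,P_K(z,w)\ge1+\delta\}$. Graphon: symmetric measurable $W:[0,1]^2\to[0,1]$; $p$-regular: $\int_0^1W(x,y)dy=p$ for all $x$; $\mathrm{Hom}(K,W)=\int\prod_{uv\in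 E(K)}W(x_u,x_v)\prod dx_v$; $I_p(x)=x\log\frac xp+(1-x)\log\frac{1-x}{1-p}$, $I_p(W)=\int I_p(W)$. $\lesssim$, $\ll$ denote $O(\cdot)$, $o(\cdot)$. Block graphon on intervals $S_1\cup\dots\cup S_k=[0,1]$ with value $w_{ij}$ on $S_i\times S_j$; $K$-block $B:V(K)\to[k]$, $\mathrm{Hom}_B$ the integral restricted to $x_v\in S_{B(v)}$, negligible if $o(p^{e(K)})$. Conditions (asymptotics as $n\to\infty$): (1) $W$ $p$-regular; (2) $m(S_k)\ge1-p$; (3) $\mathrm{Hom}(K,W)\ge(1+\Omega(1))p^{e(K)}$; (4) $n^{-1}\log n\ll I_p(W)\ll p^{2e(K)}n$; (5) $m(S_i)\gg n^{-1}$; (6) for $i,j\le k-1$, $w_{ij}\ge p$ and either $w_{ij}=p$ or $m(S_i)m(S_j)w_{ij}\ll(\log\log\log\frac1p)^{-1}I_p(W)$; $(i,j)$ is important if $i,j\le k-1$ and the latter holds, unimportant otherwise; important blocks are somewhat important if $w_{ij}<1$, very important if $w_{ij}=1$; (7) for non-negligible $B$, edges sent by $B$ to somewhat important blocks form a matching; (8) for non-negligible $B$ and unimportant $(i,j)=(B(u),B(v))$ for some edge $uv$: $m(S_i)m(S_j)\ge(1+o(1))p^{-1}I_p(W)$ and $w_{ij}=p+o(p)$; (9) $w_{ij}m(S_i)\gg n^{-1}\log n$ for important $(i,j)$; (10) $\mathrm{Hom}(K,W+p)=O(p^{e(K)})$. *)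

theory Defs
  imports "HOL-Analysis.Analysis" "HOL-Library.Landau_Symbols"
begin

section \<open>Graphs\<close>

text \<open>A graph is its finite set of edges, an edge being a two-element set of vertices; the vertex
  set is the union of the edges, so there are no isolated vertices and a subgraph is a subset of
  the edge set.\<close>

definition simple_graph :: "'a set set \<Rightarrow> bool" where
  "simple_graph K \<longleftrightarrow> finite K \<and> (\<forall>e\<in>K. card e = 2)"

abbreviation verts :: "'a set set \<Rightarrow> 'a set" where
  "verts H \<equiv> \<Union>H"

definition degree_in :: "'a set set \<Rightarrow> 'a \<Rightarrow> nat" where
  "degree_in H v = card {e \<in> H. v \<in> e}"

definition is_cycle :: "'a set set \<Rightarrow> bool" where
  "is_cycle C \<longleftrightarrow> (\<exists>vs. distinct vs \<and> length vs \<ge> 3 \<and>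
     C = {{vs ! i, vs ! (Suc i mod length vs)} | i. i < length vs})"

definition is_forest :: "'a set set \<Rightarrow> bool" where
  "is_forest K \<longleftrightarrow> (\<forall>C\<subseteq>K. \<not> is_cycle C)"

definition disjoint_union_of_cycles :: "'a set set \<Rightarrow> bool" where
  "disjoint_union_of_cycles K \<longleftrightarrow>
     (\<exists>\<C>. K = \<Union>\<C> \<and> (\<forall>C\<in>\<C>. is_cycle C) \<and>
          (\<forall>C\<in>\<C>. \<forall>D\<in>\<C>. C \<noteq> D \<longrightarrow> verts C \<inter> verts D = {}))"

definition delete_leaves :: "'a set set \<Rightarrow> 'a set set" where
  "delete_leaves H = {e \<in> H. \<forall>v\<in>e. degree_in H v \<noteq> 1}"

text \<open>Every round that changes the graph removes an edge, so \<open>card K\<close> rounds exhaust the deletion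
  process.\<close>

definition two_core :: "'a set set \<Rightarrow> 'a set set" where
  "two_core K = (delete_leaves ^^ card K) K"

definition is_matching :: "'a set set \<Rightarrow> bool" where
  "is_matching M \<longleftrightarrow> (\<forall>e\<in>M. \<forall>f\<in>M. e \<noteq> f \<longrightarrow> e \<inter> f = {})"

section \<open>Fractional vertex covers and the parameters \<open>\<gamma>\<close>, \<open>\<rho>\<close>\<close>

definition fractional_cover :: "'a set set \<Rightarrow> ('a \<Rightarrow> real) \<Rightarrow> bool" where
  "fractional_cover H c \<longleftrightarrow>
     (\<forall>v\<in>verts H. 0 \<le> c v) \<and> (\<forall>v w. {v, w} \<in> H \<longrightarrow> 1 \<le> c v + c w)"

definition cover_number :: "'a set set \<Rightarrow> real" where
  "cover_number H = Inf {(\<Sum>v\<in>verts H. c v) | c. fractional_cover H c}"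

definition minimum_cover :: "'a set set \<Rightarrow> ('a \<Rightarrow> real) \<Rightarrow> bool" where
  "minimum_cover H c \<longleftrightarrow> fractional_cover H c \<and> (\<Sum>v\<in>verts H. c v) = cover_number H"

definition excess :: "'a set set \<Rightarrow> real" where
  "excess H = real (card H) - real (card (verts H))"

definition gamma :: "'a set set \<Rightarrow> real" where
  "gamma K = Max ((\<lambda>H. excess H / cover_number H) ` {H. H \<subseteq> K \<and> H \<noteq> {}})"

text \<open>The empty subgraph is contributing; it supplies the constant term 1 of \<open>P_poly\<close>.\<close>

definition contributing :: "'a set set \<Rightarrow> 'a set set \<Rightarrow> bool" where
  "contributing K H \<longleftrightarrow> H \<subseteq> K \<and> (\<forall>v\<in>verts H. 2 \<le> degree_in H v) \<and>
     excess H = cover_number H * gamma K"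

definition valid :: "'a set set \<Rightarrow> 'a set \<Rightarrow> bool" where
  "valid H A \<longleftrightarrow> A \<subseteq> verts H \<and>
     (\<exists>c. minimum_cover H c \<and> (\<forall>v\<in>A. c v = 1) \<and> (\<forall>v\<in>verts H - A. c v \<in> {0, 1/2}))"

text \<open>The exponents \<open>c(H) - |A|\<close> are nonnegative half-integers, and the value at \<open>w = 0\<close> with
  exponent 0 has to be 1, whereas \<open>0 powr 0 = 0\<close>.\<close>

definition rpow :: "real \<Rightarrow> real \<Rightarrow> real" where
  "rpow x a = (if a = 0 then 1 else x powr a)"

definition P_poly :: "'a set set \<Rightarrow> real \<Rightarrow> real \<Rightarrow> real" where
  "P_poly K z w = (\<Sum>H | contributing K H. \<Sum>A | valid H A.
     z ^ card A * rpow w (cover_number H - real (card A)))"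

definition rho :: "'a set set \<Rightarrow> real \<Rightarrow> real" where
  "rho K \<delta> = Inf {z + w / 2 | z w. 0 \<le> z \<and> 0 \<le> w \<and> 1 + \<delta> \<le> P_poly K z w}"

section \<open>Graphons\<close>

abbreviation unit_measure :: "real measure" where
  "unit_measure \<equiv> restrict_space lborel {0..1}"

text \<open>Only the values on the unit square matter. Borel measurability makes every section
  measurable, which regularity at \<^emph>\<open>every\<close> point needs.\<close>

definition graphon :: "(real \<Rightarrow> real \<Rightarrow> real) \<Rightarrow> bool" where
  "graphon W \<longleftrightarrow>
     (\<lambda>(x, y). W x y) \<in> borel_measurable (unit_measure \<Otimes>\<^sub>M unit_measure) \<and>
     (\<forall>x\<in>{0..1}. \<forall>y\<in>{0..1}. W x y = W y x \<and> 0 \<le> W x y \<and> W x y \<le> 1)"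

definition p_regular :: "real \<Rightarrow> (real \<Rightarrow> real \<Rightarrow> real) \<Rightarrow> bool" where
  "p_regular p W \<longleftrightarrow> (\<forall>x\<in>{0..1}. (\<integral>y. W x y \<partial>unit_measure) = p)"

text \<open>The value \<open>W(x\<^sub>u, x\<^sub>v)\<close> at the edge \<open>{u, v}\<close>, unambiguous because \<open>W\<close> is symmetric.\<close>

definition edge_value :: "(real \<Rightarrow> real \<Rightarrow> real) \<Rightarrow> ('a \<Rightarrow> real) \<Rightarrow> 'a set \<Rightarrow> real" where
  "edge_value W x e = (THE r. \<exists>u v. e = {u, v} \<and> r = W (x u) (x v))"

definition Hom :: "'a set set \<Rightarrow> (real \<Rightarrow> real \<Rightarrow> real) \<Rightarrow> real" where
  "Hom K W = (\<integral>x. (\<Prod>e\<in>K. edge_value W x e) \<partial>(Pi\<^sub>M (verts K) (\<lambda>_. unit_measure)))"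

text \<open>Since \<open>ln 0 = 0\<close>, the conventional values at \<open>x = 0\<close> and \<open>x = 1\<close> are the right ones.\<close>

definition entropy :: "real \<Rightarrow> real \<Rightarrow> real" where
  "entropy p x = x * ln (x / p) + (1 - x) * ln ((1 - x) / (1 - p))"

definition graphon_entropy :: "real \<Rightarrow> (real \<Rightarrow> real \<Rightarrow> real) \<Rightarrow> real" where
  "graphon_entropy p W = (\<integral>(x, y). entropy p (W x y) \<partial>(unit_measure \<Otimes>\<^sub>M unit_measure))"

text \<open>Taken in the extended reals, so that an infeasible problem would have value \<open>\<infinity>\<close>.\<close>

definition min_entropy :: "'a set set \<Rightarrow> real \<Rightarrow> real \<Rightarrow> ereal" where
  "min_entropy K \<delta> p =
     (INF W \<in> {W. graphon W \<and> p_regular p W \<and> (1 + \<delta>) * p ^ card K \<le> Hom K W}.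
        ereal (graphon_entropy p W))"

section \<open>Sequences of block graphons\<close>

definition block_graphon ::
    "nat \<Rightarrow> (nat \<Rightarrow> real set) \<Rightarrow> (nat \<Rightarrow> nat \<Rightarrow> real) \<Rightarrow> (real \<Rightarrow> real \<Rightarrow> real) \<Rightarrow> bool" where
  "block_graphon k S w W \<longleftrightarrow> graphon W \<and>
     (\<forall>i\<in>{1..k}. is_interval (S i)) \<and> disjoint_family_on S {1..k} \<and> (\<Union>i\<in>{1..k}. S i) = {0..1} \<and>
     (\<forall>i\<in>{1..k}. \<forall>j\<in>{1..k}. \<forall>x\<in>S i. \<forall>y\<in>S j. W x y = w i j)"

definition Hom_block ::
    "'a set set \<Rightarrow> (real \<Rightarrow> real \<Rightarrow> real) \<Rightarrow> (nat \<Rightarrow> real set) \<Rightarrow> ('a \<Rightarrow> nat) \<Rightarrow> real" where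
  "Hom_block K W S B =
     (LINT x : Pi\<^sub>E (verts K) (\<lambda>v. S (B v)) | Pi\<^sub>M (verts K) (\<lambda>_. unit_measure).
        \<Prod>e\<in>K. edge_value W x e)"

text \<open>Below, \<open>p\<close>, \<open>W\<close>, \<open>S\<close>, \<open>w\<close> are sequences indexed by \<open>n\<close>, while the number \<open>k\<close> of blocks
  does not depend on \<open>n\<close>. Hence block maps \<open>B\<close> and pairs \<open>(i, j)\<close> are fixed objects, and
  negligibility and importance are asymptotic properties of them.\<close>

definition nonnegligible ::
    "'a set set \<Rightarrow> (nat \<Rightarrow> real) \<Rightarrow> (nat \<Rightarrow> real \<Rightarrow> real \<Rightarrow> real) \<Rightarrow> nat \<Rightarrow> (nat \<Rightarrow> nat \<Rightarrow> real set) \<Rightarrow>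
     ('a \<Rightarrow> nat) \<Rightarrow> bool" where
  "nonnegligible K p W k S B \<longleftrightarrow> B \<in> verts K \<rightarrow> {1..k} \<and>
     (\<lambda>n. Hom_block K (W n) (S n) B) \<notin> o(\<lambda>n. p n ^ card K)"

definition small_block ::
    "(nat \<Rightarrow> real) \<Rightarrow> (nat \<Rightarrow> real \<Rightarrow> real \<Rightarrow> real) \<Rightarrow> (nat \<Rightarrow> nat \<Rightarrow> real set) \<Rightarrow>
     (nat \<Rightarrow> nat \<Rightarrow> nat \<Rightarrow> real) \<Rightarrow> nat \<Rightarrow> nat \<Rightarrow> bool" where
  "small_block p W S w i j \<longleftrightarrow>
     (\<lambda>n. measure lborel (S n i) * measure lborel (S n j) * w n i j)
       \<in> o(\<lambda>n. graphon_entropy (p n) (W n) / ln (ln (ln (1 / p n))))"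

definition important ::
    "(nat \<Rightarrow> real) \<Rightarrow> (nat \<Rightarrow> real \<Rightarrow> real \<Rightarrow> real) \<Rightarrow> nat \<Rightarrow> (nat \<Rightarrow> nat \<Rightarrow> real set) \<Rightarrow>
     (nat \<Rightarrow> nat \<Rightarrow> nat \<Rightarrow> real) \<Rightarrow> nat \<Rightarrow> nat \<Rightarrow> bool" where
  "important p W k S w i j \<longleftrightarrow> i \<in> {1..<k} \<and> j \<in> {1..<k} \<and> small_block p W S w i j"

definition somewhat_important_at ::
    "(nat \<Rightarrow> real) \<Rightarrow> (nat \<Rightarrow> real \<Rightarrow> real \<Rightarrow> real) \<Rightarrow> nat \<Rightarrow> (nat \<Rightarrow> nat \<Rightarrow> real set) \<Rightarrow>
     (nat \<Rightarrow> nat \<Rightarrow> nat \<Rightarrow> real) \<Rightarrow> nat \<Rightarrow> nat \<Rightarrow> nat \<Rightarrow> bool" where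
  "somewhat_important_at p W k S w n i j \<longleftrightarrow> important p W k S w i j \<and> w n i j < 1"

definition block_conditions ::
    "'a set set \<Rightarrow> (nat \<Rightarrow> real) \<Rightarrow> (nat \<Rightarrow> real \<Rightarrow> real \<Rightarrow> real) \<Rightarrow> nat \<Rightarrow> (nat \<Rightarrow> nat \<Rightarrow> real set) \<Rightarrow>
     (nat \<Rightarrow> nat \<Rightarrow> nat \<Rightarrow> real) \<Rightarrow> bool" where
  "block_conditions K p W k S w \<longleftrightarrow>
     (\<forall>\<^sub>F n in sequentially. p_regular (p n) (W n)) \<and>
     (\<forall>\<^sub>F n in sequentially. 1 - p n \<le> measure lborel (S n k)) \<and>
     (\<exists>\<eta>>0. \<forall>\<^sub>F n in sequentially. (1 + \<eta>) * p n ^ card K \<le> Hom K (W n)) \<and>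
     ((\<lambda>n. ln (real n) / real n) \<in> o(\<lambda>n. graphon_entropy (p n) (W n)) \<and>
      (\<lambda>n. graphon_entropy (p n) (W n)) \<in> o(\<lambda>n. p n ^ (2 * card K) * real n)) \<and>
     (\<forall>i\<in>{1..k}. (\<lambda>n. 1 / real n) \<in> o(\<lambda>n. measure lborel (S n i))) \<and>
     (\<forall>i\<in>{1..<k}. \<forall>j\<in>{1..<k}.
        (\<forall>\<^sub>F n in sequentially. p n \<le> w n i j) \<and>
        ((\<forall>\<^sub>F n in sequentially. w n i j = p n) \<or> small_block p W S w i j)) \<and>
     (\<forall>B. nonnegligible K p W k S B \<longrightarrow>
        (\<forall>\<^sub>F n in sequentially. is_matching
           {e \<in> K. \<exists>u v. e = {u, v} \<and> somewhat_important_at p W k S w n (B u) (B v)})) \<and>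
     (\<forall>B u v. nonnegligible K p W k S B \<longrightarrow> {u, v} \<in> K \<longrightarrow>
        \<not> important p W k S w (B u) (B v) \<longrightarrow>
        (\<exists>\<epsilon>. \<epsilon> \<longlonglongrightarrow> 0 \<and> (\<forall>\<^sub>F n in sequentially.
           (1 + \<epsilon> n) * (graphon_entropy (p n) (W n) / p n)
             \<le> measure lborel (S n (B u)) * measure lborel (S n (B v)))) \<and>
        (\<lambda>n. w n (B u) (B v) - p n) \<in> o(p)) \<and>
     (\<forall>i j. important p W k S w i j \<longrightarrow>
        (\<lambda>n. ln (real n) / real n) \<in> o(\<lambda>n. w n i j * measure lborel (S n i))) \<and>
     (\<lambda>n. Hom K (\<lambda>x y. W n x y + p n)) \<in> O(\<lambda>n. p n ^ card K)"

end

(*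
Lower bound. Split W into the part G where W > 2p and the rest. The entropy dominates both G and,
up to a small multiple of p, the deviation of the rest from p, so if it is less than eta p^(2+gamma)
then G has mass O(eta p^(2+gamma)). Expanding over the edges, Hom(K,W) exceeds p^e(K) by terms
p^(e(K)-e(F)) Hom(F,G) with F nonempty. Hall's theorem, applied to a half-integral minimum cover
of F, yields a permutation of 2c(F) vertices that moves each along an edge, while every other
vertex has a neighbour among them. Using square roots of G along the permutation, Cauchy-Schwarz
one variable at a time, and degrees at most p for the other vertices, gives
Hom(F,G) <= p^(v(F)-2c(F)) |G|^c(F), which is O(eta p^e(F)) by definition of gamma.

Upper bound. Take near-optimal z, w for rho. Join a hub of measure z p^(1+gamma) completely to
[0,p), put a clique of measure sqrt(w) p^(1+gamma/2) into [0,p), and leave the remaining weights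
essentially equal to p. A contributing H with valid A is placed by a half-integral cover: level 1
into the hub, level 1/2 into the clique, level 0 into [0,p); distinct pairs (H,A) use disjoint
blocks, so Hom(K,W) is at least about P(z,w) p^e(K).
*)
theory Submission
  imports Defs "HOL-Probability.Probability" "HOL-Real_Asymp.Real_Asymp"
begin


section \<open>Graphs\<close>

text \<open>A kernel of mass \<open>s\<close> with degrees at most \<open>p\<close> contains
  \<open>F\<close> with density at most \<open>p^(v(F)-2c(F)) s^c(F)\<close>. At
  \<open>s = p^(2+gamma)\<close> this is at most \<open>p^e(F)\<close>, with equality for the
  maximisers of the ratio, and this fixes the scale. The lower bound lacks the logarithm because the
  entropy of a weight just above \<open>2p\<close> is merely comparable to the weight, whereas
  weight 1 costs \<open>ln (1/p)\<close>. The hypothesis on the 2-core makes \<open>gamma K\<close>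
  positive, so hub and clique have measure \<open>o(p)\<close> and fit into \<open>[0, p)\<close>.
  That interval has length \<open>p\<close> so that a hub vertex, with weight 1 inside and 0
  outside, has degree exactly \<open>p\<close>; the excess degree of the other vertices of
  \<open>[0, p)\<close> is taken from their weights towards \<open>[p, 1]\<close>. This repair
  changes weights by at most \<open>p\<close> and costs \<open>O(p^(2+gamma))\<close>, which
  disappears beside the main term. The density constraint has to hold exactly, not up to
  \<open>o(1)\<close>: all losses are powers of \<open>p\<close>, and a slack of order
  \<open>1 / ln (1/p)\<close> in \<open>z\<close> and \<open>w\<close> dominates them without
  changing the limit \<open>rho\<close>.\<close>

lemma simple_graph_subset: "simple_graph K \<Longrightarrow> H \<subseteq> K \<Longrightarrow> simple_graph H"
  unfolding simple_graph_def by (auto intro: finite_subset)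

lemma finite_verts: "simple_graph K \<Longrightarrow> finite (verts K)"
  unfolding simple_graph_def by (metis card.infinite finite_Union zero_neq_numeral)

lemma simple_graph_edgeE:
  assumes "simple_graph K" "e \<in> K"
  obtains u v where "e = {u, v}" "u \<noteq> v" "u \<in> verts K" "v \<in> verts K"
  using assms unfolding simple_graph_def by (metis UnionI card_2_iff insertCI)

lemma simple_graph_no_loop: "simple_graph K \<Longrightarrow> {u, v} \<in> K \<Longrightarrow> u \<noteq> v"
  unfolding simple_graph_def by force

lemma edge_in_verts: "{u, v} \<in> K \<Longrightarrow> u \<in> verts K" "{u, v} \<in> K \<Longrightarrow> v \<in> verts K"
  by auto

lemma degree_in_eq_card_nbrs:
  assumes "simple_graph K"
  shows "degree_in K v = card {u. {v, u} \<in> K}"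
proof -
  have "bij_betw (\<lambda>u. {v, u}) {u. {v, u} \<in> K} {e \<in> K. v \<in> e}"
  proof (rule bij_betw_imageI)
    show "inj_on (\<lambda>u. {v, u}) {u. {v, u} \<in> K}"
      by (auto simp: inj_on_def doubleton_eq_iff)
    show "(\<lambda>u. {v, u}) ` {u. {v, u} \<in> K} = {e \<in> K. v \<in> e}"
    proof (intro equalityI subsetI)
      fix e assume "e \<in> {e \<in> K. v \<in> e}"
      then have e: "e \<in> K" "v \<in> e" by auto
      obtain a b where "e = {a, b}" using simple_graph_edgeE[OF assms e(1)] by metis
      with e show "e \<in> (\<lambda>u. {v, u}) ` {u. {v, u} \<in> K}"
        by (auto simp: image_iff insert_commute)
    qed auto
  qed
  then show ?thesis unfolding degree_in_def using bij_betw_same_card by fastforce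
qed

lemma finite_nbrs: "simple_graph K \<Longrightarrow> finite {u. {v, u} \<in> K}"
  by (rule finite_subset[OF _ finite_verts[of K]]) auto

lemma sum_degree_in:
  assumes "simple_graph K"
  shows "(\<Sum>v\<in>verts K. degree_in K v) = 2 * card K"
  unfolding degree_in_def
proof (rule sum_multicount)
  show "\<forall>e\<in>K. card {v \<in> verts K. v \<in> e} = 2"
  proof
    fix e assume "e \<in> K"
    then have "{v \<in> verts K. v \<in> e} = e" by auto
    then show "card {v \<in> verts K. v \<in> e} = 2"
      using assms \<open>e \<in> K\<close> by (simp add: simple_graph_def)
  qed
qed (use assms finite_verts in \<open>auto simp: simple_graph_def\<close>)

lemma degree_in_pos: "simple_graph K \<Longrightarrow> v \<in> verts K \<Longrightarrow> 1 \<le> degree_in K v"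
  unfolding degree_in_def simple_graph_def by (simp add: Suc_le_eq card_gt_0_iff) blast

section \<open>The 2-core and its minimum degree\<close>

lemma two_core_subset: "two_core K \<subseteq> K"
proof -
  have "(delete_leaves ^^ n) K \<subseteq> K" for n
    by (induction n) (auto simp: delete_leaves_def)
  then show ?thesis by (simp add: two_core_def)
qed

lemma delete_leaves_two_core:
  assumes "finite K"
  shows "delete_leaves (two_core K) = two_core K"
proof -
  let ?f = "\<lambda>n. (delete_leaves ^^ n) K"
  have fin: "finite (?f n)" for n
    by (induction n) (use assms in \<open>auto simp: delete_leaves_def\<close>)
  have sub: "delete_leaves H \<subseteq> H" for H :: "'a set set" by (auto simp: delete_leaves_def)
  \<comment> \<open>Before a fixed point is reached each round loses an edge. At
    \<open>n = card K\<close> the second alternative leaves no edge at all, and the empty graph is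
    itself a fixed point.\<close>
  have "delete_leaves (?f n) = ?f n \<or> card (?f n) + n \<le> card K" for n
  proof (induction n)
    case (Suc n)
    show ?case
    proof (cases "delete_leaves (?f n) = ?f n")
      case False
      then have "?f (Suc n) \<subset> ?f n" using sub[of "?f n"] by auto
      then have "card (?f (Suc n)) < card (?f n)" using fin psubset_card_mono by blast
      with Suc False show ?thesis by linarith
    qed simp
  qed simp
  from this[of "card K"] consider "delete_leaves (two_core K) = two_core K" | "card (two_core K) = 0"
    unfolding two_core_def by linarith
  then show ?thesis
    using fin[of "card K"] by cases (auto simp: two_core_def delete_leaves_def)
qed

lemma two_core_degree:
  assumes "simple_graph K" "v \<in> verts (two_core K)"
  shows "2 \<le> degree_in (two_core K) v"
proof -
  have sg: "simple_graph (two_core K)"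
    using simple_graph_subset[OF assms(1) two_core_subset] .
  have "degree_in (two_core K) v \<noteq> 1"
    using delete_leaves_two_core[of K] assms unfolding simple_graph_def delete_leaves_def by blast
  with degree_in_pos[OF sg assms(2)] show ?thesis by linarith
qed

section \<open>Graphs of minimum degree two: cycles and edge counts\<close>

definition is_path :: "'a set set \<Rightarrow> 'a list \<Rightarrow> bool" where
  "is_path H xs \<longleftrightarrow> distinct xs \<and> set xs \<subseteq> verts H \<and>
     (\<forall>i. Suc i < length xs \<longrightarrow> {xs ! i, xs ! Suc i} \<in> H)"

text \<open>In a longest path both neighbours of the first vertex lie on the path, and one of them
  has index at least 2. It must be the last vertex, as it would otherwise have three neighbours, so
  the path closes up to a cycle. The last conclusion says that this cycle is a whole component,
  which lets an induction split it off.\<close>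

lemma two_regular_contains_cycle:
  assumes sg: "simple_graph H" and deg: "\<forall>v\<in>verts H. degree_in H v = 2" and ne: "H \<noteq> {}"
  obtains C where "C \<subseteq> H" "C \<noteq> {}" "is_cycle C" "\<And>e. e \<in> H \<Longrightarrow> e \<inter> verts C \<noteq> {} \<Longrightarrow> e \<in> C"
proof -
  have nbrs2: "card {u. {v, u} \<in> H} = 2" if "v \<in> verts H" for v
    using deg that degree_in_eq_card_nbrs[OF sg] by metis
  obtain v0 where v0: "v0 \<in> verts H" using ne sg by (metis ex_in_conv simple_graph_edgeE)
  have bound: "length xs \<le> card (verts H)" if "is_path H xs" for xs
    using that card_mono[OF finite_verts[OF sg], of "set xs"]
    by (simp add: is_path_def distinct_card)
  have "is_path H [v0]" using v0 by (simp add: is_path_def)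
  then obtain xs where xs: "is_path H xs" and mx: "\<And>ys. is_path H ys \<Longrightarrow> length ys \<le> length xs"
    using ex_has_greatest_nat[of "is_path H" "[v0]" length "Suc (card (verts H))"] bound
    by (metis less_Suc_eq_le)
  have "xs \<noteq> []" using mx[OF \<open>is_path H [v0]\<close>] by auto
  then obtain x ys where x: "xs = x # ys" by (cases xs) auto
  have xv: "x \<in> verts H" using xs x by (auto simp: is_path_def)
  have ext: "u \<in> set xs" if "{x, u} \<in> H" for u
  proof (rule ccontr)
    assume "u \<notin> set xs"
    then have "is_path H (u # xs)"
      using xs that edge_in_verts(2)[OF that] x unfolding is_path_def
      by (auto simp: nth_Cons insert_commute split: nat.splits)
    with mx[of "u # xs"] show False by simp
  qed
  obtain a b where ab: "{u. {x, u} \<in> H} = {a, b}" "a \<noteq> b"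
    using nbrs2[OF xv] by (auto simp: card_2_iff)
  have ab1: "{x, a} \<in> H" "{x, b} \<in> H" using ab(1) by blast+
  have ab2: "a \<noteq> x" "b \<noteq> x" using ab1 simple_graph_no_loop[OF sg] by blast+
  have ab3: "a \<in> set ys" "b \<in> set ys" using ext[OF ab1(1)] ext[OF ab1(2)] ab2 x by simp_all
  note ab' = ab1 ab2 ab3
  let ?m = "length xs"
  have dist: "distinct xs" using xs by (simp add: is_path_def)
  have edge: "{xs ! i, xs ! Suc i} \<in> H" if "Suc i < ?m" for i using xs that by (simp add: is_path_def)
  \<comment> \<open>Of two different positions in \<open>ys\<close> one is positive, and positions
    in \<open>xs\<close> are larger by one.\<close>
  obtain i where i: "2 \<le> i" "i < ?m" "{x, xs ! i} \<in> H"
  proof -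
    obtain i j where ij: "ys ! i = a" "i < length ys" "ys ! j = b" "j < length ys"
      using ab' by (metis in_set_conv_nth)
    have "i \<noteq> j" using ij ab by auto
    then show ?thesis
      using that[of "Suc i"] that[of "Suc j"] ij ab' x by (cases "i = 0") auto
  qed
  have last: "Suc i = ?m"
  proof (rule ccontr)
    assume "Suc i \<noteq> ?m"
    then have i': "Suc i < ?m" using i by simp
    have "{xs ! i, xs ! (i - 1)} \<in> H" using edge[of "i - 1"] i by (simp add: insert_commute)
    moreover have "{xs ! i, xs ! Suc i} \<in> H" using edge i' by blast
    moreover have "{xs ! i, xs ! 0} \<in> H" using i x by (simp add: insert_commute)
    ultimately have "{xs ! (i - 1), xs ! Suc i, xs ! 0} \<subseteq> {u. {xs ! i, u} \<in> H}" by auto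
    then have "card {xs ! (i - 1), xs ! Suc i, xs ! 0} \<le> card {u. {xs ! i, u} \<in> H}"
      by (rule card_mono[OF finite_nbrs[OF sg]])
    moreover have "card {xs ! (i - 1), xs ! Suc i, xs ! 0} = 3"
    proof -
      have "xs ! (i - 1) \<noteq> xs ! Suc i" "xs ! (i - 1) \<noteq> xs ! 0" "xs ! Suc i \<noteq> xs ! 0"
        using i i' nth_eq_iff_index_eq[OF dist, of "i - 1" "Suc i"]
          nth_eq_iff_index_eq[OF dist, of "i - 1" 0] nth_eq_iff_index_eq[OF dist, of "Suc i" 0]
        by linarith+
      then show ?thesis by simp
    qed
    moreover have "card {u. {xs ! i, u} \<in> H} = 2"
      by (rule nbrs2[OF edge_in_verts(2)[OF i(3)]])
    ultimately show False by simp
  qed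
  have m3: "?m \<ge> 3" using i last by simp
  define C where "C = {{xs ! j, xs ! (Suc j mod ?m)} | j. j < ?m}"
  have CH: "C \<subseteq> H"
  proof
    fix e assume "e \<in> C"
    then obtain j where j: "e = {xs ! j, xs ! (Suc j mod ?m)}" "j < ?m" by (auto simp: C_def)
    show "e \<in> H"
    proof (cases "Suc j = ?m")
      case True
      with last have "j = i" by linarith
      then have "e = {xs ! i, xs ! 0}" using j True by simp
      then show ?thesis using i x by (simp add: insert_commute)
    next
      case False
      then show ?thesis using j edge by simp
    qed
  qed
  have cyc: "is_cycle C" unfolding is_cycle_def by (intro exI[of _ xs] conjI dist m3 C_def)
  have "{xs ! 0, xs ! (Suc 0 mod ?m)} \<in> C" unfolding C_def using i(2) by auto
  then have ne': "C \<noteq> {}" by blast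
  have sat: "e \<in> C" if e: "e \<in> H" "e \<inter> verts C \<noteq> {}" for e
  proof -
    obtain v where v: "v \<in> e" "v \<in> verts C" using e by auto
    then obtain j where "v = xs ! j \<or> v = xs ! (Suc j mod ?m)" "j < ?m" by (auto simp: C_def)
    then obtain j where j: "v = xs ! j" "j < ?m"
    proof -
      assume *: "\<And>j. v = xs ! j \<Longrightarrow> j < ?m \<Longrightarrow> thesis"
      have "Suc j mod ?m < ?m" using m3 by (intro mod_less_divisor) linarith
      with * show thesis using \<open>v = xs ! j \<or> v = xs ! (Suc j mod ?m)\<close> \<open>j < ?m\<close> by blast
    qed
    \<comment> \<open>The cyclic predecessor of \<open>j\<close>. Together with the successor it
      exhausts the two neighbours of \<open>v\<close> in \<open>H\<close>, so every edge of
      \<open>H\<close> at \<open>v\<close> is an edge of \<open>C\<close>.\<close>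
    define k where "k = (if j = 0 then ?m - 1 else j - 1)"
    have k: "k < ?m" "Suc k mod ?m = j" using j m3 by (auto simp: k_def)
    have c1: "{v, xs ! (Suc j mod ?m)} \<in> C" using j by (auto simp: C_def)
    have "{xs ! k, xs ! (Suc k mod ?m)} \<in> C" using k(1) by (auto simp: C_def)
    then have c2: "{v, xs ! k} \<in> C" using k j by (simp add: insert_commute)
    have "Suc j mod ?m \<noteq> k"
    proof (cases "Suc j = ?m")
      case True then show ?thesis using m3 by (auto simp: k_def)
    next
      case False
      then have "Suc j mod ?m = Suc j" using j by simp
      then show ?thesis using m3 j False by (auto simp: k_def)
    qed
    moreover have "Suc j mod ?m < ?m" using m3 by (intro mod_less_divisor) linarith
    ultimately have "xs ! (Suc j mod ?m) \<noteq> xs ! k"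
      using nth_eq_iff_index_eq[OF dist _ k(1)] by blast
    then have "card {xs ! (Suc j mod ?m), xs ! k} = 2" by simp
    moreover have "{xs ! (Suc j mod ?m), xs ! k} \<subseteq> {u. {v, u} \<in> H}" using c1 c2 CH by auto
    moreover have "card {u. {v, u} \<in> H} = 2" using v e by (intro nbrs2) blast
    ultimately have eq: "{xs ! (Suc j mod ?m), xs ! k} = {u. {v, u} \<in> H}"
      using card_subset_eq[OF finite_nbrs[OF sg]] by metis
    obtain a' b' where "e = {a', b'}" using simple_graph_edgeE[OF sg e(1)] by blast
    then obtain u where "e = {v, u}" using v(1) by (auto simp: insert_commute)
    then have "u \<in> {u. {v, u} \<in> H}" using e by simp
    then have "u = xs ! (Suc j mod ?m) \<or> u = xs ! k" using eq by auto
    then show ?thesis using \<open>e = {v, u}\<close> c1 c2 by auto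
  qed
  show ?thesis by (rule that[OF CH ne' cyc sat])
qed

text \<open>Induction on the number of edges: removing a cycle that is a whole component leaves all
  remaining degrees equal to 2.\<close>

lemma two_regular_disjoint_union_of_cycles:
  assumes "simple_graph H" "\<forall>v\<in>verts H. degree_in H v = 2"
  shows "disjoint_union_of_cycles H"
  using assms
proof (induction "card H" arbitrary: H rule: less_induct)
  case less
  show ?case
  proof (cases "H = {}")
    case True
    then show ?thesis unfolding disjoint_union_of_cycles_def by (intro exI[of _ "{}"]) simp
  next
    case False
    obtain C where C: "C \<subseteq> H" "C \<noteq> {}" "is_cycle C" "\<And>e. e \<in> H \<Longrightarrow> e \<inter> verts C \<noteq> {} \<Longrightarrow> e \<in> C"
      using two_regular_contains_cycle[OF less.prems False] by blast
    have fin: "finite H" using less.prems by (simp add: simple_graph_def)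
    have "card (H - C) < card H" using C fin by (intro psubset_card_mono) auto
    moreover have "simple_graph (H - C)" using simple_graph_subset[OF less.prems(1)] by blast
    moreover have "\<forall>v\<in>verts (H - C). degree_in (H - C) v = 2"
    proof
      fix v assume "v \<in> verts (H - C)"
      then have "v \<notin> verts C" "v \<in> verts H" using C(4) by auto
      then have "{e \<in> H - C. v \<in> e} = {e \<in> H. v \<in> e}" by auto
      then have "degree_in (H - C) v = degree_in H v" by (simp only: degree_in_def)
      then show "degree_in (H - C) v = 2"
        using bspec[OF less.prems(2) \<open>v \<in> verts H\<close>] by (rule trans)
    qed
    ultimately have "disjoint_union_of_cycles (H - C)" by (rule less.hyps)
    then obtain CC where CC: "H - C = \<Union>CC" "\<forall>C\<in>CC. is_cycle C"
      "\<forall>C\<in>CC. \<forall>D\<in>CC. C \<noteq> D \<longrightarrow> verts C \<inter> verts D = {}"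
      unfolding disjoint_union_of_cycles_def by (elim exE conjE)
    have dj: "verts C \<inter> verts D = {}" if "D \<in> CC" for D
    proof -
      have "v \<notin> verts C" if "e \<in> D" "v \<in> e" for e v
      proof
        assume "v \<in> verts C"
        then have "e \<inter> verts C \<noteq> {}" using \<open>v \<in> e\<close> by (metis IntI empty_iff)
        moreover have "e \<in> H - C" unfolding CC(1) using \<open>e \<in> D\<close> \<open>D \<in> CC\<close> by (rule UnionI[rotated])
        ultimately show False using C(4)[of e] by (metis DiffD1 DiffD2)
      qed
      then show ?thesis by (metis Int_emptyI UnionE)
    qed
    show ?thesis unfolding disjoint_union_of_cycles_def
    proof (intro exI[of _ "insert C CC"] conjI)
      show "H = \<Union> (insert C CC)" unfolding Union_insert CC(1)[symmetric] using C(1) by (rule Diff_partition[symmetric])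
      show "\<forall>C\<in>insert C CC. is_cycle C" using CC(2) C(3) by auto
      show "\<forall>C'\<in>insert C CC. \<forall>D\<in>insert C CC. C' \<noteq> D \<longrightarrow> verts C' \<inter> verts D = {}"
      proof (intro ballI impI)
        fix C' D assume "C' \<in> insert C CC" "D \<in> insert C CC" "C' \<noteq> D"
        then consider "C' = C" "D \<in> CC" | "C' \<in> CC" "D = C" | "C' \<in> CC" "D \<in> CC" by fast
        then show "verts C' \<inter> verts D = {}"
        proof cases
          case 1 then show ?thesis using dj by simp
        next
          case 2 then show ?thesis using dj[of C'] by (simp only: Int_commute)
        next
          case 3 then show ?thesis using CC(3) \<open>C' \<noteq> D\<close> by simp
        qed
      qed
    qed
  qed
qed

text \<open>Both claims come from comparing \<open>2 * card (verts H)\<close> with the degree sum,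
  which is \<open>2 * card H\<close>.\<close>

lemma min_degree_two_card:
  assumes "simple_graph H" "\<forall>v\<in>verts H. 2 \<le> degree_in H v"
  shows "card (verts H) \<le> card H"
    and "card (verts H) = card H \<Longrightarrow> \<forall>v\<in>verts H. degree_in H v = 2"
proof -
  note fin = finite_verts[OF assms(1)]
  have "(\<Sum>v\<in>verts H. 2) \<le> (\<Sum>v\<in>verts H. degree_in H v)"
    using assms(2) by (intro sum_mono) auto
  then show "card (verts H) \<le> card H" by (simp add: sum_degree_in[OF assms(1)])
  show "\<forall>v\<in>verts H. degree_in H v = 2" if "card (verts H) = card H"
  proof (rule ccontr)
    assume "\<not> ?thesis"
    then obtain v where "v \<in> verts H" "2 < degree_in H v" using assms(2) by force
    then have "(\<Sum>v\<in>verts H. 2) < (\<Sum>v\<in>verts H. degree_in H v)"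
      using assms(2) by (intro sum_strict_mono_ex1[OF fin]) auto
    then show False using that by (simp add: sum_degree_in[OF assms(1)])
  qed
qed

text \<open>The hypothesis on the 2-core enters through this lemma: a subgraph with more edges than
  vertices makes \<open>gamma K\<close> positive.\<close>

lemma two_core_excess_pos:
  assumes "simple_graph K" "\<not> disjoint_union_of_cycles (two_core K)"
  shows "0 < excess (two_core K)"
proof -
  have sg: "simple_graph (two_core K)"
    using simple_graph_subset[OF assms(1) two_core_subset] .
  note md = min_degree_two_card[OF sg, OF ballI[OF two_core_degree[OF assms(1)]]]
  have "card (verts (two_core K)) \<noteq> card (two_core K)"
    using md(2) two_regular_disjoint_union_of_cycles[OF sg] assms(2) by blast
  with md(1) show ?thesis by (simp add: excess_def)
qed

section \<open>Fractional vertex covers and \<open>\<gamma>\<close>\<close>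

lemma fractional_cover_const_1: "fractional_cover H (\<lambda>_. 1)"
  by (simp add: fractional_cover_def)

lemma fractional_coverD:
  assumes "fractional_cover H c"
  shows "v \<in> verts H \<Longrightarrow> 0 \<le> c v" and "{v, w} \<in> H \<Longrightarrow> 1 \<le> c v + c w"
  using assms unfolding fractional_cover_def by (blast, blast)

lemma bdd_below_covers: "bdd_below {(\<Sum>v\<in>verts H. c v) | c. fractional_cover H c}"
  by (rule bdd_belowI[of _ 0]) (auto simp: fractional_cover_def intro!: sum_nonneg)

lemma cover_number_le: "fractional_cover H c \<Longrightarrow> cover_number H \<le> (\<Sum>v\<in>verts H. c v)"
  unfolding cover_number_def by (intro cInf_lower bdd_below_covers) auto

lemma cover_number_greatest:
  assumes "\<And>c. fractional_cover H c \<Longrightarrow> b \<le> (\<Sum>v\<in>verts H. c v)"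
  shows "b \<le> cover_number H"
  unfolding cover_number_def
  by (rule cInf_greatest) (use fractional_cover_const_1 assms in blast)+

lemma cover_number_nonneg: "0 \<le> cover_number H"
  by (rule cover_number_greatest) (auto simp: fractional_cover_def intro!: sum_nonneg)

lemma cover_number_empty [simp]: "cover_number ({} :: 'a set set) = 0"
proof -
  have "cover_number ({} :: 'a set set) \<le> 0"
    using cover_number_le[OF fractional_cover_const_1, of "{} :: 'a set set"] by simp
  with cover_number_nonneg[of "{} :: 'a set set"] show ?thesis by linarith
qed

lemma fractional_cover_mono:
  "fractional_cover H' c \<Longrightarrow> H \<subseteq> H' \<Longrightarrow> fractional_cover H c"
  unfolding fractional_cover_def by blast

lemma cover_number_mono:
  assumes "simple_graph H'" "H \<subseteq> H'"
  shows "cover_number H \<le> cover_number H'"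
proof (rule cover_number_greatest)
  fix c assume c: "fractional_cover H' c"
  have "cover_number H \<le> (\<Sum>v\<in>verts H. c v)"
    using cover_number_le fractional_cover_mono[OF c assms(2)] by blast
  also have "\<dots> \<le> (\<Sum>v\<in>verts H'. c v)"
    using c assms(2) by (intro sum_mono2 finite_verts[OF assms(1)]) (auto simp: fractional_cover_def)
  finally show "cover_number H \<le> (\<Sum>v\<in>verts H'. c v)" .
qed

lemma cover_number_ge_1:
  assumes "simple_graph H" "H \<noteq> {}"
  shows "1 \<le> cover_number H"
proof (rule cover_number_greatest)
  fix c assume c: "fractional_cover H c"
  obtain e where "e \<in> H" using assms(2) by auto
  obtain u v where e: "e = {u, v}" "u \<noteq> v" "u \<in> verts H" "v \<in> verts H"
    using simple_graph_edgeE[OF assms(1) \<open>e \<in> H\<close>] by metis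
  have "1 \<le> (\<Sum>v\<in>{u, v}. c v)"
    using c e(1,2) \<open>e \<in> H\<close> by (simp add: fractional_cover_def)
  also have "\<dots> \<le> (\<Sum>v\<in>verts H. c v)"
    using c e by (intro sum_mono2 finite_verts[OF assms(1)]) (auto simp: fractional_cover_def)
  finally show "1 \<le> (\<Sum>v\<in>verts H. c v)" .
qed

text \<open>Shifting all values in \<open>(0, 1/2)\<close> and all values in \<open>(1/2, 1)\<close> by the same amount in
  opposite directions preserves covers, and one of the two directions does not increase the weight.\<close>

lemma half_integral_rounding:
  assumes "simple_graph H" "fractional_cover H c" "\<forall>v\<in>verts H. c v \<le> 1"
  shows "\<exists>c'. fractional_cover H c' \<and> (\<forall>v\<in>verts H. c' v \<in> {0, 1/2, 1}) \<and>
    (\<Sum>v\<in>verts H. c' v) \<le> (\<Sum>v\<in>verts H. c v)"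
  using assms(2,3)
proof (induction "card {v \<in> verts H. c v \<notin> {0, 1/2, 1}}" arbitrary: c rule: less_induct)
  case less
  let ?V = "verts H"
  define N where "N = (\<lambda>c::'a \<Rightarrow> real. {v \<in> ?V. c v \<notin> {0, 1/2, 1}})"
  have finV: "finite ?V" by (rule finite_verts[OF assms(1)])
  have finN: "finite (N c)" for c unfolding N_def by (rule finite_subset[OF _ finV]) auto
  have nn: "0 \<le> c v" if "v \<in> ?V" for v using fractional_coverD(1)[OF less.prems(1) that] .
  have cov: "1 \<le> c v + c w" if "{v, w} \<in> H" for v w
    using fractional_coverD(2)[OF less.prems(1) that] .
  have le1: "c v \<le> 1" if "v \<in> ?V" for v using less.prems(2) that by blast
  show ?case
  proof (cases "N c = {}")
    case True
    then show ?thesis using less.prems(1) by (intro exI[of _ c]) (auto simp: N_def)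
  next
    case False
    define s where "s v = (if v \<in> N c then if c v < 1/2 then 1 else -1 else 0 :: real)" for v
    \<comment> \<open>The total weight changes by \<open>\<epsilon>\<close> times the sum of
      \<open>s\<close> in one direction and by the negative of this in the other; \<open>up\<close>
      picks a direction in which it does not grow.\<close>
    define up where "up \<longleftrightarrow> (\<Sum>v\<in>?V. s v) \<le> 0"
    \<comment> \<open>The room of \<open>v\<close> before it reaches the next of the values 0, 1/2,
      1 in the chosen direction: towards 1/2 from both sides if \<open>up\<close>, away from it
      otherwise. The minimum \<open>\<epsilon>\<close> makes some vertex land on such a
      value.\<close>
    define dist where "dist v = (if up then \<bar>c v - 1/2\<bar> else min (c v) (1 - c v))" for v
    define \<epsilon> where "\<epsilon> = Min (dist ` N c)"
    define c' where "c' v = (if up then c v + \<epsilon> * s v else c v - \<epsilon> * s v)" for v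
    have NcD: "0 < c v" "c v < 1" "c v \<noteq> 1/2" "v \<in> ?V" if "v \<in> N c" for v
      using that nn[of v] le1[of v] by (auto simp: N_def)
    have eps_le: "\<epsilon> \<le> dist v" if "v \<in> N c" for v
      unfolding \<epsilon>_def using that finN by (intro Min_le) auto
    have "\<epsilon> \<in> dist ` N c" unfolding \<epsilon>_def using finN False by (intro Min_in) auto
    then obtain v0 where v0: "v0 \<in> N c" "dist v0 = \<epsilon>" by auto
    have eps_pos: "0 < \<epsilon>" using NcD[OF v0(1)] unfolding v0(2)[symmetric] dist_def by auto
    have out: "c' v = c v" if "v \<notin> N c" for v using that by (simp add: c'_def s_def)
    have low: "(if up then c' v = c v + \<epsilon> \<and> c' v \<le> 1/2 else c' v = c v - \<epsilon> \<and> 0 \<le> c' v)"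
      if "v \<in> N c" "c v < 1/2" for v
      using eps_le[OF that(1)] that by (auto simp: c'_def s_def dist_def)
    have high: "(if up then c' v = c v - \<epsilon> \<and> 1/2 \<le> c' v else c' v = c v + \<epsilon> \<and> c' v \<le> 1)"
      if "v \<in> N c" "\<not> c v < 1/2" for v
      using eps_le[OF that(1)] that by (auto simp: c'_def s_def dist_def)
    have nn': "0 \<le> c' v" if "v \<in> ?V" for v
      using nn[OF that] low[of v] high[of v] out[of v] eps_pos by (cases "v \<in> N c"; cases up) force+
    have le1': "c' v \<le> 1" if "v \<in> ?V" for v
      using le1[OF that] low[of v] high[of v] out[of v] eps_pos by (cases "v \<in> N c"; cases up) force+
    have cls: "c v = 0 \<or> c v = 1/2 \<or> c v = 1 \<or> v \<in> N c" if "v \<in> ?V" for v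
      using that by (auto simp: N_def)
    have half: "1/2 \<le> c' v" if "1/2 \<le> c v" for v
      using that out[of v] low[of v] high[of v] eps_pos by (cases "v \<in> N c"; cases up) auto
    \<comment> \<open>The partner of a value below 1/2 lies above 1/2. If it is fixed it equals 1;
      if it moves, then so does \<open>v\<close>, by the opposite amount, and the sum is
      unchanged.\<close>
    have cov1: "1 \<le> c' v + c' w" if e: "{v, w} \<in> H" and v: "c v < 1/2" for v w
    proof -
      have vw: "v \<in> ?V" "w \<in> ?V" using edge_in_verts[OF e] .
      have w: "1/2 < c w" using cov[OF e] v by linarith
      show ?thesis
      proof (cases "w \<in> N c")
        case False
        then have "c w = 1" using cls[OF vw(2)] w by auto
        then show ?thesis using out[OF False] nn'[OF vw(1)] by simp
      next
        case True
        then have "c v \<noteq> 0" using cov[OF e] NcD(2)[OF True] by linarith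
        then have vN: "v \<in> N c" using cls[OF vw(1)] v by auto
        have "\<not> c w < 1/2" using w by linarith
        then have "c' v + c' w = c v + c w"
          using low[OF vN v] high[OF True] by (cases up) simp_all
        then show ?thesis using cov[OF e] by linarith
      qed
    qed
    have cov': "1 \<le> c' v + c' w" if e: "{v, w} \<in> H" for v w
    proof -
      consider "c v < 1/2" | "c w < 1/2" | "1/2 \<le> c v" "1/2 \<le> c w" by linarith
      then show ?thesis
      proof cases
        case 1 then show ?thesis using cov1 e by blast
      next
        case 2
        have "{w, v} \<in> H" using e by (simp add: insert_commute)
        then show ?thesis using cov1[OF _ 2] by fastforce
      next
        case 3 then show ?thesis using half[of v] half[of w] by linarith
      qed
    qed
    have fc': "fractional_cover H c'" using nn' cov' by (simp add: fractional_cover_def)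
    have "c' v0 \<in> {0, 1/2, 1}"
      using low[OF v0(1)] high[OF v0(1)] v0(2) NcD[OF v0(1)]
      by (cases up; cases "c v0 < 1/2") (auto simp: dist_def)
    moreover have "N c' \<subseteq> N c" using out by (auto simp: N_def)
    ultimately have "N c' \<subset> N c" using v0(1) by (auto simp: N_def)
    then have "card (N c') < card (N c)" using finN by (rule psubset_card_mono[rotated])
    then obtain c'' where c'': "fractional_cover H c''" "\<forall>v\<in>?V. c'' v \<in> {0, 1/2, 1}"
      "(\<Sum>v\<in>?V. c'' v) \<le> (\<Sum>v\<in>?V. c' v)"
      using less.hyps[OF _ fc'] le1' unfolding N_def by blast
    have "(\<Sum>v\<in>?V. c' v) = (\<Sum>v\<in>?V. c v) + (if up then \<epsilon> else - \<epsilon>) * (\<Sum>v\<in>?V. s v)"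
      unfolding c'_def by (auto simp: sum.distrib sum_subtractf sum_negf sum_distrib_left)
    also have "\<dots> \<le> (\<Sum>v\<in>?V. c v)"
      using eps_pos unfolding up_def by (auto simp: mult_le_0_iff zero_le_mult_iff)
    finally show ?thesis using c'' by (intro exI[of _ c'']) auto
  qed
qed

text \<open>Capping a cover at 1 and rounding it yields one of finitely many covers that is no
  heavier, so the infimum is attained. Restricting to \<open>verts H\<close> is what makes this set
  of functions finite.\<close>

lemma half_integral_minimum_cover:
  assumes "simple_graph H"
  obtains c where "minimum_cover H c" "\<And>v. v \<in> verts H \<Longrightarrow> c v \<in> {0, 1/2, 1}"
proof -
  let ?V = "verts H"
  have finV: "finite ?V" by (rule finite_verts[OF assms])
  define \<C> where "\<C> = {c \<in> ?V \<rightarrow>\<^sub>E {0, 1/2, 1 :: real}. fractional_cover H c}"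
  have fin: "finite \<C>" unfolding \<C>_def using finV by (simp add: finite_PiE)
  have dom: "\<exists>c'\<in>\<C>. (\<Sum>v\<in>?V. c' v) \<le> (\<Sum>v\<in>?V. c v)" if c: "fractional_cover H c" for c
  proof -
    let ?d = "\<lambda>v. min (c v) 1"
    have "fractional_cover H ?d"
      using c unfolding fractional_cover_def by (auto simp: min_def)
    then obtain c' where c': "fractional_cover H c'" "\<forall>v\<in>?V. c' v \<in> {0, 1/2, 1}"
        "(\<Sum>v\<in>?V. c' v) \<le> (\<Sum>v\<in>?V. ?d v)"
      using half_integral_rounding[OF assms, of ?d] by auto
    let ?e = "restrict c' ?V"
    have "fractional_cover H ?e"
      using c'(1) unfolding fractional_cover_def by (auto simp: restrict_def)
    moreover have "?e \<in> ?V \<rightarrow>\<^sub>E {0, 1/2, 1}" using c'(2) by (intro restrict_PiE_iff[THEN iffD2]) blast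
    ultimately have "?e \<in> \<C>" by (simp add: \<C>_def)
    moreover have "(\<Sum>v\<in>?V. ?e v) \<le> (\<Sum>v\<in>?V. c v)"
      using c'(3) sum_mono[of ?V ?d c] by simp
    ultimately show ?thesis by blast
  qed
  then have ne: "\<C> \<noteq> {}" using fractional_cover_const_1 by blast
  define m where "m = Min ((\<lambda>c. \<Sum>v\<in>?V. c v) ` \<C>)"
  have "m \<in> (\<lambda>c. \<Sum>v\<in>?V. c v) ` \<C>" unfolding m_def using fin ne by (intro Min_in) auto
  then obtain c where c: "c \<in> \<C>" "(\<Sum>v\<in>?V. c v) = m" by auto
  have "m \<le> cover_number H"
  proof (rule cover_number_greatest)
    fix d assume "fractional_cover H d"
    then obtain c' where "c' \<in> \<C>" "(\<Sum>v\<in>?V. c' v) \<le> (\<Sum>v\<in>?V. d v)" using dom by blast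
    moreover from this(1) have "m \<le> (\<Sum>v\<in>?V. c' v)"
      unfolding m_def using fin by (intro Min_le) auto
    ultimately show "m \<le> (\<Sum>v\<in>?V. d v)" by linarith
  qed
  moreover have "fractional_cover H c" using c(1) by (simp add: \<C>_def)
  ultimately have mc: "minimum_cover H c"
    using cover_number_le[of H c] c(2) by (simp add: minimum_cover_def)
  have hv: "c v \<in> {0, 1/2, 1}" if "v \<in> ?V" for v using c(1) that unfolding \<C>_def by (blast dest: PiE_mem)
  show ?thesis by (rule that[OF mc hv])
qed

section \<open>Bounds for gamma and contributing subgraphs\<close>

lemma finite_subgraphs: "simple_graph K \<Longrightarrow> finite {H. H \<subseteq> K \<and> H \<noteq> {}}"
  by (rule finite_subset[of _ "Pow K"]) (auto simp: simple_graph_def)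

text \<open>Multiplying out the quotient gives a form that also covers the empty subgraph, where
  both sides vanish.\<close>

lemma excess_le_gamma:
  assumes "simple_graph K" "H \<subseteq> K"
  shows "excess H \<le> gamma K * cover_number H"
proof (cases "H = {}")
  case True
  then show ?thesis by (simp add: excess_def)
next
  case False
  have "excess H / cover_number H \<le> gamma K"
    unfolding gamma_def using finite_subgraphs[OF assms(1)] assms(2) False by (intro Max_ge) auto
  moreover have "0 < cover_number H"
    using cover_number_ge_1[OF simple_graph_subset[OF assms] False] by linarith
  ultimately show ?thesis by (simp add: divide_le_eq)
qed

lemma gamma_attained:
  assumes "simple_graph K" "K \<noteq> {}"
  obtains H where "H \<subseteq> K" "H \<noteq> {}" "excess H = gamma K * cover_number H"
proof -
  have "gamma K \<in> (\<lambda>H. excess H / cover_number H) ` {H. H \<subseteq> K \<and> H \<noteq> {}}"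
    unfolding gamma_def using finite_subgraphs[OF assms(1)] assms(2) by (intro Max_in) auto
  then obtain H where H: "H \<subseteq> K" "H \<noteq> {}" "gamma K = excess H / cover_number H" by auto
  have "0 < cover_number H"
    using cover_number_ge_1[OF simple_graph_subset[OF assms(1) H(1)] H(2)] by linarith
  then show ?thesis using that H by simp
qed

lemma gamma_pos:
  assumes "simple_graph K" "H \<subseteq> K" "0 < excess H"
  shows "0 < gamma K"
proof -
  have "0 < gamma K * cover_number H" using excess_le_gamma[OF assms(1,2)] assms(3) by linarith
  then show ?thesis using cover_number_nonneg[of H] by (auto simp: zero_less_mult_iff)
qed

text \<open>Two vertices carry at most one edge, which leaves no positive excess.\<close>

lemma card_verts_ge_3:
  assumes "simple_graph H" "0 < excess H"
  shows "3 \<le> card (verts H)"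
proof (rule ccontr)
  assume "\<not> ?thesis"
  then have c2: "card (verts H) \<le> 2" by simp
  have "e = verts H" if "e \<in> H" for e
    using that assms(1) c2 finite_verts[OF assms(1)]
    by (intro card_seteq) (auto simp: simple_graph_def)
  then have "H \<subseteq> {verts H}" by auto
  then have "card H \<le> 1" using card_mono[of "{verts H}" H] by simp
  moreover have "H \<noteq> {}" using assms(2) by (auto simp: excess_def)
  then obtain e where "e \<in> H" by auto
  then have "2 \<le> card (verts H)"
    using card_mono[OF finite_verts[OF assms(1)], of e] assms(1) by (auto simp: simple_graph_def)
  ultimately show False using assms(2) by (simp add: excess_def)
qed

text \<open>A subgraph attaining the maximum has cover number at least 1 and at least three
  vertices, so \<open>gamma K\<close> is at most its excess, which is at most
  \<open>card K - 3\<close>. The bound makes the growth exponent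
  \<open>2 * card K - 2 - gamma K\<close> at least \<open>2 + gamma K\<close>.\<close>

lemma gamma_le:
  assumes "simple_graph K" "H\<^sub>0 \<subseteq> K" "0 < excess H\<^sub>0"
  shows "gamma K \<le> real (card K) - 3"
proof -
  have pos: "0 < gamma K" using gamma_pos[OF assms] .
  have "K \<noteq> {}" using assms(2,3) by (auto simp: excess_def)
  then obtain H where H: "H \<subseteq> K" "H \<noteq> {}" "excess H = gamma K * cover_number H"
    using gamma_attained[OF assms(1)] by metis
  note sg = simple_graph_subset[OF assms(1) H(1)]
  have c1: "1 \<le> cover_number H" using cover_number_ge_1[OF sg H(2)] .
  then have "gamma K * 1 \<le> excess H" unfolding H(3) using pos by (intro mult_left_mono) auto
  moreover from this have "0 < excess H" using pos by linarith
  then have "3 \<le> card (verts H)" using card_verts_ge_3[OF sg] by blast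
  moreover have "card H \<le> card K"
    using H(1) assms(1) by (intro card_mono) (auto simp: simple_graph_def)
  ultimately show ?thesis by (simp add: excess_def)
qed

text \<open>Among the subgraphs attaining the maximum, one with fewest edges has minimum degree two:
  deleting a leaf loses one edge and at least one vertex, so the excess does not fall, while the
  cover number does not grow.\<close>

lemma exists_contributing:
  assumes "simple_graph K" "H\<^sub>0 \<subseteq> K" "0 < excess H\<^sub>0"
  obtains H where "contributing K H" "H \<noteq> {}"
proof -
  have pos: "0 < gamma K" using gamma_pos[OF assms] .
  have Kne: "K \<noteq> {}" using assms(2,3) by (auto simp: excess_def)
  define Q where "Q H \<longleftrightarrow> H \<subseteq> K \<and> H \<noteq> {} \<and> excess H = gamma K * cover_number H" for H
  have "\<exists>H. Q H" unfolding Q_def using gamma_attained[OF assms(1) Kne] by metis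
  then obtain H where H: "Q H" "\<And>H'. Q H' \<Longrightarrow> card H \<le> card H'"
    using ex_has_least_nat[of Q _ card] by metis
  have HK: "H \<subseteq> K" "H \<noteq> {}" "excess H = gamma K * cover_number H" using H(1) by (simp_all add: Q_def)
  note sg = simple_graph_subset[OF assms(1) HK(1)]
  have fin: "finite H" using sg by (simp add: simple_graph_def)
  have "2 \<le> degree_in H v" if v: "v \<in> verts H" for v
  proof (rule ccontr)
    assume "\<not> 2 \<le> degree_in H v"
    then have "degree_in H v = 1" using degree_in_pos[OF sg v] by linarith
    then obtain e where e: "{e \<in> H. v \<in> e} = {e}" unfolding degree_in_def by (auto simp: card_1_singleton_iff)
    then have eH: "e \<in> H" by auto
    let ?H' = "H - {e}"
    have "v \<notin> verts ?H'" using e by auto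
    then have "verts ?H' \<subseteq> verts H - {v}" by auto
    then have "card (verts ?H') \<le> card (verts H - {v})"
      using finite_verts[OF sg] by (intro card_mono) auto
    also have "\<dots> = card (verts H) - 1" using v by simp
    finally have "card (verts ?H') + 1 \<le> card (verts H)"
      using v finite_verts[OF sg] card_gt_0_iff[of "verts H"] by (cases "card (verts H)") auto
    moreover have cH': "card ?H' + 1 = card H" using eH fin card_Suc_Diff1 by fastforce
    ultimately have ex: "excess H \<le> excess ?H'" unfolding excess_def by linarith
    have "0 < excess H"
      unfolding HK(3) using pos cover_number_ge_1[OF sg HK(2)] by (intro mult_pos_pos) auto
    \<comment> \<open>Positive excess survives the deletion, whereas the empty graph has excess
      0.\<close>
    have "?H' \<noteq> {}"
    proof
      assume "?H' = {}"
      then have "excess ?H' = 0" by (simp only: excess_def) simp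
      with ex \<open>0 < excess H\<close> show False by linarith
    qed
    moreover have "excess ?H' = gamma K * cover_number ?H'"
    proof (rule antisym)
      show "excess ?H' \<le> gamma K * cover_number ?H'"
        using HK(1) by (intro excess_le_gamma[OF assms(1)]) auto
      have "gamma K * cover_number ?H' \<le> gamma K * cover_number H"
        using pos by (intro mult_left_mono cover_number_mono[OF sg]) auto
      then show "gamma K * cover_number ?H' \<le> excess ?H'" using ex HK(3) by linarith
    qed
    ultimately have "Q ?H'" using HK(1) by (auto simp: Q_def)
    with H(2)[of ?H'] cH' show False by linarith
  qed
  then have "contributing K H"
    unfolding contributing_def using HK by (simp add: mult.commute)
  then show ?thesis using that HK(2) by blast
qed

lemma contributing_empty: "contributing K {}"
  by (simp add: contributing_def excess_def)

text \<open>A contributing subgraph is recovered from the level sets of a half-integral minimum cover: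
  if two of them had the same level sets, the union would have too large a ratio, because a vertex
  of \<open>H'\<close> outside \<open>H\<close> is covered with value 0 and so sends at least two edges of \<open>H'\<close> into \<open>H\<close>.\<close>

lemma contributing_subset_of_same_levels:
  assumes K: "simple_graph K" and \<gamma>: "0 \<le> gamma K"
    and H: "contributing K H" and H': "contributing K H'"
    and c: "minimum_cover H c" and c': "fractional_cover H' c'"
    and half': "\<And>v. v \<in> verts H' \<Longrightarrow> c' v \<in> {0, 1/2, 1}"
    and one: "\<And>v. v \<in> verts H' \<Longrightarrow> c' v = 1 \<Longrightarrow> v \<in> verts H \<and> c v = 1"
    and halves: "\<And>v. v \<in> verts H' \<Longrightarrow> c' v = 1/2 \<Longrightarrow> v \<in> verts H \<and> c v = 1/2"
  shows "H' \<subseteq> H"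
proof -
  let ?V = "verts H" and ?V' = "verts H'"
  have HK: "H \<subseteq> K" "H' \<subseteq> K" using H H' by (auto simp: contributing_def)
  note sg = simple_graph_subset[OF K HK(1)] and sg' = simple_graph_subset[OF K HK(2)]
  have fin: "finite H" "finite H'" using sg sg' by (simp_all add: simple_graph_def)
  note finV = finite_verts[OF sg] and finV' = finite_verts[OF sg']
  have fc: "fractional_cover H c" using c by (simp add: minimum_cover_def)
  define d where "d v = (if v \<in> ?V then c v else 0)" for v
  have d_nn: "0 \<le> d v" for v using fractional_coverD(1)[OF fc] by (simp add: d_def del: Union_iff)
  have d_ge: "c' v \<le> d v" if vV: "v \<in> ?V'" for v
  proof -
    consider "c' v = 0" | "c' v = 1/2" | "c' v = 1" using half'[OF vV] by blast
    then show ?thesis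
      using d_nn[of v] one[OF vV] halves[OF vV] by cases (simp_all add: d_def del: Union_iff)
  qed
  have "fractional_cover (H \<union> H') d"
    unfolding fractional_cover_def
  proof (intro conjI ballI allI impI)
    fix v w assume "{v, w} \<in> H \<union> H'"
    then consider "{v, w} \<in> H" | "{v, w} \<in> H'" by blast
    then show "1 \<le> d v + d w"
    proof cases
      case 1
      then show ?thesis using fc edge_in_verts[OF 1] by (simp add: d_def fractional_cover_def)
    next
      case 2
      then have "1 \<le> c' v + c' w" using c' by (simp add: fractional_cover_def)
      then show ?thesis using d_ge[OF edge_in_verts(1)[OF 2]] d_ge[OF edge_in_verts(2)[OF 2]] by linarith
    qed
  qed (use d_nn in auto)
  then have "cover_number (H \<union> H') \<le> (\<Sum>v\<in>verts (H \<union> H'). d v)" by (rule cover_number_le)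
  also have "\<dots> = (\<Sum>v\<in>?V. d v)"
    using finV finV' by (intro sum.mono_neutral_right) (auto simp: d_def)
  also have "\<dots> = cover_number H" using c by (simp add: d_def minimum_cover_def)
  finally have "gamma K * cover_number (H \<union> H') \<le> gamma K * cover_number H"
    using \<gamma> by (rule mult_left_mono)
  moreover have "excess (H \<union> H') \<le> gamma K * cover_number (H \<union> H')"
    using HK by (intro excess_le_gamma[OF K]) auto
  moreover have "excess H = gamma K * cover_number H" using H by (simp add: contributing_def mult.commute)
  ultimately have ex: "excess (H \<union> H') \<le> excess H" by linarith
  define N where "N = ?V' - ?V"
  define E where "E = H' - H"
  have finN: "finite N" and finE: "finite E" using finV' fin by (auto simp: N_def E_def)
  have "card (H \<union> H') = card H + card E"
    using fin unfolding E_def by (metis Un_Diff_cancel card_Un_disjoint finite_Diff Diff_disjoint)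
  moreover have "card (verts (H \<union> H')) = card ?V + card N"
    using finV finV' unfolding N_def by (metis Un_Diff_cancel card_Un_disjoint finite_Diff Diff_disjoint Union_Un_distrib)
  ultimately have EN: "card E \<le> card N" using ex by (simp add: excess_def)
  \<comment> \<open>Counting incidences between new vertices and new edges: at least two per vertex
    and at most one per edge. With \<open>card E <= card N\<close> both sets are empty.\<close>
  have "2 * card N = (\<Sum>v\<in>N. 2)" by simp
  also have "\<dots> \<le> (\<Sum>v\<in>N. card {e \<in> E. v \<in> e})"
  proof (rule sum_mono)
    fix v assume v: "v \<in> N"
    then have "{e \<in> E. v \<in> e} = {e \<in> H'. v \<in> e}" by (auto simp: N_def E_def)
    moreover have "2 \<le> degree_in H' v" using H' v by (auto simp: contributing_def N_def)
    ultimately show "2 \<le> card {e \<in> E. v \<in> e}" by (simp add: degree_in_def)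
  qed
  also have "\<dots> = (\<Sum>e\<in>E. card {v \<in> N. v \<in> e})"
    using finN finE by (intro sum_multicount_gen) auto
  also have "\<dots> \<le> (\<Sum>e\<in>E. 1)"
  proof (rule sum_mono)
    fix e assume e: "e \<in> E"
    then have eH': "e \<in> H'" by (simp add: E_def)
    obtain a b where ab: "e = {a, b}" "a \<in> ?V'" "b \<in> ?V'" using simple_graph_edgeE[OF sg' eH'] by metis
    have "1 \<le> c' a + c' b" using c' eH' ab(1) by (simp add: fractional_cover_def)
    then have "c' a \<noteq> 0 \<or> c' b \<noteq> 0" by auto
    then have "a \<in> ?V \<or> b \<in> ?V" using half'[OF ab(2)] half'[OF ab(3)] one halves ab(2,3) by blast
    then have "{v \<in> N. v \<in> e} \<subseteq> {a} \<or> {v \<in> N. v \<in> e} \<subseteq> {b}" using ab(1) by (auto simp: N_def)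
    then have "card {v \<in> N. v \<in> e} \<le> card {a} \<or> card {v \<in> N. v \<in> e} \<le> card {b}"
      using card_mono[of "{a}"] card_mono[of "{b}"] by blast
    then show "card {v \<in> N. v \<in> e} \<le> 1" by simp
  qed
  finally have "card N \<le> 0" "card E = 0" using EN by simp_all
  then show ?thesis using finE by (auto simp: E_def)
qed

section \<open>Permutations along edges\<close>

text \<open>Induction on \<open>card I\<close>. If some proper nonempty \<open>S\<close> has exactly
  \<open>card S\<close> neighbours, then \<open>S\<close> and \<open>I - S\<close> are matched
  separately, the latter outside the neighbours of \<open>S\<close>. Otherwise every proper nonempty
  subset has a neighbour to spare, and any choice for one index preserves the condition for the
  others.\<close>

lemma Hall:
  assumes "finite I" "\<And>i. i \<in> I \<Longrightarrow> finite (N i)" "\<And>S. S \<subseteq> I \<Longrightarrow> card S \<le> card (\<Union>(N ` S))"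
  shows "\<exists>f. inj_on f I \<and> (\<forall>i\<in>I. f i \<in> N i)"
  using assms
proof (induction "card I" arbitrary: I N rule: less_induct)
  case less
  note hall = less.prems(3)
  show ?case
  proof (cases "\<exists>S. S \<subset> I \<and> S \<noteq> {} \<and> card (\<Union>(N ` S)) = card S")
    case True
    then obtain S where S: "S \<subset> I" "S \<noteq> {}" "card (\<Union>(N ` S)) = card S" by blast
    have finS: "finite S" using S(1) less.prems(1) finite_subset by blast
    have "card S < card I" using S(1) less.prems(1) by (simp add: psubset_card_mono)
    then have "\<exists>f. inj_on f S \<and> (\<forall>i\<in>S. f i \<in> N i)"
      using S(1) less.prems(2) hall finS by (intro less.hyps) auto
    then obtain f where f: "inj_on f S" "\<forall>i\<in>S. f i \<in> N i" by blast
    let ?U = "\<Union>(N ` S)"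
    have finU: "finite ?U" using finS S(1) less.prems(2) by auto
    have "card (I - S) < card I"
      using S less.prems(1) by (intro psubset_card_mono) auto
    moreover have "card T \<le> card (\<Union>((\<lambda>i. N i - ?U) ` T))" if T: "T \<subseteq> I - S" for T
    proof -
      have finT: "finite T" using T less.prems(1) finite_subset by blast
      have finUT: "finite (\<Union>((\<lambda>i. N i - ?U) ` T))"
        using finT T less.prems(2) by auto
      have "card T + card S = card (T \<union> S)" using T finT finS by (subst card_Un_disjoint) auto
      also have "\<dots> \<le> card (\<Union>(N ` (T \<union> S)))" using T S(1) by (intro hall) auto
      also have "\<Union>(N ` (T \<union> S)) = \<Union>((\<lambda>i. N i - ?U) ` T) \<union> ?U" by auto
      also have "card \<dots> = card (\<Union>((\<lambda>i. N i - ?U) ` T)) + card ?U"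
        using finUT finU by (intro card_Un_disjoint) auto
      finally show ?thesis using S(3) by linarith
    qed
    ultimately have "\<exists>g. inj_on g (I - S) \<and> (\<forall>i\<in>I - S. g i \<in> N i - ?U)"
      using less.prems(1,2) by (intro less.hyps) auto
    then obtain g where g: "inj_on g (I - S)" "\<forall>i\<in>I - S. g i \<in> N i - ?U" by blast
    let ?h = "\<lambda>i. if i \<in> S then f i else g i"
    have "inj_on ?h I"
    proof (rule inj_onI)
      fix i j assume ij: "i \<in> I" "j \<in> I" "?h i = ?h j"
      have fU: "f i \<in> ?U" if "i \<in> S" for i using f(2) that by blast
      have gU: "g i \<notin> ?U" if "i \<in> I - S" for i using g(2) that by blast
      show "i = j"
        using ij fU[of i] fU[of j] gU[of i] gU[of j] inj_onD[OF f(1)] inj_onD[OF g(1)]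
        by (cases "i \<in> S"; cases "j \<in> S") auto
    qed
    moreover have "\<forall>i\<in>I. ?h i \<in> N i" using f g by auto
    ultimately show ?thesis by blast
  next
    case False
    show ?thesis
    proof (cases "I = {}")
      case True then show ?thesis by simp
    next
      case I: False
      then obtain i where i: "i \<in> I" by auto
      have "card {i} \<le> card (\<Union>(N ` {i}))" using i by (intro hall) auto
      then have "N i \<noteq> {}" by auto
      then obtain x where x: "x \<in> N i" by auto
      have "card (I - {i}) < card I" using i less.prems(1) by (simp add: card_gt_0_iff I)
      moreover have "card T \<le> card (\<Union>((\<lambda>j. N j - {x}) ` T))" if T: "T \<subseteq> I - {i}" for T
      proof (cases "T = {}")
        case False': False
        have finT: "finite T" using T less.prems(1) finite_subset by blast
        have "card T \<le> card (\<Union>(N ` T))" "card (\<Union>(N ` T)) \<noteq> card T"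
          using T i False False' hall[of T] by blast+
        then have "card T \<le> card (\<Union>(N ` T)) - 1" by linarith
        also have "\<dots> \<le> card (\<Union>(N ` T) - {x})"
          using card_Diff1_le[of "\<Union>(N ` T)" x] by (simp add: card_Diff_singleton_if)
        also have "\<Union>(N ` T) - {x} = \<Union>((\<lambda>j. N j - {x}) ` T)" by auto
        finally show ?thesis .
      qed simp
      ultimately have "\<exists>g. inj_on g (I - {i}) \<and> (\<forall>j\<in>I - {i}. g j \<in> N j - {x})"
        using less.prems(1,2) by (intro less.hyps) auto
      then obtain g where g: "inj_on g (I - {i})" "\<forall>j\<in>I - {i}. g j \<in> N j - {x}" by blast
      have "inj_on (g(i := x)) I"
        using g unfolding inj_on_def by (auto split: if_splits)
      moreover have "\<forall>j\<in>I. (g(i := x)) j \<in> N j" using g x by auto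
      ultimately show ?thesis by blast
    qed
  qed
qed


lemma cover_edge_values:
  assumes "fractional_cover F c" "\<And>v. v \<in> verts F \<Longrightarrow> c v \<in> {0, 1/2, 1::real}" "{u, w} \<in> F"
  shows "c u = 1 \<or> c w = 1 \<or> (c u = 1/2 \<and> c w = 1/2)"
  using fractional_coverD(2)[OF assms(1,3)] assms(2)[OF edge_in_verts(1)[OF assms(3)]]
    assms(2)[OF edge_in_verts(2)[OF assms(3)]] by auto

text \<open>Minimality of the cover, put into the shape of Hall's condition: the shifted cover
  differs in weight by half of \<open>card T - card S\<close>, so this cannot be negative.\<close>

lemma minimum_cover_shift:
  assumes F: "simple_graph F" and c: "minimum_cover F c"
    and S: "S \<subseteq> verts F" and T: "T \<subseteq> verts F"
    and cov: "fractional_cover F (\<lambda>v. c v - (if v \<in> S then 1/2 else 0) + (if v \<in> T then 1/2 else 0))"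
  shows "card S \<le> card T"
proof -
  note finV = finite_verts[OF F]
  have *: "(\<Sum>v\<in>verts F. if v \<in> A then 1/2 else 0 :: real) = card A / 2" if "A \<subseteq> verts F" for A
    using that finV by (simp add: sum.If_cases Int_absorb1 del: Union_iff)
  have "cover_number F \<le> (\<Sum>v\<in>verts F. c v - (if v \<in> S then 1/2 else 0) + (if v \<in> T then 1/2 else 0))"
    by (rule cover_number_le[OF cov])
  also have "\<dots> = (\<Sum>v\<in>verts F. c v) - card S / 2 + card T / 2"
    by (simp add: sum.distrib sum_subtractf *[OF S] *[OF T])
  finally show ?thesis using c by (simp add: minimum_cover_def)
qed

text \<open>The level sets \<open>V\<^sub>1\<close> and \<open>V\<^sub>h\<close> of a half-integral minimum cover satisfy Hall's condition towards
  the level set of 0 and towards \<open>V\<^sub>h\<close>, since otherwise shifting by 1/2 gives a lighter cover. The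
  two matchings form the permutation; its orbits play the part of an optimal fractional matching.\<close>

lemma permutation_along_edges:
  assumes F: "simple_graph F"
  obtains Y \<sigma> where "Y \<subseteq> verts F" "bij_betw \<sigma> Y Y" "\<And>v. v \<in> Y \<Longrightarrow> {v, \<sigma> v} \<in> F"
    "real (card Y) = 2 * cover_number F" "\<And>u. u \<in> verts F - Y \<Longrightarrow> \<exists>w\<in>Y. {u, w} \<in> F"
proof -
  let ?V = "verts F"
  note finV = finite_verts[OF F]
  obtain c where c: "minimum_cover F c" and vals: "\<And>v. v \<in> ?V \<Longrightarrow> c v \<in> {0, 1/2, 1}"
    using half_integral_minimum_cover[OF F] by metis
  have fc: "fractional_cover F c" using c by (simp add: minimum_cover_def)
  note edge = cover_edge_values[OF fc vals]
  define V1 where "V1 = {v \<in> ?V. c v = 1}"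
  define Vh where "Vh = {v \<in> ?V. c v = 1/2}"
  define V0 where "V0 = {v \<in> ?V. c v = 0}"
  have fin: "finite V1" "finite Vh" "finite V0" using finV by (auto simp: V1_def Vh_def V0_def simp del: Union_iff)
  have V: "?V = V1 \<union> Vh \<union> V0" using vals by (auto simp: V1_def Vh_def V0_def)
  have subs: "V1 \<subseteq> ?V" "Vh \<subseteq> ?V" "V0 \<subseteq> ?V" using V by auto
  have dj: "V1 \<inter> Vh = {}" "V1 \<inter> V0 = {}" "Vh \<inter> V0 = {}" by (auto simp: V1_def Vh_def V0_def)
  have cv: "c v = 1" if "v \<in> V1" for v using that by (simp add: V1_def)
  have cvh: "c v = 1/2" if "v \<in> Vh" for v using that by (simp add: Vh_def)
  have cv0: "c v = 0" if "v \<in> V0" for v using that by (simp add: V0_def)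
  have inV: "c u = 1 \<Longrightarrow> u \<in> V1" "c u = 1/2 \<Longrightarrow> u \<in> Vh" "c u = 0 \<Longrightarrow> u \<in> V0" if "u \<in> ?V" for u
    using that by (simp_all add: V1_def Vh_def V0_def)
  \<comment> \<open>Lowering \<open>S\<close> from 1 and raising its neighbours of value 0 leaves a
    cover: edges from \<open>S\<close> to values 1/2 or 1 have room, and those to 0 are repaired by
    \<open>?T\<close>.\<close>
  have hall1: "card S \<le> card (\<Union>((\<lambda>v. {u \<in> V0. {v, u} \<in> F}) ` S))" if S: "S \<subseteq> V1" for S
  proof (rule minimum_cover_shift[OF F c])
    let ?T = "\<Union>((\<lambda>v. {u \<in> V0. {v, u} \<in> F}) ` S)"
    let ?c = "\<lambda>v. c v - (if v \<in> S then 1/2 else 0) + (if v \<in> ?T then 1/2 else 0)"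
    show "S \<subseteq> ?V" using S subs by blast
    show T: "?T \<subseteq> ?V" using subs by blast
    have nn: "0 \<le> ?c v" if "v \<in> ?V" for v
      using fractional_coverD(1)[OF fc that] S cv[of v] by auto
    have c1: "1/2 \<le> ?c v" if "c v = 1" for v using that by auto
    have c2: "1/2 \<le> ?c v" if "c v = 1/2" for v
    proof -
      have "v \<notin> S" using S cv that by auto
      then show ?thesis using that by auto
    qed
    have half: "1 \<le> ?c v + ?c w" if e: "{v, w} \<in> F" and v: "c v = 1" for v w
    proof -
      note vw = edge_in_verts[OF e]
      consider "c w = 1 \<or> c w = 1/2" | "c w = 0" using vals[OF vw(2)] by auto
      then show ?thesis
      proof cases
        case 1 then show ?thesis using c1[OF v] c1[of w] c2[of w] by linarith
      next
        case 2
        then have wS: "w \<notin> S" using S cv by force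
        have "w \<in> ?T" if "v \<in> S" using inV(3)[OF vw(2) 2] e that by auto
        then show ?thesis using v 2 wS by auto
      qed
    qed
    show "fractional_cover F ?c"
      unfolding fractional_cover_def
    proof (intro conjI ballI allI impI)
      fix v w assume e: "{v, w} \<in> F"
      then have e': "{w, v} \<in> F" by (simp add: insert_commute)
      consider "c v = 1" | "c w = 1" | "c v = 1/2" "c w = 1/2" using edge[OF _ e] by blast
      then show "1 \<le> ?c v + ?c w"
      proof cases
        case 1 then show ?thesis by (rule half[OF e])
      next
        case 2 then show ?thesis using half[OF e'] by linarith
      next
        case 3 then show ?thesis using c2[of v] c2[of w] by linarith
      qed
    qed (rule nn)
  qed
  \<comment> \<open>The other endpoint of an edge at \<open>S\<close> has value 1, which suffices by
    itself, or value 1/2, and then it lies in \<open>?T\<close>.\<close>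
  have hallh: "card S \<le> card (\<Union>((\<lambda>v. {u \<in> Vh. {v, u} \<in> F}) ` S))" if S: "S \<subseteq> Vh" for S
  proof (rule minimum_cover_shift[OF F c])
    let ?T = "\<Union>((\<lambda>v. {u \<in> Vh. {v, u} \<in> F}) ` S)"
    let ?c = "\<lambda>v. c v - (if v \<in> S then 1/2 else 0) + (if v \<in> ?T then 1/2 else 0)"
    show "S \<subseteq> ?V" using S subs by blast
    show T: "?T \<subseteq> ?V" using subs by blast
    have nn: "0 \<le> ?c v" if "v \<in> ?V" for v
      using fractional_coverD(1)[OF fc that] S cvh[of v] by auto
    have one: "1 \<le> ?c v" if "c v = 1" for v
    proof -
      have "v \<notin> S" using S cvh that by force
      then show ?thesis using that by auto
    qed
    show "fractional_cover F ?c"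
      unfolding fractional_cover_def
    proof (intro conjI ballI allI impI)
      fix v w assume e: "{v, w} \<in> F"
      then have e': "{w, v} \<in> F" by (simp add: insert_commute)
      note vw = edge_in_verts[OF e]
      consider "c v = 1" | "c w = 1" | "c v = 1/2" "c w = 1/2" using edge[OF _ e] by blast
      then show "1 \<le> ?c v + ?c w"
      proof cases
        case 1 then show ?thesis using one[of v] nn[OF vw(2)] by linarith
      next
        case 2 then show ?thesis using one[of w] nn[OF vw(1)] by linarith
      next
        case 3
        have "w \<in> ?T" if "v \<in> S" using inV(2)[OF vw(2) 3(2)] e that by auto
        moreover have "v \<in> ?T" if "w \<in> S" using inV(2)[OF vw(1) 3(1)] e' that by auto
        ultimately show ?thesis using 3 by auto
      qed
    qed (rule nn)
  qed
  obtain f1 where f1: "inj_on f1 V1" "\<And>v. v \<in> V1 \<Longrightarrow> f1 v \<in> V0 \<and> {v, f1 v} \<in> F"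
    using Hall[of V1 "\<lambda>v. {u \<in> V0. {v, u} \<in> F}", OF fin(1) _ hall1] fin(3) by auto
  obtain f2 where f2: "inj_on f2 Vh" "\<And>v. v \<in> Vh \<Longrightarrow> f2 v \<in> Vh \<and> {v, f2 v} \<in> F"
    using Hall[of Vh "\<lambda>v. {u \<in> Vh. {v, u} \<in> F}", OF fin(2) _ hallh] fin(2) by auto
  let ?I = "f1 ` V1"
  define Y where "Y = Vh \<union> (V1 \<union> ?I)"
  \<comment> \<open>\<open>f2\<close> permutes \<open>Vh\<close>, being an injective map of a finite
    set into itself; \<open>f1\<close> is turned into transpositions of \<open>V1\<close> with its
    image in \<open>V0\<close>.\<close>
  define \<sigma> where "\<sigma> v = (if v \<in> Vh then f2 v else if v \<in> V1 then f1 v else inv_into V1 f1 v)" for v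
  have I0: "?I \<subseteq> V0" using f1(2) by auto
  have bh: "bij_betw f2 Vh Vh"
    using f2 fin(2) by (intro bij_betw_imageI endo_inj_surj) auto
  have b1: "bij_betw f1 V1 ?I" using f1(1) by (rule inj_on_imp_bij_betw)
  have b2: "bij_betw (inv_into V1 f1) ?I V1" using b1 by (rule bij_betw_inv_into)
  have e1: "\<sigma> v = f2 v" if "v \<in> Vh" for v using that by (simp add: \<sigma>_def)
  have e2: "\<sigma> v = f1 v" if "v \<in> V1" for v using that dj by (auto simp: \<sigma>_def)
  have e3: "\<sigma> v = inv_into V1 f1 v" if "v \<in> ?I" for v
  proof -
    have "v \<in> V0" using I0 that by (rule subsetD)
    then have "v \<notin> Vh" "v \<notin> V1" using dj by auto
    then show ?thesis by (simp add: \<sigma>_def)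
  qed
  have "bij_betw \<sigma> Vh Vh" using bh e1 by (simp cong: bij_betw_cong)
  moreover have "bij_betw \<sigma> V1 ?I" using b1 e2 by (simp cong: bij_betw_cong)
  moreover have "bij_betw \<sigma> ?I V1" using b2 e3 bij_betw_cong[of ?I \<sigma> "inv_into V1 f1" V1] by blast
  moreover have d1: "V1 \<inter> ?I = {}" "Vh \<inter> (V1 \<union> ?I) = {}" using I0 dj by blast+
  ultimately have "bij_betw \<sigma> Y (Vh \<union> (?I \<union> V1))"
    unfolding Y_def by (intro bij_betw_combine) auto
  then have bij: "bij_betw \<sigma> Y Y" unfolding Y_def by (simp add: Un_commute)
  have YV: "Y \<subseteq> ?V" unfolding Y_def using subs I0 by blast
  have edges: "{v, \<sigma> v} \<in> F" if "v \<in> Y" for v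
  proof -
    consider "v \<in> Vh" | "v \<in> V1" | "v \<in> ?I" using \<open>v \<in> Y\<close> unfolding Y_def by blast
    then show ?thesis
    proof cases
      case 1 then show ?thesis using f2(2) e1 by simp
    next
      case 2 then show ?thesis using f1(2) e2 by simp
    next
      case 3
      then have "inv_into V1 f1 v \<in> V1" "f1 (inv_into V1 f1 v) = v"
        by (auto intro: inv_into_into f_inv_into_f)
      then show ?thesis using f1(2)[of "inv_into V1 f1 v"] e3[OF 3] by (simp add: insert_commute)
    qed
  qed
  have "card Y = card Vh + (card V1 + card ?I)"
    unfolding Y_def using fin d1 by (simp add: card_Un_disjoint)
  then have cY: "card Y = card Vh + 2 * card V1" using card_image[OF f1(1)] by simp
  have "cover_number F = (\<Sum>v\<in>?V. c v)" using c by (simp add: minimum_cover_def)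
  also have "\<dots> = (\<Sum>v\<in>V1. c v) + (\<Sum>v\<in>Vh. c v) + (\<Sum>v\<in>V0. c v)"
    unfolding V using fin dj by (subst sum.union_disjoint; simp add: Int_Un_distrib2)+
  also have "(\<Sum>v\<in>Vh. c v) = (\<Sum>v\<in>Vh. 1/2)" by (rule sum.cong[OF refl cvh])
  also have "(\<Sum>v\<in>V1. c v) + (\<Sum>v\<in>Vh. 1/2) + (\<Sum>v\<in>V0. c v) = card V1 + card Vh / 2" using cv cv0 by simp
  finally have card: "real (card Y) = 2 * cover_number F" using cY by simp
  \<comment> \<open>A vertex outside \<open>Y\<close> has value 0, so all its neighbours have value
    1 and lie in \<open>V1\<close>.\<close>
  have rest: "\<exists>w\<in>Y. {u, w} \<in> F" if u: "u \<in> ?V - Y" for u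
  proof -
    have uV: "u \<in> ?V" using u by blast
    have "u \<notin> Vh" "u \<notin> V1" using u by (auto simp: Y_def)
    then have "c u = 0" using vals[OF uV] inV[OF uV] by blast
    obtain e where e: "e \<in> F" "u \<in> e" using uV by blast
    obtain a b where "e = {a, b}" using simple_graph_edgeE[OF F e(1)] by metis
    then obtain w where w: "{u, w} \<in> F" using e by (auto simp: insert_commute)
    have "c w = 1" using edge[OF _ w] \<open>c u = 0\<close> by auto
    then have "w \<in> Y" using inV(1)[OF edge_in_verts(2)[OF w]] by (simp add: Y_def)
    then show ?thesis using w by blast
  qed
  show ?thesis by (rule that[OF YV bij edges card rest])
qed

section \<open>Products of a kernel over the edges of a graph\<close>

lemma ennreal_le_of_square_le:
  assumes "(a::ennreal)\<^sup>2 \<le> b\<^sup>2" shows "a \<le> b"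
proof (rule ccontr)
  assume "\<not> a \<le> b"
  then have ba: "b < a" by simp
  then obtain r where r: "b = ennreal r" "0 \<le> r" by (cases b) auto
  show False
  proof (cases a)
    case (real q)
    then have "r < q" using ba r by (simp add: ennreal_less_iff)
    then have "r\<^sup>2 < q\<^sup>2" using r by (simp add: power_strict_mono)
    moreover have "q\<^sup>2 \<le> r\<^sup>2" using assms real r by (simp add: ennreal_power ennreal_le_iff)
    ultimately show False by simp
  next
    case top
    then have "top \<le> ennreal (r\<^sup>2)" using assms r by (simp add: ennreal_power power2_eq_square[of top] ennreal_top_mult)
    then show False by (simp add: top_unique)
  qed
qed

text \<open>Cauchy-Schwarz with the norms bounded through their squares, so that no square root in
  \<open>ennreal\<close> appears.\<close>

lemma nn_integral_mult_le:
  assumes [measurable]: "f \<in> borel_measurable M" "g \<in> borel_measurable M"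
    and "(\<integral>\<^sup>+x. (f x)\<^sup>2 \<partial>M) \<le> a\<^sup>2" "(\<integral>\<^sup>+x. (g x)\<^sup>2 \<partial>M) \<le> b\<^sup>2"
  shows "(\<integral>\<^sup>+x. f x * g x \<partial>M) \<le> a * b"
proof (rule ennreal_le_of_square_le)
  have "(\<integral>\<^sup>+x. f x * g x \<partial>M)\<^sup>2 \<le> (\<integral>\<^sup>+x. (f x)\<^sup>2 \<partial>M) * (\<integral>\<^sup>+x. (g x)\<^sup>2 \<partial>M)"
    by (rule Cauchy_Schwarz_nn_integral) auto
  also have "\<dots> \<le> (a * b)\<^sup>2" unfolding power_mult_distrib using assms(3,4) by (rule mult_mono) auto
  finally show "(\<integral>\<^sup>+x. f x * g x \<partial>M)\<^sup>2 \<le> (a * b)\<^sup>2" .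
qed

text \<open>The factor of \<open>v\<close> once the variables outside \<open>I\<close> have been integrated out: \<open>h\<close> dominates
  the \<open>L\<^sup>2\<close> norms of the sections of \<open>g\<close>, and \<open>t\<close> the \<open>L\<^sup>2\<close> norm of \<open>h\<close>.\<close>

definition orbit_factor ::
    "('a \<Rightarrow> 'a) \<Rightarrow> ('b \<Rightarrow> 'b \<Rightarrow> ennreal) \<Rightarrow> ('b \<Rightarrow> ennreal) \<Rightarrow> ennreal \<Rightarrow> 'a set \<Rightarrow> 'a \<Rightarrow> ('a \<Rightarrow> 'b) \<Rightarrow> ennreal" where
  "orbit_factor \<sigma> g h t I v x =
    (if v \<in> I then (if \<sigma> v \<in> I then g (x v) (x (\<sigma> v)) else h (x v))
     else (if \<sigma> v \<in> I then h (x (\<sigma> v)) else t))"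

lemma measurable_two_components:
  assumes "(\<lambda>(x, y). g x y) \<in> measurable (M \<Otimes>\<^sub>M M) N" "u \<in> I" "v \<in> I"
  shows "(\<lambda>x. g (x u) (x v)) \<in> measurable (Pi\<^sub>M I (\<lambda>_. M)) N"
proof -
  have "(\<lambda>x. (x u, x v)) \<in> measurable (Pi\<^sub>M I (\<lambda>_. M)) (M \<Otimes>\<^sub>M M)"
    using assms(2,3) by (intro measurable_Pair measurable_component_singleton)
  from measurable_compose[OF this assms(1)] show ?thesis by simp
qed

lemma measurable_orbit_factor:
  assumes "(\<lambda>(x, y). g x y) \<in> borel_measurable (M \<Otimes>\<^sub>M M)" "h \<in> borel_measurable M"
  shows "orbit_factor \<sigma> g h t I v \<in> borel_measurable (Pi\<^sub>M I (\<lambda>_. M))"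
proof -
  have h: "(\<lambda>x. h (x w)) \<in> borel_measurable (Pi\<^sub>M I (\<lambda>_. M))" if "w \<in> I" for w
    using measurable_compose[OF measurable_component_singleton[OF that] assms(2)] by simp
  show ?thesis
    unfolding orbit_factor_def
    using h measurable_two_components[OF assms(1)] by (cases "v \<in> I"; cases "\<sigma> v \<in> I") simp_all
qed

text \<open>Each variable occurs in two factors, the one of its vertex and the one of the preimage
  of that vertex under \<open>\<sigma>\<close>. Cauchy-Schwarz in this variable alone separates them
  into \<open>L^2\<close> norms of sections, and treating all variables leaves one \<open>t\<close>
  per vertex. The induction runs over the set \<open>I\<close> of variables not yet integrated
  out.\<close>

lemma permutation_product_integral_le:
  fixes g :: "'b \<Rightarrow> 'b \<Rightarrow> ennreal"
  assumes M: "sigma_finite_measure M" and fin: "finite Y" and bij: "bij_betw \<sigma> Y Y"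
    and nofix: "\<And>v. v \<in> Y \<Longrightarrow> \<sigma> v \<noteq> v"
    and gm: "(\<lambda>(x, y). g x y) \<in> borel_measurable (M \<Otimes>\<^sub>M M)"
    and sym: "\<And>a b. a \<in> space M \<Longrightarrow> b \<in> space M \<Longrightarrow> g a b = g b a"
    and hm: "h \<in> borel_measurable M"
    and h: "\<And>a. a \<in> space M \<Longrightarrow> (\<integral>\<^sup>+b. (g a b)\<^sup>2 \<partial>M) \<le> (h a)\<^sup>2"
    and t: "(\<integral>\<^sup>+a. (h a)\<^sup>2 \<partial>M) \<le> t\<^sup>2"
  shows "(\<integral>\<^sup>+x. (\<Prod>v\<in>Y. g (x v) (x (\<sigma> v))) \<partial>Pi\<^sub>M Y (\<lambda>_. M)) \<le> t ^ card Y"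
proof -
  interpret sigma_finite_measure M by (rule M)
  interpret product_sigma_finite "\<lambda>_. M" by unfold_locales
  let ?f = "orbit_factor \<sigma> g h t"
  note fm = measurable_orbit_factor[OF gm hm]
  have g1: "(\<lambda>y. g y b) \<in> borel_measurable M" "(\<lambda>y. g b y) \<in> borel_measurable M" if "b \<in> space M" for b
    using measurable_Pair2[OF gm that] measurable_Pair1[OF gm that] by simp_all
  have "(\<integral>\<^sup>+x. (\<Prod>v\<in>Y. ?f I v x) \<partial>Pi\<^sub>M I (\<lambda>_. M)) \<le> t ^ card Y" if "finite I" "I \<subseteq> Y" for I
    using that
  proof (induction I)
    case empty
    show ?case by (subst nn_integral_empty) (simp_all add: orbit_factor_def)
  next
    case (insert y I)
    let ?J = "insert y I"
    have y: "y \<in> Y" and I: "I \<subseteq> Y" using insert.prems by auto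
    obtain u where u: "u \<in> Y" "\<sigma> u = y" using bij y by (metis bij_betw_imp_surj_on imageE)
    have uy: "u \<noteq> y" using nofix[OF u(1)] u(2) by blast
    have inner: "(\<integral>\<^sup>+b. (\<Prod>v\<in>Y. ?f ?J v (x(y := b))) \<partial>M) \<le> (\<Prod>v\<in>Y. ?f I v x)"
      if x: "x \<in> space (Pi\<^sub>M I (\<lambda>_. M))" for x
    proof -
      have xs: "x i \<in> space M" if "i \<in> I" for i
        using x that by (auto simp: space_PiM)
      have split: "(\<Prod>v\<in>Y. F v) = F y * F u * (\<Prod>v\<in>Y - {y, u}. F v)" for F :: "'a \<Rightarrow> ennreal"
      proof -
        have "Y = insert y (insert u (Y - {y, u}))" using y u by auto
        then have "(\<Prod>v\<in>Y. F v) = (\<Prod>v\<in>insert y (insert u (Y - {y, u})). F v)" by simp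
        also have "\<dots> = F y * (F u * (\<Prod>v\<in>Y - {y, u}. F v))" using fin uy by simp
        finally show ?thesis by (simp add: mult.assoc)
      qed
      \<comment> \<open>\<open>A\<close> and \<open>B\<close> are the two factors that depend on the
        new variable, \<open>C\<close> collects the others. Where the second variable of such a
        factor has already been integrated out, \<open>h\<close> stands in for
        \<open>g\<close>.\<close>
      define C where "C = (\<Prod>v\<in>Y - {y, u}. ?f I v x)"
      define A where "A b = (if \<sigma> y \<in> I then g b (x (\<sigma> y)) else h b)" for b
      define B where "B b = (if u \<in> I then g (x u) b else h b)" for b
      have Am: "A \<in> borel_measurable M" unfolding A_def by (cases "\<sigma> y \<in> I") (simp_all add: g1 hm xs)
      have Bm: "B \<in> borel_measurable M" unfolding B_def by (cases "u \<in> I") (simp_all add: g1 hm xs)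
      have "(\<Prod>v\<in>Y. ?f ?J v (x(y := b))) = A b * B b * C" for b
      proof -
        have "?f ?J y (x(y := b)) = A b" using nofix[OF y] by (simp add: orbit_factor_def A_def)
        moreover have "?f ?J u (x(y := b)) = B b" using u uy by (simp add: orbit_factor_def B_def)
        moreover have "(\<Prod>v\<in>Y - {y, u}. ?f ?J v (x(y := b))) = C"
          unfolding C_def
        proof (rule prod.cong[OF refl])
          fix v assume v: "v \<in> Y - {y, u}"
          then have "\<sigma> v \<noteq> y" using u bij by (metis DiffD1 DiffD2 bij_betw_imp_inj_on inj_onD insertCI)
          then show "?f ?J v (x(y := b)) = ?f I v x" using v by (simp add: orbit_factor_def)
        qed
        ultimately show ?thesis by (simp add: split)
      qed
      then have "(\<integral>\<^sup>+b. (\<Prod>v\<in>Y. ?f ?J v (x(y := b))) \<partial>M) = (\<integral>\<^sup>+b. A b * B b \<partial>M) * C"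
        using Am Bm by (simp add: nn_integral_multc)
      also have "(\<integral>\<^sup>+b. A b * B b \<partial>M) \<le> ?f I y x * ?f I u x"
      proof (rule nn_integral_mult_le[OF Am Bm])
        show "(\<integral>\<^sup>+b. (A b)\<^sup>2 \<partial>M) \<le> (?f I y x)\<^sup>2"
        proof (cases "\<sigma> y \<in> I")
          case True
          have "(\<integral>\<^sup>+b. (A b)\<^sup>2 \<partial>M) = (\<integral>\<^sup>+b. (g (x (\<sigma> y)) b)\<^sup>2 \<partial>M)"
            using True sym xs by (intro nn_integral_cong) (simp add: A_def)
          then show ?thesis using h[OF xs[OF True]] True insert.hyps by (simp add: orbit_factor_def)
        next
          case False
          then show ?thesis using t insert.hyps by (simp add: A_def orbit_factor_def)
        qed
        show "(\<integral>\<^sup>+b. (B b)\<^sup>2 \<partial>M) \<le> (?f I u x)\<^sup>2"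
          using t h xs u insert.hyps by (cases "u \<in> I") (simp_all add: B_def orbit_factor_def)
      qed
      finally show ?thesis unfolding split[of "\<lambda>v. ?f I v x"] C_def by (simp add: mult_right_mono)
    qed
    have "(\<integral>\<^sup>+x. (\<Prod>v\<in>Y. ?f ?J v x) \<partial>Pi\<^sub>M ?J (\<lambda>_. M)) =
        (\<integral>\<^sup>+x. (\<integral>\<^sup>+b. (\<Prod>v\<in>Y. ?f ?J v (x(y := b))) \<partial>M) \<partial>Pi\<^sub>M I (\<lambda>_. M))"
      using insert.hyps by (intro product_nn_integral_insert borel_measurable_prod_ennreal fm)
    also have "\<dots> \<le> (\<integral>\<^sup>+x. (\<Prod>v\<in>Y. ?f I v x) \<partial>Pi\<^sub>M I (\<lambda>_. M))"
      by (rule nn_integral_mono[OF inner])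
    also have "\<dots> \<le> t ^ card Y" using insert.IH I by blast
    finally show ?case .
  qed
  from this[OF fin order_refl]
  have "(\<integral>\<^sup>+x. (\<Prod>v\<in>Y. ?f Y v x) \<partial>Pi\<^sub>M Y (\<lambda>_. M)) \<le> t ^ card Y" .
  moreover have "(\<Prod>v\<in>Y. ?f Y v x) = (\<Prod>v\<in>Y. g (x v) (x (\<sigma> v)))" for x
    using bij by (intro prod.cong) (auto simp: orbit_factor_def bij_betw_apply)
  ultimately show ?thesis by simp
qed

text \<open>A variable in \<open>R\<close> occurs in one pendant factor and integrates to at most
  \<open>P\<close>; the other variables of \<open>Z\<close> do not occur and integrate to 1 over a
  probability space. For this \<open>\<Phi>\<close> has to depend on the coordinates in
  \<open>Y\<close> only.\<close>

lemma pendant_product_integral_le: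
  fixes G :: "'b \<Rightarrow> 'b \<Rightarrow> ennreal"
  assumes M: "prob_space M" and fin: "finite Z" "finite Y" and dj: "Z \<inter> Y = {}"
    and R: "R \<subseteq> Z" and a: "\<And>u. u \<in> R \<Longrightarrow> a u \<in> Y"
    and Gm: "(\<lambda>(x, y). G x y) \<in> borel_measurable (M \<Otimes>\<^sub>M M)"
    and deg: "\<And>b. b \<in> space M \<Longrightarrow> (\<integral>\<^sup>+y. G y b \<partial>M) \<le> P"
    and Phim: "\<And>V. Y \<subseteq> V \<Longrightarrow> \<Phi> \<in> borel_measurable (Pi\<^sub>M V (\<lambda>_. M))"
    and Phi: "\<And>x x'. (\<And>v. v \<in> Y \<Longrightarrow> x v = x' v) \<Longrightarrow> \<Phi> x = \<Phi> x'"
  shows "(\<integral>\<^sup>+x. \<Phi> x * (\<Prod>u\<in>R. G (x u) (x (a u))) \<partial>Pi\<^sub>M (Z \<union> Y) (\<lambda>_. M))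
    \<le> P ^ card R * (\<integral>\<^sup>+x. \<Phi> x \<partial>Pi\<^sub>M Y (\<lambda>_. M))"
  using fin(1) dj R a
proof (induction Z arbitrary: R)
  case empty
  then show ?case by simp
next
  case (insert z Z)
  interpret prob_space M by (rule M)
  interpret product_sigma_finite "\<lambda>_. M" by unfold_locales
  let ?R = "R - {z}"
  let ?F = "\<lambda>x. \<Phi> x * (\<Prod>u\<in>?R. G (x u) (x (a u)))"
  have zY: "z \<notin> Y" and dj: "Z \<inter> Y = {}" and RZ: "?R \<subseteq> Z" using insert.prems by auto
  have finR: "finite R" using insert.prems(2) insert.hyps(1) finite_subset by blast
  have Gm': "(\<lambda>x. \<Prod>u\<in>S. G (x u) (x (a u))) \<in> borel_measurable (Pi\<^sub>M V (\<lambda>_. M))"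
    if "S \<subseteq> R" "S \<union> Y \<subseteq> V" for S V
    using that insert.prems(3) by (intro borel_measurable_prod_ennreal measurable_two_components[OF Gm]) auto
  have F: "?F (x(z := b)) = ?F x" for x b
  proof -
    have "\<Phi> (x(z := b)) = \<Phi> x" using zY by (intro Phi) auto
    moreover have "(\<Prod>u\<in>?R. G ((x(z := b)) u) ((x(z := b)) (a u))) = (\<Prod>u\<in>?R. G (x u) (x (a u)))"
      using zY insert.prems(3) by (intro prod.cong) auto
    ultimately show ?thesis by simp
  qed
  have IH: "(\<integral>\<^sup>+x. ?F x \<partial>Pi\<^sub>M (Z \<union> Y) (\<lambda>_. M)) \<le> P ^ card ?R * (\<integral>\<^sup>+x. \<Phi> x \<partial>Pi\<^sub>M Y (\<lambda>_. M))"
    using insert.prems by (intro insert.IH[OF dj RZ]) auto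
  have "(\<integral>\<^sup>+x. \<Phi> x * (\<Prod>u\<in>R. G (x u) (x (a u))) \<partial>Pi\<^sub>M (insert z Z \<union> Y) (\<lambda>_. M)) =
      (\<integral>\<^sup>+x. (\<integral>\<^sup>+b. \<Phi> (x(z := b)) * (\<Prod>u\<in>R. G ((x(z := b)) u) ((x(z := b)) (a u))) \<partial>M) \<partial>Pi\<^sub>M (Z \<union> Y) (\<lambda>_. M))"
    using insert.hyps fin(2) zY insert.prems(2) unfolding Un_insert_left
    by (intro product_nn_integral_insert borel_measurable_times_ennreal Phim Gm') auto
  also have "\<dots> \<le> (\<integral>\<^sup>+x. (if z \<in> R then P else 1) * ?F x \<partial>Pi\<^sub>M (Z \<union> Y) (\<lambda>_. M))"
  proof (rule nn_integral_mono)
    fix x assume x: "x \<in> space (Pi\<^sub>M (Z \<union> Y) (\<lambda>_. M))"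
    show "(\<integral>\<^sup>+b. \<Phi> (x(z := b)) * (\<Prod>u\<in>R. G ((x(z := b)) u) ((x(z := b)) (a u))) \<partial>M)
      \<le> (if z \<in> R then P else 1) * ?F x"
    proof (cases "z \<in> R")
      case True
      have az: "a z \<in> Y" using insert.prems(3) True by blast
      then have "x (a z) \<in> space M" using x by (auto simp: space_PiM)
      then have d: "(\<integral>\<^sup>+b. G b (x (a z)) \<partial>M) \<le> P" and m: "(\<lambda>b. G b (x (a z))) \<in> borel_measurable M"
        using deg measurable_Pair1[OF Gm] by auto
      have "\<Phi> (x(z := b)) * (\<Prod>u\<in>R. G ((x(z := b)) u) ((x(z := b)) (a u))) = G b (x (a z)) * ?F x" for b
      proof -
        have "a z \<noteq> z" using az zY by auto
        then have "(\<Prod>u\<in>R. G ((x(z := b)) u) ((x(z := b)) (a u))) =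
            G b (x (a z)) * (\<Prod>u\<in>?R. G ((x(z := b)) u) ((x(z := b)) (a u)))"
          by (subst prod.remove[OF finR True]) simp
        then show ?thesis unfolding F[of x b, symmetric] by (simp only: mult_ac)
      qed
      then show ?thesis using True d m by (simp add: nn_integral_multc mult_right_mono)
    next
      case False
      then have "?R = R" by auto
      then show ?thesis using False F[of x] by (simp add: emeasure_space_1)
    qed
  qed
  also have "\<dots> = (if z \<in> R then P else 1) * (\<integral>\<^sup>+x. ?F x \<partial>Pi\<^sub>M (Z \<union> Y) (\<lambda>_. M))"
    using RZ by (intro nn_integral_cmult borel_measurable_times_ennreal Phim Gm') auto
  also have "\<dots> \<le> (if z \<in> R then P else 1) * (P ^ card ?R * (\<integral>\<^sup>+x. \<Phi> x \<partial>Pi\<^sub>M Y (\<lambda>_. M)))"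
    by (rule mult_left_mono[OF IH]) simp
  also have "\<dots> = P ^ card R * (\<integral>\<^sup>+x. \<Phi> x \<partial>Pi\<^sub>M Y (\<lambda>_. M))"
  proof (cases "z \<in> R")
    case True
    have "card R = Suc (card ?R)" by (rule card.remove[OF finR True])
    from True show ?thesis by (simp only: \<open>card R = Suc (card ?R)\<close> if_True power_Suc mult.assoc)
  qed simp
  finally show ?case .
qed

text \<open>An edge \<open>{v, \<sigma> v}\<close> arises from at most its two endpoints, so the
  square roots assigned to them multiply to at least \<open>q e\<close>. The pendant edges differ
  from these and from each other because \<open>u\<close> lies outside \<open>Y\<close>. All
  remaining edges are dropped, as \<open>q <= 1\<close>.\<close>

lemma prod_edges_le_permutation_product:
  fixes q :: "'a set \<Rightarrow> real"
  assumes fin: "finite F" "finite Y" "finite R" and q: "\<And>e. e \<in> F \<Longrightarrow> 0 \<le> q e \<and> q e \<le> 1"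
    and Y: "\<And>v. v \<in> Y \<Longrightarrow> \<sigma> v \<in> Y \<and> {v, \<sigma> v} \<in> F"
    and R: "\<And>u. u \<in> R \<Longrightarrow> u \<notin> Y \<and> a u \<in> Y \<and> {u, a u} \<in> F"
  shows "(\<Prod>e\<in>F. q e) \<le> (\<Prod>v\<in>Y. sqrt (q {v, \<sigma> v})) * (\<Prod>u\<in>R. q {u, a u})"
proof -
  let ?e = "\<lambda>v. {v, \<sigma> v}" and ?r = "\<lambda>u. {u, a u}"
  have sub: "?e ` Y \<subseteq> F" "?r ` R \<subseteq> F" using Y R by auto
  have dj: "?e ` Y \<inter> ?r ` R = {}"
  proof -
    have False if "v \<in> Y" "u \<in> R" "?e v = ?r u" for u v
    proof -
      have "u \<in> {v, \<sigma> v}" using that(3) by blast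
      then show False using Y[OF that(1)] R[OF that(2)] that(1) by auto
    qed
    then show ?thesis by blast
  qed
  have injr: "inj_on ?r R"
  proof (rule inj_onI)
    fix u u' assume u: "u \<in> R" "u' \<in> R" "?r u = ?r u'"
    then have "u \<in> {u', a u'}" by blast
    moreover have "u \<noteq> a u'" using R[OF u(1)] R[OF u(2)] by auto
    ultimately show "u = u'" by simp
  qed
  have "(\<Prod>e\<in>F. q e) = (\<Prod>e\<in>?e ` Y \<union> ?r ` R. q e) * (\<Prod>e\<in>F - (?e ` Y \<union> ?r ` R). q e)"
    using sub fin(1) by (subst prod.subset_diff[of "?e ` Y \<union> ?r ` R" F]) (auto simp: mult.commute)
  also have "\<dots> \<le> (\<Prod>e\<in>?e ` Y \<union> ?r ` R. q e) * 1"
    using q sub by (intro mult_left_mono prod_le_1 prod_nonneg) blast+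
  also have "\<dots> = (\<Prod>e\<in>?e ` Y. q e) * (\<Prod>u\<in>R. q (?r u))"
    using fin dj by (simp add: prod.union_disjoint prod.reindex[OF injr])
  also have "\<dots> \<le> (\<Prod>v\<in>Y. sqrt (q (?e v))) * (\<Prod>u\<in>R. q (?r u))"
  proof (rule mult_right_mono)
    show "0 \<le> (\<Prod>u\<in>R. q (?r u))" using q R by (intro prod_nonneg) auto
    have "(\<Prod>e\<in>?e ` Y. q e) \<le> (\<Prod>e\<in>?e ` Y. \<Prod>v | v \<in> Y \<and> ?e v = e. sqrt (q (?e v)))"
    proof (rule prod_mono)
      fix e assume e: "e \<in> ?e ` Y"
      then have qe: "0 \<le> q e" "q e \<le> 1" using sub q by blast+
      let ?S = "{v \<in> Y. ?e v = e}"
      have "?S \<subseteq> e" by blast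
      moreover have "finite e" "card e \<le> 2" using e by (auto simp: card_insert_if)
      ultimately have "card ?S \<le> 2" using card_mono[of e ?S] by linarith
      have "q e = sqrt (q e) ^ 2" using qe by simp
      also have "\<dots> \<le> sqrt (q e) ^ card ?S"
        using qe \<open>card ?S \<le> 2\<close> by (intro power_decreasing) auto
      also have "\<dots> = (\<Prod>v\<in>?S. sqrt (q (?e v)))" by simp
      finally show "0 \<le> q e \<and> q e \<le> (\<Prod>v\<in>?S. sqrt (q (?e v)))" using qe by simp
    qed
    also have "\<dots> = (\<Prod>v\<in>Y. sqrt (q (?e v)))" by (rule prod.image_gen[OF fin(2), symmetric])
    finally show "(\<Prod>e\<in>?e ` Y. q e) \<le> (\<Prod>v\<in>Y. sqrt (q (?e v)))" .
  qed
  finally show ?thesis .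
qed

section \<open>Edge values and edge products on the unit cube\<close>

lemma prob_space_unit: "prob_space unit_measure"
  by (rule prob_spaceI) (simp add: emeasure_restrict_space space_restrict_space)

lemma space_unit: "space unit_measure = {0..1}"
  by (simp add: space_restrict_space)

lemma edge_value_doubleton: "W (x u) (x v) = W (x v) (x u) \<Longrightarrow> edge_value W x {u, v} = W (x u) (x v)"
  unfolding edge_value_def by (rule the_equality) (auto simp: doubleton_eq_iff)

lemma PiM_unit_apply: "x \<in> space (Pi\<^sub>M V (\<lambda>_. unit_measure)) \<Longrightarrow> v \<in> V \<Longrightarrow> x v \<in> {0..1}"
  by (auto simp: space_PiM space_unit)

lemma edge_value_on_cube:
  assumes "\<And>a b. a \<in> {0..1} \<Longrightarrow> b \<in> {0..1} \<Longrightarrow> W a b = W b a"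
    and "x \<in> space (Pi\<^sub>M V (\<lambda>_. unit_measure))" "u \<in> V" "v \<in> V"
  shows "edge_value W x {u, v} = W (x u) (x v)"
  using assms(1)[OF PiM_unit_apply[OF assms(2,3)] PiM_unit_apply[OF assms(2,4)]]
  by (rule edge_value_doubleton)

lemma measurable_edge_value:
  assumes K: "simple_graph K" "e \<in> K" "verts K \<subseteq> V"
    and sym: "\<And>a b. a \<in> {0..1} \<Longrightarrow> b \<in> {0..1} \<Longrightarrow> W a b = W b a"
    and m: "(\<lambda>(x, y). W x y) \<in> borel_measurable (unit_measure \<Otimes>\<^sub>M unit_measure)"
  shows "(\<lambda>x. edge_value W x e) \<in> borel_measurable (Pi\<^sub>M V (\<lambda>_. unit_measure))"
proof -
  obtain u v where e: "e = {u, v}" "u \<in> verts K" "v \<in> verts K" using simple_graph_edgeE[OF K(1,2)] by metis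
  have uv: "u \<in> V" "v \<in> V" using e K(3) by auto
  have "(\<lambda>x. W (x u) (x v)) \<in> borel_measurable (Pi\<^sub>M V (\<lambda>_. unit_measure))"
    by (rule measurable_two_components[OF m uv])
  then show ?thesis
    unfolding e(1) by (subst measurable_cong[OF edge_value_on_cube[where W = W, OF sym _ uv]])
qed

text \<open>Stated for an arbitrary property \<open>P\<close> of values so that one lemma serves all
  range statements.\<close>

lemma edge_value_bounds:
  assumes K: "simple_graph K" "e \<in> K" "verts K \<subseteq> V"
    and sym: "\<And>a b. a \<in> {0..1} \<Longrightarrow> b \<in> {0..1} \<Longrightarrow> W a b = W b a"
    and P: "\<And>a b. a \<in> {0..1} \<Longrightarrow> b \<in> {0..1} \<Longrightarrow> P (W a b)"
    and x: "x \<in> space (Pi\<^sub>M V (\<lambda>_. unit_measure))"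
  shows "P (edge_value W x e)"
proof -
  obtain u v where e: "e = {u, v}" "u \<in> verts K" "v \<in> verts K" using simple_graph_edgeE[OF K(1,2)] by metis
  have uv: "u \<in> V" "v \<in> V" using e K(3) by auto
  have "edge_value W x {u, v} = W (x u) (x v)"
    by (rule edge_value_on_cube[OF _ x uv]) (rule sym)
  then show ?thesis
    unfolding e(1) using P[OF PiM_unit_apply[OF x uv(1)] PiM_unit_apply[OF x uv(2)]] by simp
qed

text \<open>The orbit estimate is applied to the root \<open>g\<close> of \<open>G\<close>: the
  squared norms of its sections are the degrees \<open>d\<close>, so \<open>h\<close> is the root of
  \<open>d\<close> and \<open>t\<close> the root of the total mass \<open>s\<close>. The number
  \<open>k\<close> is the size of the permuted set.\<close>

lemma edge_product_integral_le:
  fixes G :: "real \<Rightarrow> real \<Rightarrow> real"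
  assumes F: "simple_graph F" and V: "finite V" "verts F \<subseteq> V"
    and m: "(\<lambda>(x, y). G x y) \<in> borel_measurable (unit_measure \<Otimes>\<^sub>M unit_measure)"
    and sym: "\<And>a b. a \<in> {0..1} \<Longrightarrow> b \<in> {0..1} \<Longrightarrow> G a b = G b a"
    and bd: "\<And>a b. a \<in> {0..1} \<Longrightarrow> b \<in> {0..1} \<Longrightarrow> 0 \<le> G a b \<and> G a b \<le> 1"
    and deg: "\<And>a. a \<in> {0..1} \<Longrightarrow> (\<integral>\<^sup>+b. ennreal (G a b) \<partial>unit_measure) \<le> ennreal p"
    and tot: "(\<integral>\<^sup>+a. \<integral>\<^sup>+b. ennreal (G a b) \<partial>unit_measure \<partial>unit_measure) \<le> ennreal s"
    and ps: "0 \<le> p" "0 \<le> s"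
  obtains k where "real k = 2 * cover_number F" "k \<le> card (verts F)"
    "(\<integral>\<^sup>+x. (\<Prod>e\<in>F. ennreal (edge_value G x e)) \<partial>Pi\<^sub>M V (\<lambda>_. unit_measure))
      \<le> ennreal (p ^ (card (verts F) - k) * sqrt s ^ k)"
proof -
  let ?U = unit_measure
  interpret prob_space ?U by (rule prob_space_unit)
  have sU: "space ?U = {0..1}" by (rule space_unit)
  have finF: "finite F" using F by (simp add: simple_graph_def)
  have finVF: "finite (verts F)" by (rule finite_verts[OF F])
  obtain Y \<sigma> where Y: "Y \<subseteq> verts F" "bij_betw \<sigma> Y Y" "\<And>v. v \<in> Y \<Longrightarrow> {v, \<sigma> v} \<in> F"
    "real (card Y) = 2 * cover_number F" "\<And>u. u \<in> verts F - Y \<Longrightarrow> \<exists>w\<in>Y. {u, w} \<in> F"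
    using permutation_along_edges[OF F] by metis
  define R where "R = verts F - Y"
  obtain a where a: "\<And>u. u \<in> R \<Longrightarrow> a u \<in> Y \<and> {u, a u} \<in> F" using Y(5) unfolding R_def by metis
  have finY: "finite Y" and finR: "finite R" using Y(1) finVF finite_subset by (auto simp: R_def)
  have \<sigma>Y: "\<sigma> v \<in> Y" if "v \<in> Y" for v using Y(2) that by (rule bij_betw_apply)
  define g where "g x y = ennreal (sqrt (G x y))" for x y
  define d where "d x = (\<integral>\<^sup>+y. ennreal (G x y) \<partial>?U)" for x
  define h where "h x = ennreal (sqrt (enn2real (d x)))" for x
  have gm: "(\<lambda>(x, y). g x y) \<in> borel_measurable (?U \<Otimes>\<^sub>M ?U)"
    using m unfolding g_def split_beta' by measurable
  have Gm: "(\<lambda>(x, y). ennreal (G x y)) \<in> borel_measurable (?U \<Otimes>\<^sub>M ?U)"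
    using m unfolding split_beta' by measurable
  have dm: "d \<in> borel_measurable ?U"
    unfolding d_def using borel_measurable_nn_integral[OF Gm] by simp
  have hm: "h \<in> borel_measurable ?U" unfolding h_def using dm by measurable
  have g2: "(g x y)\<^sup>2 = ennreal (G x y)" if "x \<in> {0..1}" "y \<in> {0..1}" for x y
    using bd[OF that] by (simp add: g_def ennreal_power)
  \<comment> \<open>\<open>enn2real\<close> loses nothing here because the degree bound makes
    \<open>d\<close> finite.\<close>
  have h2: "(h x)\<^sup>2 = d x" if "x \<in> {0..1}" for x
  proof -
    have "d x < top" using deg[OF that] by (auto simp: d_def intro: le_less_trans)
    then show ?thesis by (simp add: h_def ennreal_power)
  qed
  define \<Phi> where "\<Phi> x = (\<Prod>v\<in>Y. g (x v) (x (\<sigma> v)))" for x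
  have Phim: "\<Phi> \<in> borel_measurable (Pi\<^sub>M V' (\<lambda>_. ?U))" if "Y \<subseteq> V'" for V'
    unfolding \<Phi>_def using that \<sigma>Y by (intro borel_measurable_prod_ennreal measurable_two_components[OF gm]) auto
  have I1: "(\<integral>\<^sup>+x. \<Phi> x \<partial>Pi\<^sub>M Y (\<lambda>_. ?U)) \<le> ennreal (sqrt s) ^ card Y"
    unfolding \<Phi>_def
  proof (rule permutation_product_integral_le[OF _ finY Y(2) _ gm _ hm])
    show "sigma_finite_measure ?U" by (rule sigma_finite_measure_axioms)
    show "\<sigma> v \<noteq> v" if "v \<in> Y" for v using simple_graph_no_loop[OF F Y(3)[OF that]] by simp
    show "g x y = g y x" if "x \<in> space ?U" "y \<in> space ?U" for x y
      using sym that unfolding sU g_def by simp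
    show "(\<integral>\<^sup>+y. (g x y)\<^sup>2 \<partial>?U) \<le> (h x)\<^sup>2" if "x \<in> space ?U" for x
    proof -
      have "(\<integral>\<^sup>+y. (g x y)\<^sup>2 \<partial>?U) = d x"
        unfolding d_def using that g2 by (intro nn_integral_cong) (simp add: sU)
      then show ?thesis using h2 that by (simp add: sU)
    qed
    have "(\<integral>\<^sup>+x. (h x)\<^sup>2 \<partial>?U) = (\<integral>\<^sup>+x. d x \<partial>?U)"
      using h2 by (intro nn_integral_cong) (simp add: sU)
    then show "(\<integral>\<^sup>+x. (h x)\<^sup>2 \<partial>?U) \<le> (ennreal (sqrt s))\<^sup>2"
      using tot ps by (simp add: d_def ennreal_power)
  qed
  have RV: "R \<subseteq> V - Y" using V(2) by (auto simp: R_def)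
  have VY: "V - Y \<union> Y = V" using V(2) Y(1) by auto
  have "(\<integral>\<^sup>+x. \<Phi> x * (\<Prod>u\<in>R. ennreal (G (x u) (x (a u)))) \<partial>Pi\<^sub>M (V - Y \<union> Y) (\<lambda>_. ?U))
    \<le> ennreal p ^ card R * (\<integral>\<^sup>+x. \<Phi> x \<partial>Pi\<^sub>M Y (\<lambda>_. ?U))"
  proof (rule pendant_product_integral_le[OF prob_space_unit _ finY _ RV _ Gm _ Phim])
    show "finite (V - Y)" using V(1) by simp
    show "(V - Y) \<inter> Y = {}" by auto
    show "a u \<in> Y" if "u \<in> R" for u using a[OF that] by simp
    show "(\<integral>\<^sup>+y. ennreal (G y b) \<partial>?U) \<le> ennreal p" if "b \<in> space ?U" for b
    proof -
      have "(\<integral>\<^sup>+y. ennreal (G y b) \<partial>?U) = (\<integral>\<^sup>+y. ennreal (G b y) \<partial>?U)"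
        using sym that unfolding sU by (intro nn_integral_cong) (simp add: sU)
      then show ?thesis using deg that by (simp add: sU)
    qed
    show "\<Phi> x = \<Phi> x'" if "\<And>v. v \<in> Y \<Longrightarrow> x v = x' v" for x x'
      unfolding \<Phi>_def using that \<sigma>Y by (intro prod.cong) auto
  qed
  also have "\<dots> \<le> ennreal p ^ card R * ennreal (sqrt s) ^ card Y"
    by (rule mult_left_mono[OF I1]) simp
  also have "\<dots> = ennreal (p ^ card R * sqrt s ^ card Y)"
    using ps by (simp add: ennreal_power ennreal_mult)
  also have "card R = card (verts F) - card Y"
    unfolding R_def using Y(1) finY by (rule card_Diff_subset[rotated])
  finally have I2: "(\<integral>\<^sup>+x. \<Phi> x * (\<Prod>u\<in>R. ennreal (G (x u) (x (a u)))) \<partial>Pi\<^sub>M V (\<lambda>_. ?U))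
    \<le> ennreal (p ^ (card (verts F) - card Y) * sqrt s ^ card Y)" unfolding VY .
  have "(\<integral>\<^sup>+x. (\<Prod>e\<in>F. ennreal (edge_value G x e)) \<partial>Pi\<^sub>M V (\<lambda>_. ?U)) \<le>
     (\<integral>\<^sup>+x. \<Phi> x * (\<Prod>u\<in>R. ennreal (G (x u) (x (a u)))) \<partial>Pi\<^sub>M V (\<lambda>_. ?U))"
  proof (rule nn_integral_mono)
    fix x assume x: "x \<in> space (Pi\<^sub>M V (\<lambda>_. ?U))"
    let ?q = "\<lambda>e. edge_value G x e"
    have q: "0 \<le> ?q e \<and> ?q e \<le> 1" if "e \<in> F" for e
      by (rule edge_value_bounds[where W = G and P = "\<lambda>r. 0 \<le> r \<and> r \<le> 1", OF F that V(2) sym bd x])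
    have q2: "?q {u, v} = G (x u) (x v)" if "{u, v} \<in> F" for u v
      using edge_in_verts[OF that] V(2) by (intro edge_value_on_cube[where W = G, OF sym x]) auto
    have "(\<Prod>e\<in>F. ?q e) \<le> (\<Prod>v\<in>Y. sqrt (?q {v, \<sigma> v})) * (\<Prod>u\<in>R. ?q {u, a u})"
    proof (rule prod_edges_le_permutation_product[OF finF finY finR])
      show "0 \<le> ?q e \<and> ?q e \<le> 1" if "e \<in> F" for e by (rule q[OF that])
      show "\<sigma> v \<in> Y \<and> {v, \<sigma> v} \<in> F" if "v \<in> Y" for v using \<sigma>Y Y(3) that by simp
      show "u \<notin> Y \<and> a u \<in> Y \<and> {u, a u} \<in> F" if "u \<in> R" for u using a[OF that] that by (simp add: R_def)
    qed
    also have "(\<Prod>v\<in>Y. sqrt (?q {v, \<sigma> v})) = (\<Prod>v\<in>Y. sqrt (G (x v) (x (\<sigma> v))))"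
      using q2 Y(3) by (intro prod.cong) auto
    also have "(\<Prod>u\<in>R. ?q {u, a u}) = (\<Prod>u\<in>R. G (x u) (x (a u)))"
      using q2 a by (intro prod.cong) auto
    finally have le: "(\<Prod>e\<in>F. ?q e) \<le> (\<Prod>v\<in>Y. sqrt (G (x v) (x (\<sigma> v)))) * (\<Prod>u\<in>R. G (x u) (x (a u)))" .
    have n1: "0 \<le> sqrt (G (x v) (x (\<sigma> v)))" if "v \<in> Y" for v
      using q[OF Y(3)[OF that]] q2[OF Y(3)[OF that]] by simp
    have n2: "0 \<le> G (x u) (x (a u))" if "u \<in> R" for u
      using q[of "{u, a u}"] q2[of u "a u"] a[OF that] by simp
    have "(\<Prod>e\<in>F. ennreal (?q e)) = ennreal (\<Prod>e\<in>F. ?q e)" using q by (intro prod_ennreal) auto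
    also have "\<dots> \<le> ennreal ((\<Prod>v\<in>Y. sqrt (G (x v) (x (\<sigma> v)))) * (\<Prod>u\<in>R. G (x u) (x (a u))))"
      by (rule ennreal_leI[OF le])
    also have "\<dots> = \<Phi> x * (\<Prod>u\<in>R. ennreal (G (x u) (x (a u))))"
      unfolding \<Phi>_def g_def using n1 n2 by (simp add: prod_ennreal prod_nonneg ennreal_mult)
    finally show "(\<Prod>e\<in>F. ennreal (?q e)) \<le> \<Phi> x * (\<Prod>u\<in>R. ennreal (G (x u) (x (a u))))" .
  qed
  with I2 have "(\<integral>\<^sup>+x. (\<Prod>e\<in>F. ennreal (edge_value G x e)) \<partial>Pi\<^sub>M V (\<lambda>_. ?U))
    \<le> ennreal (p ^ (card (verts F) - card Y) * sqrt s ^ card Y)" by (rule order_trans[rotated])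
  then show ?thesis using that[of "card Y"] Y(4) card_mono[OF finVF Y(1)] by simp
qed

text \<open>The exponent of \<open>p\<close> on the left is
  \<open>(v - k) + k (1 + \<gamma> / 2) = v + \<gamma> C\<close>, which is at least
  \<open>e\<close>.\<close>

lemma power_le_of_excess_le:
  fixes p M \<gamma> C :: real
  assumes p: "0 < p" "p \<le> 1" and M: "0 \<le> M"
    and k: "real k = 2 * C" "k \<le> v" and ex: "real e - real v \<le> \<gamma> * C"
  shows "p ^ (v - k) * sqrt (M * p powr (2 + \<gamma>)) ^ k \<le> sqrt M ^ k * p ^ e"
proof -
  have "sqrt (p powr (2 + \<gamma>)) = p powr (1 + \<gamma> / 2)"
    using p by (simp add: powr_half_sqrt[symmetric] powr_powr add_divide_distrib)
  then have "p ^ (v - k) * sqrt (M * p powr (2 + \<gamma>)) ^ k = sqrt M ^ k * (p ^ (v - k) * (p powr (1 + \<gamma> / 2)) ^ k)"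
    by (simp add: real_sqrt_mult power_mult_distrib)
  also have "p ^ (v - k) * (p powr (1 + \<gamma> / 2)) ^ k = p powr (real (v - k) + real k * (1 + \<gamma> / 2))"
  proof -
    have "(p powr a) ^ k = p powr (real k * a)" for a
      using p by (simp add: powr_realpow[symmetric] powr_powr mult.commute)
    moreover have "p ^ (v - k) = p powr real (v - k)" using p by (simp add: powr_realpow)
    ultimately show ?thesis by (simp only: powr_add[of p "real (v - k)"])
  qed
  also have "real (v - k) + real k * (1 + \<gamma> / 2) = real v + \<gamma> * C"
    using k by (simp add: of_nat_diff algebra_simps)
  also have "p powr (real v + \<gamma> * C) \<le> p powr (real e)"
    using p ex by (intro powr_mono') auto
  also have "p powr (real e) = p ^ e" using p by (simp add: powr_realpow)
  finally show ?thesis using M by (simp add: mult_left_mono)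
qed

text \<open>Both bounds on \<open>k\<close> are kept, for small and for large \<open>M\<close>: if
  \<open>M <= 1\<close> then \<open>sqrt M ^ k\<close> is at most \<open>M\<close>, and if
  \<open>M >= 1\<close> it is at most \<open>M ^ card (verts F)\<close>.\<close>

lemma edge_product_integral_le_gamma:
  fixes G :: "real \<Rightarrow> real \<Rightarrow> real"
  assumes K: "simple_graph K" and F: "F \<subseteq> K" "F \<noteq> {}" and V: "finite V" "verts F \<subseteq> V"
    and m: "(\<lambda>(x, y). G x y) \<in> borel_measurable (unit_measure \<Otimes>\<^sub>M unit_measure)"
    and sym: "\<And>a b. a \<in> {0..1} \<Longrightarrow> b \<in> {0..1} \<Longrightarrow> G a b = G b a"
    and bd: "\<And>a b. a \<in> {0..1} \<Longrightarrow> b \<in> {0..1} \<Longrightarrow> 0 \<le> G a b \<and> G a b \<le> 1"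
    and deg: "\<And>a. a \<in> {0..1} \<Longrightarrow> (\<integral>\<^sup>+b. ennreal (G a b) \<partial>unit_measure) \<le> ennreal p"
    and tot: "(\<integral>\<^sup>+a. \<integral>\<^sup>+b. ennreal (G a b) \<partial>unit_measure \<partial>unit_measure) \<le> ennreal (M * p powr (2 + gamma K))"
    and p: "0 < p" "p \<le> 1" and M: "0 \<le> M"
  obtains k where "2 \<le> k" "k \<le> card (verts F)"
    "(\<integral>\<^sup>+x. (\<Prod>e\<in>F. ennreal (edge_value G x e)) \<partial>Pi\<^sub>M V (\<lambda>_. unit_measure))
      \<le> ennreal (sqrt M ^ k * p ^ card F)"
proof -
  note sg = simple_graph_subset[OF K F(1)]
  have p0: "0 \<le> p" using p by simp
  have s0: "0 \<le> M * p powr (2 + gamma K)" using M by simp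
  obtain k where k: "real k = 2 * cover_number F" "k \<le> card (verts F)"
    "(\<integral>\<^sup>+x. (\<Prod>e\<in>F. ennreal (edge_value G x e)) \<partial>Pi\<^sub>M V (\<lambda>_. unit_measure))
      \<le> ennreal (p ^ (card (verts F) - k) * sqrt (M * p powr (2 + gamma K)) ^ k)"
    by (rule edge_product_integral_le[OF sg V m sym bd deg tot p0 s0])
  have "real (card F) - real (card (verts F)) \<le> gamma K * cover_number F"
    using excess_le_gamma[OF K F(1)] by (simp add: excess_def)
  from power_le_of_excess_le[OF p M k(1,2) this]
  have "ennreal (p ^ (card (verts F) - k) * sqrt (M * p powr (2 + gamma K)) ^ k)
    \<le> ennreal (sqrt M ^ k * p ^ card F)" by (rule ennreal_leI)
  moreover have "2 \<le> k" using k(1) cover_number_ge_1[OF sg F(2)] by linarith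
  ultimately show ?thesis using that[of k] k(2,3) by (meson order_trans)
qed

section \<open>Relative entropy and the lower bound\<close>

lemma mult_ln_div_le: "0 \<le> x \<Longrightarrow> 0 < y \<Longrightarrow> x * ln (x / y) \<le> x * (x / y - 1)" for x y :: real
  by (cases "x = 0") (auto intro!: mult_left_mono ln_le_minus_one)

text \<open>The inequality \<open>ln r <= r - 1\<close> is used at
  \<open>r = sqrt y / sqrt x\<close> instead of \<open>y / x\<close>, and this is what produces a
  Hellinger distance below.\<close>

lemma mult_ln_div_ge: "0 \<le> x \<Longrightarrow> 0 < y \<Longrightarrow> 2 * x - 2 * (sqrt x * sqrt y) \<le> x * ln (x / y)" for x y :: real
proof (cases "x = 0")
  case False
  assume "0 \<le> x" "0 < y"
  with False have xy: "0 < x" "0 < y" by auto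
  have "ln (x / y) = - 2 * ln (sqrt y / sqrt x)"
    using xy by (simp add: ln_div ln_sqrt)
  moreover have "ln (sqrt y / sqrt x) \<le> sqrt y / sqrt x - 1" using xy by (intro ln_le_minus_one) auto
  ultimately have "2 - 2 * (sqrt y / sqrt x) \<le> ln (x / y)" by linarith
  then have "x * (2 - 2 * (sqrt y / sqrt x)) \<le> x * ln (x / y)" using xy by (intro mult_left_mono) auto
  moreover have "x * (2 - 2 * (sqrt y / sqrt x)) = 2 * x - 2 * (sqrt x * sqrt y)" using xy by (simp add: field_simps)
  ultimately show ?thesis by simp
qed auto

context
  fixes p q :: real
  assumes p: "0 < p" "p < 1" and q: "0 \<le> q" "q \<le> 1"
begin

text \<open>Being quadratic in \<open>q - p\<close>, this bound shows the repair of regularity to be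
  cheap.\<close>

lemma entropy_le_chi_square: "entropy p q \<le> (q - p)\<^sup>2 / (p * (1 - p))"
proof -
  have "entropy p q \<le> q * (q / p - 1) + (1 - q) * ((1 - q) / (1 - p) - 1)"
    unfolding entropy_def using p q by (intro add_mono mult_ln_div_le) auto
  also have "\<dots> = (q - p)\<^sup>2 / (p * (1 - p))"
    using p by (simp add: divide_simps power2_eq_square) (simp add: algebra_simps)
  finally show ?thesis .
qed

text \<open>The two lower bounds add up to the squared Hellinger distance of the two-point
  distributions; the square belonging to the complementary probabilities is discarded.\<close>

lemma entropy_ge_hellinger: "(sqrt q - sqrt p)\<^sup>2 \<le> entropy p q"
proof -
  have "2 * q - 2 * (sqrt q * sqrt p) + (2 * (1 - q) - 2 * (sqrt (1 - q) * sqrt (1 - p))) \<le> entropy p q"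
    unfolding entropy_def using p q by (intro add_mono mult_ln_div_ge) auto
  moreover have "0 \<le> (sqrt (1 - q) - sqrt (1 - p))\<^sup>2" by simp
  ultimately show ?thesis using p q by (simp add: power2_diff)
qed

lemma entropy_nonneg: "0 \<le> entropy p q"
  using entropy_ge_hellinger by (rule order_trans[rotated]) simp

text \<open>Since \<open>4/3 < sqrt 2\<close>, the hypothesis gives
  \<open>sqrt p <= 3/4 * sqrt q\<close>, so \<open>sqrt q - sqrt p\<close> is at least a quarter of
  \<open>sqrt q\<close>; squaring gives the factor 16.\<close>

lemma le_entropy_of_large:
  assumes "2 * p < q" shows "q \<le> 16 * entropy p q"
proof -
  let ?a = "sqrt q" and ?b = "sqrt p"
  have ab: "?a\<^sup>2 = q" "?b\<^sup>2 = p" "0 \<le> ?a" "0 \<le> ?b" using p q by auto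
  have "(4/3 * ?b)\<^sup>2 = 16/9 * p" unfolding power_mult_distrib ab(2) by (simp add: power2_eq_square)
  then have "(4/3 * ?b)\<^sup>2 \<le> ?a\<^sup>2" using assms p ab by linarith
  then have "4/3 * ?b \<le> ?a" using ab(3) by (rule power2_le_imp_le)
  then have "0 \<le> (3 * ?a - 4 * ?b) * (5 * ?a - 4 * ?b)" using ab(3,4) by (intro mult_nonneg_nonneg) linarith+
  moreover have "a\<^sup>2 \<le> 16 * (a - b)\<^sup>2" if "0 \<le> (3 * a - 4 * b) * (5 * a - 4 * b)" for a b :: real
    using that by (simp add: power2_eq_square algebra_simps)
  ultimately have "?a\<^sup>2 \<le> 16 * (?a - ?b)\<^sup>2" by blast
  then show ?thesis using entropy_ge_hellinger ab by linarith
qed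

text \<open>The difference of the roots is multiplied by at most \<open>5/2 * sqrt p\<close>,
  because \<open>sqrt 2 < 3/2\<close>, and the product is split by a weighted arithmetic-geometric
  mean inequality. The free \<open>\<theta>\<close> trades a small multiple of \<open>p\<close>
  against a large multiple of the entropy.\<close>

lemma abs_diff_le_entropy_of_small:
  assumes "q \<le> 2 * p" "0 < \<theta>" shows "\<bar>q - p\<bar> \<le> p * \<theta> + 2 * entropy p q / \<theta>"
proof -
  let ?a = "sqrt q" and ?b = "sqrt p"
  have ab: "?a\<^sup>2 = q" "?b\<^sup>2 = p" "0 \<le> ?a" "0 \<le> ?b" using p q by auto
  have "(3/2 * ?b)\<^sup>2 = 9/4 * p" unfolding power_mult_distrib ab(2) by (simp add: power2_eq_square)
  then have "?a\<^sup>2 \<le> (3/2 * ?b)\<^sup>2" using assms p ab by linarith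
  then have a: "?a \<le> 3/2 * ?b" by (rule power2_le_imp_le) (use ab(4) in linarith)
  define x where "x = \<bar>?a - ?b\<bar>"
  have "?a\<^sup>2 - ?b\<^sup>2 = (?a - ?b) * (?a + ?b)" by (simp only: power2_eq_square square_diff_square_factored mult.commute)
  then have "q - p = (?a - ?b) * (?a + ?b)" unfolding ab .
  then have "\<bar>q - p\<bar> = x * (?a + ?b)" using ab(3,4) by (simp add: abs_mult x_def)
  also have "\<dots> \<le> x * (5/2 * ?b)" using a by (intro mult_left_mono) (auto simp: x_def)
  also have "\<dots> \<le> \<theta> * ?b\<^sup>2 + 2 * x\<^sup>2 / \<theta>"
  proof -
    \<comment> \<open>Completing the square in \<open>\<theta> * ?b\<close>; the remaining
      coefficient is \<open>2 - 25/16 = 7/16\<close>.\<close>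
    have "0 \<le> (\<theta> * ?b - 5/4 * x)\<^sup>2 + 7/16 * x\<^sup>2" by simp
    then have "x * (5/2 * ?b) * \<theta> \<le> (\<theta> * ?b\<^sup>2 + 2 * x\<^sup>2 / \<theta>) * \<theta>"
      using assms(2) by (simp add: power2_eq_square algebra_simps)
    then show ?thesis using assms(2) by simp
  qed
  also have "x\<^sup>2 = (?a - ?b)\<^sup>2" by (simp add: x_def)
  also have "\<theta> * ?b\<^sup>2 + 2 * (?a - ?b)\<^sup>2 / \<theta> \<le> p * \<theta> + 2 * entropy p q / \<theta>"
  proof -
    have "2 * (?a - ?b)\<^sup>2 / \<theta> \<le> 2 * entropy p q / \<theta>"
      using entropy_ge_hellinger assms(2) by (intro divide_right_mono mult_left_mono) auto
    then show ?thesis unfolding ab(2) by (simp add: mult.commute)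
  qed
  finally show ?thesis .
qed

end

section \<open>The density of K in a graphon of small entropy\<close>

lemma prod_1_plus_le:
  fixes t :: "'b \<Rightarrow> real"
  assumes "finite E" "\<And>e. e \<in> E \<Longrightarrow> 0 \<le> t e \<and> t e \<le> 1"
  shows "(\<Prod>e\<in>E. 1 + t e) \<le> 1 + 2 ^ card E * (\<Sum>e\<in>E. t e)"
  using assms
proof (induction E)
  case (insert a E)
  let ?S = "\<Sum>e\<in>E. t e" and ?n = "card E"
  have S: "0 \<le> ?S" using insert.prems by (intro sum_nonneg) auto
  have t: "0 \<le> t a" "t a \<le> 1" using insert.prems by auto
  have "(\<Prod>e\<in>insert a E. 1 + t e) = (1 + t a) * (\<Prod>e\<in>E. 1 + t e)" using insert.hyps by simp
  also have "\<dots> \<le> (1 + t a) * (1 + 2 ^ ?n * ?S)"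
    using insert t by (intro mult_left_mono) auto
  also have "\<dots> = 1 + t a + 2 ^ ?n * ?S + t a * (2 ^ ?n * ?S)" by (simp add: algebra_simps)
  also have "t a * (2 ^ ?n * ?S) \<le> 1 * (2 ^ ?n * ?S)" using t S by (intro mult_right_mono) auto
  also have "t a \<le> 2 * 2 ^ ?n * t a"
  proof -
    have "1 * t a \<le> (2 * 2 ^ ?n) * t a"
      using t one_le_power[of "2::real" ?n] by (intro mult_right_mono) linarith+
    then show ?thesis by simp
  qed
  finally show ?case using insert.hyps by (simp add: algebra_simps)
qed simp

lemma measurable_entropy: "entropy p \<in> borel_measurable borel"
  unfolding entropy_def[abs_def] by measurable

lemma pair_unit_prob: "prob_space (unit_measure \<Otimes>\<^sub>M unit_measure)"
proof -
  interpret prob_space unit_measure by (rule prob_space_unit)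
  interpret pair_prob_space unit_measure unit_measure ..
  show ?thesis by (rule P.prob_space_axioms)
qed

lemma nn_integral_iterated:
  assumes "(\<lambda>(x, y). f x y) \<in> borel_measurable (unit_measure \<Otimes>\<^sub>M unit_measure)"
  shows "(\<integral>\<^sup>+x. \<integral>\<^sup>+y. f x y \<partial>unit_measure \<partial>unit_measure) =
    (\<integral>\<^sup>+(x, y). f x y \<partial>(unit_measure \<Otimes>\<^sub>M unit_measure))"
proof -
  interpret prob_space unit_measure by (rule prob_space_unit)
  show ?thesis using nn_integral_fst[OF assms] by simp
qed

lemma nn_integral_two_components:
  fixes f :: "real \<Rightarrow> real \<Rightarrow> ennreal"
  assumes V: "finite V" "u \<in> V" "v \<in> V" "u \<noteq> v"
    and m: "(\<lambda>(x, y). f x y) \<in> borel_measurable (unit_measure \<Otimes>\<^sub>M unit_measure)"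
  shows "(\<integral>\<^sup>+x. f (x u) (x v) \<partial>Pi\<^sub>M V (\<lambda>_. unit_measure)) =
    (\<integral>\<^sup>+x. \<integral>\<^sup>+y. f x y \<partial>unit_measure \<partial>unit_measure)"
proof -
  let ?U = "unit_measure"
  interpret U: prob_space ?U by (rule prob_space_unit)
  interpret product_sigma_finite "\<lambda>_. ?U" by unfold_locales
  define Z where "Z = V - {u, v}"
  have Z: "V = insert u (insert v Z)" "u \<notin> insert v Z" "v \<notin> Z" "finite Z"
    using V by (auto simp: Z_def)
  interpret Z: prob_space "Pi\<^sub>M Z (\<lambda>_. ?U)" by (rule prob_space_PiM) (rule prob_space_unit)
  have fm: "(\<lambda>x. f (x u) (x v)) \<in> borel_measurable (Pi\<^sub>M V (\<lambda>_. ?U))"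
    by (rule measurable_two_components[OF m V(2,3)])
  have "(\<integral>\<^sup>+x. f (x u) (x v) \<partial>Pi\<^sub>M V (\<lambda>_. ?U)) =
      (\<integral>\<^sup>+a. \<integral>\<^sup>+x. f ((x(u := a)) u) ((x(u := a)) v) \<partial>Pi\<^sub>M (insert v Z) (\<lambda>_. ?U) \<partial>?U)"
    using fm Z unfolding Z(1) by (intro product_nn_integral_insert_rev) auto
  also have "\<dots> = (\<integral>\<^sup>+a. \<integral>\<^sup>+x. f a (x v) \<partial>Pi\<^sub>M (insert v Z) (\<lambda>_. ?U) \<partial>?U)" using V(4) by simp
  also have "\<dots> = (\<integral>\<^sup>+a. \<integral>\<^sup>+b. f a b \<partial>?U \<partial>?U)"
  proof (rule nn_integral_cong)
    fix a assume a: "a \<in> space ?U"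
    have "f a \<in> borel_measurable ?U" using measurable_Pair2[OF m a] by simp
    then have "(\<lambda>x. f a (x v)) \<in> borel_measurable (Pi\<^sub>M (insert v Z) (\<lambda>_. ?U))"
      by (rule measurable_compose[where g = "f a" and f = "\<lambda>x. x v", rotated])
        (rule measurable_component_singleton, simp)
    then have "(\<integral>\<^sup>+x. f a (x v) \<partial>Pi\<^sub>M (insert v Z) (\<lambda>_. ?U)) =
        (\<integral>\<^sup>+b. \<integral>\<^sup>+x. f a ((x(v := b)) v) \<partial>Pi\<^sub>M Z (\<lambda>_. ?U) \<partial>?U)"
      using Z by (intro product_nn_integral_insert_rev) auto
    also have "\<dots> = (\<integral>\<^sup>+b. f a b \<partial>?U)" by (simp add: Z.emeasure_space_1)
    finally show "(\<integral>\<^sup>+x. f a (x v) \<partial>Pi\<^sub>M (insert v Z) (\<lambda>_. ?U)) = (\<integral>\<^sup>+b. f a b \<partial>?U)" .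
  qed
  finally show ?thesis .
qed

lemma graphonD:
  assumes "graphon W"
  shows "(\<lambda>(x, y). W x y) \<in> borel_measurable (unit_measure \<Otimes>\<^sub>M unit_measure)"
    and "a \<in> {0..1} \<Longrightarrow> b \<in> {0..1} \<Longrightarrow> W a b = W b a"
    and "a \<in> {0..1} \<Longrightarrow> b \<in> {0..1} \<Longrightarrow> 0 \<le> W a b \<and> W a b \<le> 1"
  using assms unfolding graphon_def by blast+

text \<open>The chi-square bound makes the entropy bounded and hence integrable, so the Bochner
  integral of the definition equals an iterated nonnegative integral, the form in which it is
  compared with other kernels.\<close>

lemma entropy_integral:
  assumes W: "graphon W" and p: "0 < p" "p < 1"
  shows "(\<integral>\<^sup>+x. \<integral>\<^sup>+y. ennreal (entropy p (W x y)) \<partial>unit_measure \<partial>unit_measure) =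
      ennreal (graphon_entropy p W)"
    and "(\<lambda>(x, y). ennreal (entropy p (W x y))) \<in> borel_measurable (unit_measure \<Otimes>\<^sub>M unit_measure)"
    and "0 \<le> graphon_entropy p W"
    and "integrable (unit_measure \<Otimes>\<^sub>M unit_measure) (\<lambda>(x, y). entropy p (W x y))"
proof -
  let ?M = "unit_measure \<Otimes>\<^sub>M unit_measure"
  interpret finite_measure ?M by (rule prob_space.finite_measure[OF pair_unit_prob])
  have sp: "space ?M = {0..1} \<times> {0..1}" by (simp add: space_pair_measure space_unit)
  have m: "(\<lambda>(x, y). entropy p (W x y)) \<in> borel_measurable ?M"
    using measurable_compose[OF graphonD(1)[OF W] measurable_entropy[of p]] by (simp add: split_beta')
  then show m': "(\<lambda>(x, y). ennreal (entropy p (W x y))) \<in> borel_measurable ?M"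
    by (simp add: split_beta')
  have nn: "0 \<le> entropy p (W x y)" if "x \<in> {0..1}" "y \<in> {0..1}" for x y
    using entropy_nonneg[OF p] graphonD(3)[OF W that] by blast
  have le: "entropy p (W x y) \<le> 1 / (p * (1 - p))" if "x \<in> {0..1}" "y \<in> {0..1}" for x y
  proof -
    have w: "0 \<le> W x y" "W x y \<le> 1" using graphonD(3)[OF W that] by auto
    have "entropy p (W x y) \<le> (W x y - p)\<^sup>2 / (p * (1 - p))" by (rule entropy_le_chi_square[OF p w])
    also have "\<dots> \<le> 1 / (p * (1 - p))"
      using p w by (intro divide_right_mono) (auto simp: abs_square_le_1)
    finally show ?thesis .
  qed
  show int: "integrable ?M (\<lambda>(x, y). entropy p (W x y))"
    using m nn le by (intro integrable_const_bound[of _ "1 / (p * (1 - p))"]) (auto intro!: AE_I2 simp: sp)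
  have nnAE: "AE z in ?M. 0 \<le> (case z of (x, y) \<Rightarrow> entropy p (W x y))"
    using nn by (intro AE_I2) (auto simp: sp)
  show "0 \<le> graphon_entropy p W"
    unfolding graphon_entropy_def using nn by (intro Bochner_Integration.integral_nonneg) (auto simp: sp)
  have "(\<integral>\<^sup>+(x, y). ennreal (entropy p (W x y)) \<partial>?M) = ennreal (graphon_entropy p W)"
    unfolding graphon_entropy_def using nn_integral_eq_integral[OF int nnAE] by (simp add: split_beta')
  then show "(\<integral>\<^sup>+x. \<integral>\<^sup>+y. ennreal (entropy p (W x y)) \<partial>unit_measure \<partial>unit_measure) = ennreal (graphon_entropy p W)"
    using nn_integral_iterated[OF m'] by simp
qed

text \<open>Expands the product of \<open>B + G\<close> over the sets \<open>F\<close> of edges that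
  take \<open>G\<close>. The term \<open>F = {}\<close> is \<open>main\<close>; in every other term
  \<open>B\<close> is replaced by its bound \<open>\<beta> = \<alpha> * q\<close>, and there are
  fewer than \<open>2 ^ card K\<close> such terms. It is applied with \<open>q = p\<close>: with
  \<open>\<alpha> = 2\<close> for the lower bound and with \<open>\<alpha> = 3\<close> for the
  density of \<open>W + p\<close>.\<close>

lemma Hom_le_split:
  fixes U B G :: "real \<Rightarrow> real \<Rightarrow> real"
  assumes K: "simple_graph K"
    and m: "(\<lambda>(x, y). U x y) \<in> borel_measurable (unit_measure \<Otimes>\<^sub>M unit_measure)"
      "(\<lambda>(x, y). B x y) \<in> borel_measurable (unit_measure \<Otimes>\<^sub>M unit_measure)"
      "(\<lambda>(x, y). G x y) \<in> borel_measurable (unit_measure \<Otimes>\<^sub>M unit_measure)"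
    and sym: "\<And>a c. a \<in> {0..1} \<Longrightarrow> c \<in> {0..1} \<Longrightarrow> U a c = U c a"
      "\<And>a c. a \<in> {0..1} \<Longrightarrow> c \<in> {0..1} \<Longrightarrow> B a c = B c a"
      "\<And>a c. a \<in> {0..1} \<Longrightarrow> c \<in> {0..1} \<Longrightarrow> G a c = G c a"
    and le: "\<And>a c. a \<in> {0..1} \<Longrightarrow> c \<in> {0..1} \<Longrightarrow> 0 \<le> U a c \<and> U a c \<le> B a c + G a c"
    and B: "\<And>a c. a \<in> {0..1} \<Longrightarrow> c \<in> {0..1} \<Longrightarrow> 0 \<le> B a c \<and> B a c \<le> \<beta>"
    and G: "\<And>a c. a \<in> {0..1} \<Longrightarrow> c \<in> {0..1} \<Longrightarrow> 0 \<le> G a c \<and> G a c \<le> 1"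
    and main: "(\<integral>\<^sup>+x. (\<Prod>e\<in>K. ennreal (edge_value B x e)) \<partial>Pi\<^sub>M (verts K) (\<lambda>_. unit_measure)) \<le> ennreal T"
    and T: "0 \<le> T" and \<beta>: "0 \<le> \<beta>" and D: "0 \<le> D" and q: "0 \<le> q" "\<beta> = \<alpha> * q" "1 \<le> \<alpha>"
    and rest: "\<And>F. F \<subseteq> K \<Longrightarrow> F \<noteq> {} \<Longrightarrow>
      (\<integral>\<^sup>+x. (\<Prod>e\<in>F. ennreal (edge_value G x e)) \<partial>Pi\<^sub>M (verts K) (\<lambda>_. unit_measure)) \<le> ennreal (D * q ^ card F)"
  shows "Hom K U \<le> T + (2 * \<alpha>) ^ card K * D * q ^ card K"
proof -
  let ?P = "Pi\<^sub>M (verts K) (\<lambda>_. unit_measure)"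
  have finK: "finite K" using K by (simp add: simple_graph_def)
  have bdB: "0 \<le> edge_value B x e \<and> edge_value B x e \<le> \<beta>" if "e \<in> K" "x \<in> space ?P" for x e
    by (rule edge_value_bounds[where W = B and P = "\<lambda>r. 0 \<le> r \<and> r \<le> \<beta>", OF K that(1) order_refl sym(2) B that(2)])
  have bdG: "0 \<le> edge_value G x e \<and> edge_value G x e \<le> 1" if "e \<in> K" "x \<in> space ?P" for x e
    by (rule edge_value_bounds[where W = G and P = "\<lambda>r. 0 \<le> r \<and> r \<le> 1", OF K that(1) order_refl sym(3) G that(2)])
  have bdU: "0 \<le> edge_value U x e \<and> edge_value U x e \<le> edge_value B x e + edge_value G x e"
    if eK: "e \<in> K" and x: "x \<in> space ?P" for x e
  proof -
    obtain u v where e: "e = {u, v}" "u \<in> verts K" "v \<in> verts K" using simple_graph_edgeE[OF K eK] by metis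
    have eq: "edge_value U x e = U (x u) (x v)" "edge_value B x e = B (x u) (x v)" "edge_value G x e = G (x u) (x v)"
      unfolding e(1)
      using edge_value_on_cube[where W = U, OF _ x e(2,3)] sym(1)
        edge_value_on_cube[where W = B, OF _ x e(2,3)] sym(2)
        edge_value_on_cube[where W = G, OF _ x e(2,3)] sym(3) by presburger+
    show ?thesis unfolding eq
      by (rule le[OF PiM_unit_apply[OF x e(2)] PiM_unit_apply[OF x e(3)]])
  qed
  have mG: "(\<lambda>x. \<Prod>e\<in>F. ennreal (edge_value G x e)) \<in> borel_measurable ?P" if "F \<subseteq> K" for F
    using measurable_edge_value[where W = G, OF K _ order_refl sym(3) m(3)] that
    by (intro borel_measurable_prod_ennreal) auto
  have mB: "(\<lambda>x. \<Prod>e\<in>K. ennreal (edge_value B x e)) \<in> borel_measurable ?P"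
    using measurable_edge_value[where W = B, OF K _ order_refl sym(2) m(2)]
    by (intro borel_measurable_prod_ennreal) auto
  let ?\<F> = "Pow K - {{}}"
  have pw: "ennreal (\<Prod>e\<in>K. edge_value U x e) \<le> (\<Prod>e\<in>K. ennreal (edge_value B x e)) +
      (\<Sum>F\<in>?\<F>. ennreal (\<beta> ^ card (K - F)) * (\<Prod>e\<in>F. ennreal (edge_value G x e)))"
    if x: "x \<in> space ?P" for x
  proof -
    have "(\<Prod>e\<in>K. edge_value U x e) \<le> (\<Prod>e\<in>K. edge_value G x e + edge_value B x e)"
      using bdU x by (intro prod_mono) (simp add: add.commute)
    also have "\<dots> = (\<Sum>F\<in>Pow K. (\<Prod>e\<in>F. edge_value G x e) * (\<Prod>e\<in>K - F. edge_value B x e))"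
      by (rule prod_add[OF finK])
    also have "\<dots> = (\<Prod>e\<in>K. edge_value B x e) +
        (\<Sum>F\<in>?\<F>. (\<Prod>e\<in>F. edge_value G x e) * (\<Prod>e\<in>K - F. edge_value B x e))"
      using finK by (subst sum.remove[of _ "{}"]) auto
    also have "(\<Sum>F\<in>?\<F>. (\<Prod>e\<in>F. edge_value G x e) * (\<Prod>e\<in>K - F. edge_value B x e)) \<le>
        (\<Sum>F\<in>?\<F>. \<beta> ^ card (K - F) * (\<Prod>e\<in>F. edge_value G x e))"
    proof (rule sum_mono)
      fix F assume "F \<in> ?\<F>"
      then have FK: "F \<subseteq> K" by auto
      have "(\<Prod>e\<in>K - F. edge_value B x e) \<le> (\<Prod>e\<in>K - F. \<beta>)" using bdB x by (intro prod_mono) auto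
      moreover have "0 \<le> (\<Prod>e\<in>F. edge_value G x e)" using bdG x FK by (intro prod_nonneg) auto
      ultimately show "(\<Prod>e\<in>F. edge_value G x e) * (\<Prod>e\<in>K - F. edge_value B x e)
          \<le> \<beta> ^ card (K - F) * (\<Prod>e\<in>F. edge_value G x e)"
        by (simp add: mult.commute mult_left_mono)
    qed
    finally have "ennreal (\<Prod>e\<in>K. edge_value U x e) \<le> ennreal ((\<Prod>e\<in>K. edge_value B x e) +
        (\<Sum>F\<in>?\<F>. \<beta> ^ card (K - F) * (\<Prod>e\<in>F. edge_value G x e)))"
      by (intro ennreal_leI) simp
    also have "\<dots> = ennreal (\<Prod>e\<in>K. edge_value B x e) +
        ennreal (\<Sum>F\<in>?\<F>. \<beta> ^ card (K - F) * (\<Prod>e\<in>F. edge_value G x e))"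
      using bdB bdG x \<beta> by (intro ennreal_plus sum_nonneg mult_nonneg_nonneg prod_nonneg) auto
    also have "ennreal (\<Prod>e\<in>K. edge_value B x e) = (\<Prod>e\<in>K. ennreal (edge_value B x e))"
      using bdB x by (intro prod_ennreal[symmetric]) auto
    also have "ennreal (\<Sum>F\<in>?\<F>. \<beta> ^ card (K - F) * (\<Prod>e\<in>F. edge_value G x e)) =
        (\<Sum>F\<in>?\<F>. ennreal (\<beta> ^ card (K - F) * (\<Prod>e\<in>F. edge_value G x e)))"
      using bdG x \<beta> by (intro sum_ennreal[symmetric] mult_nonneg_nonneg prod_nonneg) auto
    also have "\<dots> = (\<Sum>F\<in>?\<F>. ennreal (\<beta> ^ card (K - F)) * (\<Prod>e\<in>F. ennreal (edge_value G x e)))"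
    proof (rule sum.cong[OF refl])
      fix F assume "F \<in> ?\<F>"
      then have FK: "F \<subseteq> K" by auto
      have g: "0 \<le> edge_value G x e" if "e \<in> F" for e using bdG x FK that by auto
      have "(\<Prod>e\<in>F. ennreal (edge_value G x e)) = ennreal (\<Prod>e\<in>F. edge_value G x e)"
        using g by (rule prod_ennreal)
      then show "ennreal (\<beta> ^ card (K - F) * (\<Prod>e\<in>F. edge_value G x e)) =
          ennreal (\<beta> ^ card (K - F)) * (\<Prod>e\<in>F. ennreal (edge_value G x e))"
        using g \<beta> by (simp add: ennreal_mult prod_nonneg)
    qed
    finally show ?thesis .
  qed
  have "(\<integral>\<^sup>+x. ennreal (\<Prod>e\<in>K. edge_value U x e) \<partial>?P) \<le> (\<integral>\<^sup>+x. ((\<Prod>e\<in>K. ennreal (edge_value B x e)) +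
      (\<Sum>F\<in>?\<F>. ennreal (\<beta> ^ card (K - F)) * (\<Prod>e\<in>F. ennreal (edge_value G x e)))) \<partial>?P)"
    by (rule nn_integral_mono[OF pw])
  also have "\<dots> = (\<integral>\<^sup>+x. (\<Prod>e\<in>K. ennreal (edge_value B x e)) \<partial>?P) +
      (\<Sum>F\<in>?\<F>. ennreal (\<beta> ^ card (K - F)) * (\<integral>\<^sup>+x. (\<Prod>e\<in>F. ennreal (edge_value G x e)) \<partial>?P))"
  proof -
    let ?g = "\<lambda>F x. ennreal (\<beta> ^ card (K - F)) * (\<Prod>e\<in>F. ennreal (edge_value G x e))"
    have gm: "?g F \<in> borel_measurable ?P" if "F \<in> ?\<F>" for F
      using mG that by (intro borel_measurable_times_ennreal borel_measurable_const) auto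
    have "(\<integral>\<^sup>+x. (\<Prod>e\<in>K. ennreal (edge_value B x e)) + (\<Sum>F\<in>?\<F>. ?g F x) \<partial>?P) =
        (\<integral>\<^sup>+x. (\<Prod>e\<in>K. ennreal (edge_value B x e)) \<partial>?P) + (\<integral>\<^sup>+x. (\<Sum>F\<in>?\<F>. ?g F x) \<partial>?P)"
      using mB gm by (intro nn_integral_add borel_measurable_sum) auto
    also have "(\<integral>\<^sup>+x. (\<Sum>F\<in>?\<F>. ?g F x) \<partial>?P) = (\<Sum>F\<in>?\<F>. \<integral>\<^sup>+x. ?g F x \<partial>?P)"
      using gm by (rule nn_integral_sum)
    also have "\<dots> = (\<Sum>F\<in>?\<F>. ennreal (\<beta> ^ card (K - F)) * (\<integral>\<^sup>+x. (\<Prod>e\<in>F. ennreal (edge_value G x e)) \<partial>?P))"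
      using mG by (intro sum.cong[OF refl] nn_integral_cmult) auto
    finally show ?thesis .
  qed
  also have "\<dots> \<le> ennreal T + (\<Sum>F\<in>?\<F>. ennreal (\<alpha> ^ card K * D * q ^ card K))"
  proof (intro add_mono main sum_mono)
    fix F assume F: "F \<in> ?\<F>"
    have cF: "card (K - F) + card F = card K"
      using F finK by (metis DiffD1 PowD card_Diff_subset card_mono finite_subset le_add_diff_inverse2)
    have "ennreal (\<beta> ^ card (K - F)) * (\<integral>\<^sup>+x. (\<Prod>e\<in>F. ennreal (edge_value G x e)) \<partial>?P)
        \<le> ennreal (\<beta> ^ card (K - F)) * ennreal (D * q ^ card F)"
      using F by (intro mult_left_mono rest) auto
    also have "\<dots> = ennreal (\<alpha> ^ card (K - F) * D * q ^ (card (K - F) + card F))"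
      using \<beta> D q by (simp add: ennreal_mult[symmetric] power_mult_distrib power_add mult_ac)
    also have "\<dots> \<le> ennreal (\<alpha> ^ card K * D * q ^ card K)"
      unfolding cF using q D finK by (intro ennreal_leI mult_right_mono power_increasing card_mono) auto
    finally show "ennreal (\<beta> ^ card (K - F)) * (\<integral>\<^sup>+x. (\<Prod>e\<in>F. ennreal (edge_value G x e)) \<partial>?P)
        \<le> ennreal (\<alpha> ^ card K * D * q ^ card K)" .
  qed
  also have "(\<Sum>F\<in>?\<F>. ennreal (\<alpha> ^ card K * D * q ^ card K)) = ennreal (real (card ?\<F>) * (\<alpha> ^ card K * D * q ^ card K))"
    using q D by (simp add: ennreal_mult ennreal_of_nat_eq_real_of_nat)
  also have "\<dots> \<le> ennreal (2 ^ card K * (\<alpha> ^ card K * D * q ^ card K))"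
    using q D finK by (intro ennreal_leI mult_right_mono) (auto simp: card_Pow of_nat_diff)
  finally have "(\<integral>\<^sup>+x. ennreal (\<Prod>e\<in>K. edge_value U x e) \<partial>?P) \<le>
      ennreal (T + 2 ^ card K * (\<alpha> ^ card K * D * q ^ card K))"
    using T q D by (simp add: ennreal_plus add_left_mono)
  moreover have "Hom K U = enn2real (\<integral>\<^sup>+x. ennreal (\<Prod>e\<in>K. edge_value U x e) \<partial>?P)"
    unfolding Hom_def
  proof (rule integral_eq_nn_integral)
    show "(\<lambda>x. \<Prod>e\<in>K. edge_value U x e) \<in> borel_measurable ?P"
      using measurable_edge_value[where W = U, OF K _ order_refl sym(1) m(1)]
      by (intro borel_measurable_prod) auto
    show "AE x in ?P. 0 \<le> (\<Prod>e\<in>K. edge_value U x e)"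
      using bdU by (intro AE_I2 prod_nonneg) auto
  qed
  ultimately show ?thesis
    using T q D by (simp add: enn2real_leI power_mult_distrib mult_ac)
qed

lemma p_regular_nn_integral:
  assumes W: "graphon W" "p_regular p W" and x: "x \<in> {0..1}"
  shows "(\<integral>\<^sup>+y. ennreal (W x y) \<partial>unit_measure) = ennreal p"
proof -
  interpret prob_space unit_measure by (rule prob_space_unit)
  have bd: "0 \<le> W x y \<and> W x y \<le> 1" if "y \<in> {0..1}" for y using graphonD(3)[OF W(1) x that] .
  have "W x \<in> borel_measurable unit_measure"
    using measurable_Pair2[OF graphonD(1)[OF W(1)], of x] x by (simp add: space_unit)
  then have "integrable unit_measure (W x)"
    using bd by (intro integrable_const_bound[of _ 1] AE_I2) (auto simp: space_unit)
  then have "(\<integral>\<^sup>+y. ennreal (W x y) \<partial>unit_measure) = ennreal (\<integral>y. W x y \<partial>unit_measure)"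
    using bd by (intro nn_integral_eq_integral AE_I2) (auto simp: space_unit)
  then show ?thesis using W(2) x by (simp add: p_regular_def)
qed

lemma edge_value_nn_integral:
  fixes f :: "real \<Rightarrow> real \<Rightarrow> real"
  assumes K: "simple_graph K" "e \<in> K"
    and m: "(\<lambda>(x, y). ennreal (f x y)) \<in> borel_measurable (unit_measure \<Otimes>\<^sub>M unit_measure)"
    and sym: "\<And>a b. a \<in> {0..1} \<Longrightarrow> b \<in> {0..1} \<Longrightarrow> f a b = f b a"
  shows "(\<integral>\<^sup>+x. ennreal (edge_value f x e) \<partial>Pi\<^sub>M (verts K) (\<lambda>_. unit_measure)) =
    (\<integral>\<^sup>+x. \<integral>\<^sup>+y. ennreal (f x y) \<partial>unit_measure \<partial>unit_measure)"
proof -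
  obtain u v where e: "e = {u, v}" "u \<noteq> v" "u \<in> verts K" "v \<in> verts K"
    using simple_graph_edgeE[OF K] by metis
  have "(\<integral>\<^sup>+x. ennreal (edge_value f x e) \<partial>Pi\<^sub>M (verts K) (\<lambda>_. unit_measure)) =
      (\<integral>\<^sup>+x. ennreal (f (x u) (x v)) \<partial>Pi\<^sub>M (verts K) (\<lambda>_. unit_measure))"
    unfolding e(1)
  proof (rule nn_integral_cong)
    fix x assume "x \<in> space (Pi\<^sub>M (verts K) (\<lambda>_. unit_measure))"
    from edge_value_on_cube[OF _ this e(3,4), of f] sym
    show "ennreal (edge_value f x {u, v}) = ennreal (f (x u) (x v))" by presburger
  qed
  also have "\<dots> = (\<integral>\<^sup>+x. \<integral>\<^sup>+y. ennreal (f x y) \<partial>unit_measure \<partial>unit_measure)"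
    by (rule nn_integral_two_components[OF finite_verts[OF K(1)] e(3,4,2) m])
  finally show ?thesis .
qed

text \<open>Taking the absolute deviation makes \<open>B\<close> at least \<open>p\<close>
  everywhere, so each factor is \<open>p * (1 + t)\<close> with \<open>t\<close> in
  \<open>[0, 1]\<close>, and the product is controlled by the sum of the \<open>t\<close>.
  \<open>G\<close> keeps the values above \<open>2 * p\<close>, where the entropy controls the value
  itself.\<close>

lemma Hom_le_of_entropy_le:
  assumes K: "simple_graph K" and \<gamma>: "0 \<le> gamma K"
    and W: "graphon W" "p_regular p W" and p: "0 < p" "p < 1"
    and I: "graphon_entropy p W \<le> \<eta> * p powr (2 + gamma K)" and \<eta>: "0 \<le> \<eta>" "16 * \<eta> \<le> 1"
    and \<theta>: "0 < \<theta>"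
  shows "Hom K W \<le> p ^ card K * (1 + 2 ^ card K * real (card K) * (\<theta> + 2 * \<eta> / \<theta>)) + 4 ^ card K * (16 * \<eta>) * p ^ card K"
proof -
  let ?U = unit_measure
  let ?P = "Pi\<^sub>M (verts K) (\<lambda>_. ?U)"
  let ?n = "card K"
  have finK: "finite K" using K by (simp add: simple_graph_def)
  define B where "B x y = p + (if W x y \<le> 2 * p then \<bar>W x y - p\<bar> else 0)" for x y
  define G where "G x y = (if W x y \<le> 2 * p then 0 else W x y)" for x y
  define Ent where "Ent x y = entropy p (W x y)" for x y
  note Wm = graphonD(1)[OF W(1)] and Wsym = graphonD(2)[OF W(1)] and Wbd = graphonD(3)[OF W(1)]
  have m': "(\<lambda>z. W (fst z) (snd z)) \<in> borel_measurable (?U \<Otimes>\<^sub>M ?U)"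
    using Wm by (simp add: split_beta')
  note m'[measurable]
  have Bm: "(\<lambda>(x, y). B x y) \<in> borel_measurable (?U \<Otimes>\<^sub>M ?U)"
    unfolding B_def split_beta' by measurable
  have Gm: "(\<lambda>(x, y). G x y) \<in> borel_measurable (?U \<Otimes>\<^sub>M ?U)"
    unfolding G_def split_beta' by measurable
  have Em: "(\<lambda>(x, y). ennreal (Ent x y)) \<in> borel_measurable (?U \<Otimes>\<^sub>M ?U)"
    unfolding Ent_def by (rule entropy_integral(2)[OF W(1) p])
  have Bsym: "B a c = B c a" if "a \<in> {0..1}" "c \<in> {0..1}" for a c using Wsym[OF that] by (simp add: B_def)
  have Gsym: "G a c = G c a" if "a \<in> {0..1}" "c \<in> {0..1}" for a c using Wsym[OF that] by (simp add: G_def)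
  have Esym: "Ent a c = Ent c a" if "a \<in> {0..1}" "c \<in> {0..1}" for a c using Wsym[OF that] by (simp add: Ent_def)
  have Bbd: "0 \<le> B a c \<and> B a c \<le> 2 * p" if "a \<in> {0..1}" "c \<in> {0..1}" for a c
    using Wbd[OF that] p by (auto simp: B_def)
  have Gbd: "0 \<le> G a c \<and> G a c \<le> 1" if "a \<in> {0..1}" "c \<in> {0..1}" for a c
    using Wbd[OF that] by (auto simp: G_def)
  have Ebd: "0 \<le> Ent a c" if "a \<in> {0..1}" "c \<in> {0..1}" for a c
    using Wbd[OF that] entropy_nonneg[OF p] by (auto simp: Ent_def)
  have GE: "G a c \<le> 16 * Ent a c" if "a \<in> {0..1}" "c \<in> {0..1}" for a c
    using Wbd[OF that] le_entropy_of_large[OF p] Ebd[OF that] by (auto simp: G_def Ent_def)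
  have BE: "p \<le> B a c \<and> B a c - p \<le> p * \<theta> + 2 * Ent a c / \<theta>" if "a \<in> {0..1}" "c \<in> {0..1}" for a c
  proof (cases "W a c \<le> 2 * p")
    case True
    then show ?thesis using Wbd[OF that] abs_diff_le_entropy_of_small[OF p _ _ True \<theta>] by (simp add: B_def Ent_def)
  next
    case False
    then show ?thesis using Ebd[OF that] p \<theta> by (simp add: B_def)
  qed
  let ?I = "graphon_entropy p W"
  have EI: "(\<integral>\<^sup>+x. \<integral>\<^sup>+y. ennreal (Ent x y) \<partial>?U \<partial>?U) = ennreal ?I"
    unfolding Ent_def by (rule entropy_integral(1)[OF W(1) p])
  have I0: "0 \<le> ?I" by (rule entropy_integral(3)[OF W(1) p])
  \<comment> \<open>For \<open>B\<close> the weaker bound \<open>\<eta> * p\<close> on the entropy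
    is enough: it cancels the \<open>1 / p\<close> in \<open>c2\<close>. The full exponent is used
    for \<open>G\<close>.\<close>
  have "p powr (2 + gamma K) \<le> p powr 1" using p \<gamma> by (intro powr_mono') auto
  then have "?I \<le> \<eta> * p" using I \<eta>(1) p mult_left_mono[of "p powr (2 + gamma K)" p \<eta>] by simp
  define c1 where "c1 = p ^ ?n * (1 + 2 ^ ?n * real ?n * \<theta>)"
  define c2 where "c2 = p ^ ?n * 2 ^ ?n * (2 / (p * \<theta>))"
  have c: "0 \<le> c1" "0 \<le> c2" using p \<theta> by (simp_all add: c1_def c2_def)
  have pw: "(\<Prod>e\<in>K. ennreal (edge_value B x e)) \<le> ennreal c1 + ennreal c2 * (\<Sum>e\<in>K. ennreal (edge_value Ent x e))"
    if x: "x \<in> space ?P" for x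
  proof -
    let ?t = "\<lambda>e. (edge_value B x e - p) / p"
    have b: "p \<le> edge_value B x e \<and> edge_value B x e \<le> 2 * p \<and> edge_value B x e - p \<le> p * \<theta> + 2 * edge_value Ent x e / \<theta>
        \<and> 0 \<le> edge_value Ent x e"
      if e: "e \<in> K" for e
    proof -
      obtain u v where uv: "e = {u, v}" "u \<in> verts K" "v \<in> verts K" using simple_graph_edgeE[OF K e] by metis
      have 1: "edge_value B x e = B (x u) (x v)" unfolding uv(1)
        by (rule edge_value_on_cube[OF _ x uv(2,3)]) (rule Bsym)
      have 2: "edge_value Ent x e = Ent (x u) (x v)" unfolding uv(1)
        by (rule edge_value_on_cube[OF _ x uv(2,3)]) (rule Esym)
      note xx = PiM_unit_apply[OF x uv(2)] PiM_unit_apply[OF x uv(3)]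
      show ?thesis unfolding 1 2 using BE[OF xx] Bbd[OF xx] Ebd[OF xx] by simp
    qed
    have t: "0 \<le> ?t e \<and> ?t e \<le> 1" if "e \<in> K" for e using b[OF that] p by simp
    have "(\<Prod>e\<in>K. edge_value B x e) = (\<Prod>e\<in>K. p * (1 + ?t e))"
      using p by (intro prod.cong) (simp_all add: field_simps)
    also have "\<dots> = p ^ ?n * (\<Prod>e\<in>K. 1 + ?t e)" by (simp add: prod.distrib)
    also have "\<dots> \<le> p ^ ?n * (1 + 2 ^ ?n * (\<Sum>e\<in>K. ?t e))"
      using p t by (intro mult_left_mono prod_1_plus_le finK) auto
    also have "\<dots> \<le> p ^ ?n * (1 + 2 ^ ?n * (\<Sum>e\<in>K. \<theta> + 2 / (p * \<theta>) * edge_value Ent x e))"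
    proof -
      have "?t e \<le> \<theta> + 2 / (p * \<theta>) * edge_value Ent x e" if "e \<in> K" for e
      proof -
        have "?t e \<le> (p * \<theta> + 2 * edge_value Ent x e / \<theta>) / p" using b[OF that] p by (intro divide_right_mono) auto
        also have "\<dots> = \<theta> + 2 / (p * \<theta>) * edge_value Ent x e" using p \<theta> by (simp add: field_simps)
        finally show ?thesis .
      qed
      then show ?thesis using p by (intro mult_left_mono add_mono sum_mono) auto
    qed
    also have "\<dots> = c1 + c2 * (\<Sum>e\<in>K. edge_value Ent x e)"
      unfolding c1_def c2_def sum.distrib sum_distrib_left[symmetric] by (simp add: algebra_simps)
    finally have le: "(\<Prod>e\<in>K. edge_value B x e) \<le> c1 + c2 * (\<Sum>e\<in>K. edge_value Ent x e)" .
    have "(\<Prod>e\<in>K. ennreal (edge_value B x e)) = ennreal (\<Prod>e\<in>K. edge_value B x e)"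
      using b p by (intro prod_ennreal) force
    also have "\<dots> \<le> ennreal (c1 + c2 * (\<Sum>e\<in>K. edge_value Ent x e))" using le by (rule ennreal_leI)
    also have "\<dots> = ennreal c1 + ennreal c2 * ennreal (\<Sum>e\<in>K. edge_value Ent x e)"
      using c b by (simp add: sum_nonneg ennreal_plus ennreal_mult)
    also have "ennreal (\<Sum>e\<in>K. edge_value Ent x e) = (\<Sum>e\<in>K. ennreal (edge_value Ent x e))"
      using b by (intro sum_ennreal[symmetric]) auto
    finally show ?thesis .
  qed
  interpret P: prob_space ?P by (rule prob_space_PiM) (rule prob_space_unit)
  have Evm: "(\<lambda>x. ennreal (edge_value Ent x e)) \<in> borel_measurable ?P" if "e \<in> K" for e
  proof -
    have "(\<lambda>(x, y). Ent x y) \<in> borel_measurable (?U \<Otimes>\<^sub>M ?U)"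
      unfolding Ent_def using measurable_compose[OF Wm measurable_entropy[of p]] by (simp add: split_beta')
    then have "(\<lambda>x. edge_value Ent x e) \<in> borel_measurable ?P"
      using Esym by (intro measurable_edge_value[OF K that order_refl])
    then show ?thesis by measurable
  qed
  have "(\<integral>\<^sup>+x. (\<Prod>e\<in>K. ennreal (edge_value B x e)) \<partial>?P) \<le>
      (\<integral>\<^sup>+x. ennreal c1 + ennreal c2 * (\<Sum>e\<in>K. ennreal (edge_value Ent x e)) \<partial>?P)"
    by (rule nn_integral_mono[OF pw])
  also have "\<dots> = (\<integral>\<^sup>+x. ennreal c1 \<partial>?P) + (\<integral>\<^sup>+x. ennreal c2 * (\<Sum>e\<in>K. ennreal (edge_value Ent x e)) \<partial>?P)"
    using Evm by (intro nn_integral_add borel_measurable_times_ennreal borel_measurable_sum) auto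
  also have "(\<integral>\<^sup>+x. ennreal c1 \<partial>?P) = ennreal c1" by (simp add: P.emeasure_space_1)
  also have "(\<integral>\<^sup>+x. ennreal c2 * (\<Sum>e\<in>K. ennreal (edge_value Ent x e)) \<partial>?P) =
      ennreal c2 * (\<integral>\<^sup>+x. (\<Sum>e\<in>K. ennreal (edge_value Ent x e)) \<partial>?P)"
    using Evm by (intro nn_integral_cmult borel_measurable_sum)
  also have "(\<integral>\<^sup>+x. (\<Sum>e\<in>K. ennreal (edge_value Ent x e)) \<partial>?P) = (\<Sum>e\<in>K. \<integral>\<^sup>+x. ennreal (edge_value Ent x e) \<partial>?P)"
    using Evm by (rule nn_integral_sum)
  also have "\<dots> = (\<Sum>e\<in>K. ennreal ?I)"
    using edge_value_nn_integral[OF K _ Em Esym] EI by (intro sum.cong) auto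
  also have "\<dots> = ennreal (?n * ?I)" using I0 by (simp add: ennreal_mult ennreal_of_nat_eq_real_of_nat)
  also have "ennreal c1 + ennreal c2 * ennreal (?n * ?I) = ennreal (c1 + c2 * (?n * ?I))"
    using c I0 by (simp add: ennreal_plus ennreal_mult)
  also have "c1 + c2 * (?n * ?I) \<le> c1 + c2 * (?n * (\<eta> * p))"
    using c \<open>?I \<le> \<eta> * p\<close> by (intro add_left_mono mult_left_mono) auto
  also have "\<dots> = p ^ ?n * (1 + 2 ^ ?n * real ?n * (\<theta> + 2 * \<eta> / \<theta>))"
    unfolding c1_def c2_def using p \<theta> by (simp add: field_simps)
  finally have main: "(\<integral>\<^sup>+x. (\<Prod>e\<in>K. ennreal (edge_value B x e)) \<partial>?P) \<le>
      ennreal (p ^ ?n * (1 + 2 ^ ?n * real ?n * (\<theta> + 2 * \<eta> / \<theta>)))" by (simp add: ennreal_leI)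
  have rest: "(\<integral>\<^sup>+x. (\<Prod>e\<in>F. ennreal (edge_value G x e)) \<partial>?P) \<le> ennreal (16 * \<eta> * p ^ card F)"
    if F: "F \<subseteq> K" "F \<noteq> {}" for F
  proof -
    have deg: "(\<integral>\<^sup>+b. ennreal (G a b) \<partial>?U) \<le> ennreal p" if a: "a \<in> {0..1}" for a
    proof -
      have "(\<integral>\<^sup>+b. ennreal (G a b) \<partial>?U) \<le> (\<integral>\<^sup>+b. ennreal (W a b) \<partial>?U)"
        using Wbd[OF a] by (intro nn_integral_mono ennreal_leI) (simp add: G_def space_unit)
      then show ?thesis using p_regular_nn_integral[OF W a] by simp
    qed
    have "(\<integral>\<^sup>+a. \<integral>\<^sup>+b. ennreal (G a b) \<partial>?U \<partial>?U) \<le> (\<integral>\<^sup>+a. \<integral>\<^sup>+b. ennreal 16 * ennreal (Ent a b) \<partial>?U \<partial>?U)"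
    proof (intro nn_integral_mono)
      fix a b assume "a \<in> space ?U" "b \<in> space ?U"
      then have ab: "a \<in> {0..1}" "b \<in> {0..1}" by (simp_all add: space_unit)
      have "ennreal (G a b) \<le> ennreal (16 * Ent a b)" using GE[OF ab] by (rule ennreal_leI)
      also have "\<dots> = ennreal 16 * ennreal (Ent a b)" using Ebd[OF ab] by (intro ennreal_mult) auto
      finally show "ennreal (G a b) \<le> ennreal 16 * ennreal (Ent a b)" .
    qed
    also have "\<dots> = (\<integral>\<^sup>+a. ennreal 16 * (\<integral>\<^sup>+b. ennreal (Ent a b) \<partial>?U) \<partial>?U)"
      using measurable_Pair2[OF Em] by (intro nn_integral_cong nn_integral_cmult) simp
    also have "\<dots> = ennreal 16 * ennreal ?I"
      unfolding EI[symmetric]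
      using sigma_finite_measure.borel_measurable_nn_integral_fst[OF prob_space_imp_sigma_finite[OF prob_space_unit] Em]
      by (intro nn_integral_cmult) simp
    also have "\<dots> \<le> ennreal (16 * \<eta> * p powr (2 + gamma K))"
      using I I0 by (simp add: ennreal_mult[symmetric] ennreal_leI del: ennreal_numeral)
    finally have tot: "(\<integral>\<^sup>+a. \<integral>\<^sup>+b. ennreal (G a b) \<partial>?U \<partial>?U) \<le> ennreal (16 * \<eta> * p powr (2 + gamma K))" .
    have p1: "p \<le> 1" and M: "0 \<le> 16 * \<eta>" using p \<eta> by simp_all
    have VK: "verts F \<subseteq> verts K" using F(1) by auto
    obtain k where k: "2 \<le> k" "(\<integral>\<^sup>+x. (\<Prod>e\<in>F. ennreal (edge_value G x e)) \<partial>?P)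
      \<le> ennreal (sqrt (16 * \<eta>) ^ k * p ^ card F)"
      using edge_product_integral_le_gamma[OF K F finite_verts[OF K] VK Gm Gsym Gbd deg tot p(1) p1 M] by metis
    \<comment> \<open>As \<open>16 * \<eta>\<close> is at most 1 and \<open>k\<close> at least 2,
      the bound becomes linear in \<open>\<eta>\<close> and its constant does not depend on
      \<open>F\<close>.\<close>
    have "sqrt (16 * \<eta>) ^ k \<le> sqrt (16 * \<eta>) ^ 2"
      using k(1) \<eta> by (intro power_decreasing) auto
    also have "\<dots> = 16 * \<eta>" using M by (rule real_sqrt_pow2)
    finally have "sqrt (16 * \<eta>) ^ k * p ^ card F \<le> 16 * \<eta> * p ^ card F"
      using p by (intro mult_right_mono) auto
    then show ?thesis using k(2) by (meson ennreal_leI order_trans)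
  qed
  have "Hom K W \<le> p ^ ?n * (1 + 2 ^ ?n * real ?n * (\<theta> + 2 * \<eta> / \<theta>)) + (2 * 2) ^ ?n * (16 * \<eta>) * p ^ ?n"
  proof (rule Hom_le_split[OF K Wm Bm Gm Wsym Bsym Gsym _ Bbd Gbd main])
    show "0 \<le> W a c \<and> W a c \<le> B a c + G a c" if "a \<in> {0..1}" "c \<in> {0..1}" for a c
      using Wbd[OF that] p by (auto simp: B_def G_def)
  qed (use p \<eta> \<theta> rest in auto)
  then show ?thesis by simp
qed

lemma entropy_lower_bound:
  assumes K: "simple_graph K" and \<gamma>: "0 \<le> gamma K" and \<delta>: "0 < \<delta>"
  shows "\<exists>\<eta>>0. \<forall>p W. 0 < p \<longrightarrow> p < 1 \<longrightarrow> graphon W \<longrightarrow> p_regular p W \<longrightarrow>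
    (1 + \<delta>) * p ^ card K \<le> Hom K W \<longrightarrow> \<eta> * p powr (2 + gamma K) \<le> graphon_entropy p W"
proof -
  \<comment> \<open>The \<open>+ 1\<close> keeps \<open>E\<close> positive even without edges. The
    choices of \<open>\<theta>\<close> and \<open>\<eta>\<close> make each of the three errors
    \<open>E * \<theta>\<close>, \<open>2 * E * \<eta> / \<theta>\<close> and
    \<open>4 ^ card K * 16 * \<eta>\<close> at most \<open>\<delta> / 4\<close>, so that together
    they stay below \<open>\<delta>\<close>.\<close>
  define E :: real where "E = 2 ^ card K * (real (card K) + 1)"
  have E: "0 < E" "2 ^ card K * real (card K) \<le> E" by (auto simp: E_def intro: add_nonneg_pos)
  define \<theta> where "\<theta> = \<delta> / (4 * E)"
  have \<theta>: "0 < \<theta>" using \<delta> E by (simp add: \<theta>_def)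
  define \<eta> where "\<eta> = min (1/16) (min (\<delta> * \<theta> / (8 * E)) (\<delta> / (64 * 4 ^ card K)))"
  have \<eta>: "0 < \<eta>" "16 * \<eta> \<le> 1" "\<eta> \<le> \<delta> * \<theta> / (8 * E)" "\<eta> \<le> \<delta> / (64 * 4 ^ card K)"
  proof -
    have "0 < \<delta> * \<theta> / (8 * E)" "0 < \<delta> / (64 * 4 ^ card K)" using \<delta> \<theta> E by simp_all
    then show "0 < \<eta>" "16 * \<eta> \<le> 1" "\<eta> \<le> \<delta> * \<theta> / (8 * E)" "\<eta> \<le> \<delta> / (64 * 4 ^ card K)"
      unfolding \<eta>_def by linarith+
  qed
  show ?thesis
  proof (intro exI[of _ \<eta>] conjI allI impI \<eta>(1))
    fix p W assume p: "0 < p" "p < 1" and W: "graphon W" "p_regular p W"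
      and H: "(1 + \<delta>) * p ^ card K \<le> Hom K W"
    show "\<eta> * p powr (2 + gamma K) \<le> graphon_entropy p W"
    proof (rule ccontr)
      assume "\<not> ?thesis"
      then have I: "graphon_entropy p W \<le> \<eta> * p powr (2 + gamma K)" by simp
      have "0 \<le> \<eta>" using \<eta> by simp
      note le = Hom_le_of_entropy_le[OF K \<gamma> W p I this \<eta>(2) \<theta>]
      have "2 ^ card K * real (card K) * (\<theta> + 2 * \<eta> / \<theta>) \<le> E * (\<theta> + 2 * \<eta> / \<theta>)"
        using E \<theta> \<eta> by (intro mult_right_mono) auto
      also have "\<dots> \<le> E * (\<delta> / (4 * E) + \<delta> / (4 * E))"
      proof -
        have "2 * \<eta> / \<theta> \<le> \<delta> / (4 * E)" using \<eta>(3) \<theta> E by (simp add: field_simps)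
        then show ?thesis using E by (intro mult_left_mono add_mono) (auto simp: \<theta>_def)
      qed
      also have "\<dots> = \<delta> / 2" using E by (simp add: field_simps)
      finally have a1: "2 ^ card K * real (card K) * (\<theta> + 2 * \<eta> / \<theta>) \<le> \<delta> / 2" .
      have a2: "4 ^ card K * (16 * \<eta>) \<le> \<delta> / 4" using \<eta>(4) by (simp add: field_simps)
      have "Hom K W \<le> p ^ card K * (1 + \<delta> / 2) + (\<delta> / 4) * p ^ card K"
        proof (rule order_trans[OF le])
        show "p ^ card K * (1 + 2 ^ card K * real (card K) * (\<theta> + 2 * \<eta> / \<theta>)) + 4 ^ card K * (16 * \<eta>) * p ^ card K
            \<le> p ^ card K * (1 + \<delta> / 2) + (\<delta> / 4) * p ^ card K"
          using p by (intro add_mono mult_left_mono mult_right_mono order_refl a1 a2) auto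
      qed
      also have "\<dots> < (1 + \<delta>) * p ^ card K"
      proof -
        have "0 < p ^ card K" using p by simp
        then have "0 < \<delta> * p ^ card K" using \<delta> by simp
        then show ?thesis by (simp add: algebra_simps)
      qed
      finally show False using H by simp
    qed
  qed
qed

section \<open>The polynomial \<open>P\<close> and \<open>\<rho>\<close>\<close>

lemma rpow_nonneg: "0 \<le> rpow x a"
  by (simp add: rpow_def)

lemma rpow_mono: "0 \<le> x \<Longrightarrow> x \<le> y \<Longrightarrow> 0 \<le> a \<Longrightarrow> rpow x a \<le> rpow y a"
  by (simp add: rpow_def powr_mono2)

lemma rpow_mult: "0 \<le> x \<Longrightarrow> 0 \<le> y \<Longrightarrow> rpow (x * y) a = rpow x a * rpow y a"
  by (simp add: rpow_def powr_mult)

text \<open>At equal positive arguments \<open>z = w = x\<close> the term of every valid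
  \<open>A\<close> is therefore \<open>x powr cover_number H\<close>, whatever the size of
  \<open>A\<close>.\<close>

lemma power_mult_rpow:
  assumes "0 < x" shows "x ^ n * rpow x (c - real n) = x powr c"
proof -
  have "x ^ n * rpow x (c - real n) = x powr real n * x powr (c - real n)"
    using assms by (simp add: rpow_def powr_realpow)
  also have "\<dots> = x powr c" by (simp add: powr_add[symmetric])
  finally show ?thesis .
qed

lemma valid_card_le:
  assumes "simple_graph H" "valid H A" shows "real (card A) \<le> cover_number H"
proof -
  obtain c where c: "minimum_cover H c" "\<forall>v\<in>A. c v = 1" "A \<subseteq> verts H"
    using assms(2) unfolding valid_def by blast
  have fc: "fractional_cover H c" using c(1) by (simp add: minimum_cover_def)
  have "real (card A) = (\<Sum>v\<in>A. c v)" using c(2) by simp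
  also have "\<dots> \<le> (\<Sum>v\<in>verts H. c v)"
    using c(3) fractional_coverD(1)[OF fc] by (intro sum_mono2 finite_verts[OF assms(1)]) blast+
  finally show ?thesis using c(1) by (simp add: minimum_cover_def)
qed

lemma exists_valid:
  assumes "simple_graph H" shows "\<exists>A. valid H A"
proof -
  obtain c where c: "minimum_cover H c" "\<And>v. v \<in> verts H \<Longrightarrow> c v \<in> {0, 1/2, 1}"
    using half_integral_minimum_cover[OF assms] by metis
  have "valid H {v \<in> verts H. c v = 1}"
    unfolding valid_def using c by (intro conjI exI[of _ c]) blast+
  then show ?thesis ..
qed

lemma finite_valid: "simple_graph H \<Longrightarrow> finite {A. valid H A}"
  by (rule finite_subset[of _ "Pow (verts H)"]) (auto simp: valid_def dest: finite_verts)

lemma finite_contributing: "simple_graph K \<Longrightarrow> finite {H. contributing K H}"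
  by (rule finite_subset[of _ "Pow K"]) (auto simp: contributing_def simple_graph_def)

lemma contributing_simple: "simple_graph K \<Longrightarrow> contributing K H \<Longrightarrow> simple_graph H"
  by (auto simp: contributing_def intro: simple_graph_subset)

lemma valid_empty: "valid ({} :: 'a set set) A \<longleftrightarrow> A = {}"
proof -
  have "minimum_cover ({} :: 'a set set) (\<lambda>_. 0)" by (simp add: minimum_cover_def fractional_cover_def)
  then show ?thesis by (auto simp: valid_def)
qed

definition P_term :: "'a set set \<Rightarrow> real \<Rightarrow> real \<Rightarrow> 'a set \<Rightarrow> real" where
  "P_term H z w A = z ^ card A * rpow w (cover_number H - real (card A))"

text \<open>Without the constant term of the empty subgraph every monomial has degree
  \<open>cover_number H >= 1\<close>, so this part grows at least linearly under scaling.\<close>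

definition P_tail :: "'a set set \<Rightarrow> real \<Rightarrow> real \<Rightarrow> real" where
  "P_tail K z w = (\<Sum>H | contributing K H \<and> H \<noteq> {}. \<Sum>A | valid H A. P_term H z w A)"

lemma P_poly_eq:
  fixes K :: "'a set set"
  assumes "simple_graph K" shows "P_poly K z w = 1 + P_tail K z w"
proof -
  have "P_poly K z w = (\<Sum>H\<in>{H. contributing K H}. \<Sum>A | valid H A. P_term H z w A)"
    by (simp add: P_poly_def P_term_def)
  also have "\<dots> = (\<Sum>A | valid ({} :: 'a set set) A. P_term {} z w A) + (\<Sum>H\<in>{H. contributing K H} - {{}}. \<Sum>A | valid H A. P_term H z w A)"
    using finite_contributing[OF assms] contributing_empty[of K] by (intro sum.remove) auto
  also have "(\<Sum>A | valid ({} :: 'a set set) A. P_term {} z w A) = 1" by (simp add: valid_empty P_term_def rpow_def)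
  also have "{H. contributing K H} - {{}} = {H. contributing K H \<and> H \<noteq> {}}" by auto
  finally show ?thesis by (simp add: P_tail_def)
qed

lemma P_term_nonneg: "0 \<le> z \<Longrightarrow> 0 \<le> P_term H z w A"
  by (simp add: P_term_def rpow_nonneg)

context
  fixes K :: "'a set set"
  assumes K: "simple_graph K"
begin

lemma P_tail_mono:
  assumes "0 \<le> z" "z \<le> z'" "0 \<le> w" "w \<le> w'"
  shows "P_tail K z w \<le> P_tail K z' w'"
  unfolding P_tail_def P_term_def
proof (intro sum_mono mult_mono power_mono rpow_mono rpow_nonneg)
  fix H A assume "H \<in> {H. contributing K H \<and> H \<noteq> {}}" "A \<in> {A. valid H A}"
  then show "0 \<le> cover_number H - real (card A)"
    using valid_card_le[of H A] contributing_simple[OF K, of H] by simp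
qed (use assms in auto)

lemma P_tail_scale:
  assumes "0 \<le> z" "0 \<le> w" "1 \<le> s"
  shows "s * P_tail K z w \<le> P_tail K (s * z) (s * w)"
  unfolding P_tail_def sum_distrib_left
proof (intro sum_mono)
  fix H A assume HA: "H \<in> {H. contributing K H \<and> H \<noteq> {}}" "A \<in> {A. valid H A}"
  then have "1 \<le> cover_number H" using contributing_simple[OF K] by (intro cover_number_ge_1) auto
  then have "s powr 1 \<le> s powr cover_number H" using assms(3) by (intro powr_mono) auto
  then have "s * P_term H z w A \<le> s powr cover_number H * P_term H z w A"
    using assms by (intro mult_right_mono P_term_nonneg) auto
  also have "\<dots> = (s ^ card A * rpow s (cover_number H - real (card A))) * P_term H z w A"
    using assms(3) by (simp add: power_mult_rpow)
  also have "\<dots> = P_term H (s * z) (s * w) A"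
    using assms by (simp add: P_term_def rpow_mult power_mult_distrib)
  finally show "s * P_term H z w A \<le> P_term H (s * z) (s * w) A" .
qed

lemma P_tail_small:
  assumes "0 \<le> z" "z \<le> x" "0 \<le> w" "w \<le> x" "0 < x" "x \<le> 1"
  shows "P_tail K z w \<le> x * (\<Sum>H | contributing K H \<and> H \<noteq> {}. real (card {A. valid H A}))"
proof -
  have "P_tail K z w \<le> P_tail K x x" using assms by (intro P_tail_mono) auto
  also have "\<dots> \<le> (\<Sum>H | contributing K H \<and> H \<noteq> {}. \<Sum>A | valid H A. x)"
    unfolding P_tail_def
  proof (intro sum_mono)
    fix H A assume HA: "H \<in> {H. contributing K H \<and> H \<noteq> {}}" "A \<in> {A. valid H A}"
    then have "1 \<le> cover_number H" using contributing_simple[OF K] by (intro cover_number_ge_1) auto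
    then have "x powr cover_number H \<le> x powr 1" using assms by (intro powr_mono') auto
    then show "P_term H x x A \<le> x" using assms by (simp add: P_term_def power_mult_rpow)
  qed
  finally show ?thesis by (simp add: sum_distrib_left mult.commute)
qed

lemma P_tail_large:
  assumes "contributing K H" "H \<noteq> {}" "1 \<le> x"
  shows "x \<le> P_tail K x x"
proof -
  note sg = contributing_simple[OF K assms(1)]
  obtain A where A: "valid H A" using exists_valid[OF sg] by blast
  have "x powr 1 \<le> x powr cover_number H"
    using assms(3) cover_number_ge_1[OF sg assms(2)] by (intro powr_mono) auto
  then have "x \<le> P_term H x x A" using assms(3) by (simp add: P_term_def power_mult_rpow)
  also have "\<dots> \<le> (\<Sum>A | valid H A. P_term H x x A)"
    using A finite_valid[OF sg] assms(3) by (intro member_le_sum P_term_nonneg) auto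
  also have "\<dots> \<le> P_tail K x x"
    unfolding P_tail_def
  proof (rule member_le_sum)
    show "H \<in> {H. contributing K H \<and> H \<noteq> {}}" using assms by simp
    show "finite {H. contributing K H \<and> H \<noteq> {}}"
      by (rule finite_subset[OF _ finite_contributing[OF K]]) auto
  qed (use assms in \<open>auto intro!: sum_nonneg P_term_nonneg\<close>)
  finally show ?thesis .
qed

section \<open>Feasible points and the infimum rho\<close>

context
  fixes \<delta> :: real and H\<^sub>1 :: "'a set set"
  assumes \<delta>: "0 < \<delta>" and H\<^sub>1: "contributing K H\<^sub>1" "H\<^sub>1 \<noteq> {}"
begin

lemma feasible_exists: "\<exists>z w. 0 \<le> z \<and> 0 \<le> w \<and> 1 + \<delta> \<le> P_poly K z w"
proof -
  let ?x = "max 1 \<delta>"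
  have "1 + \<delta> \<le> P_poly K ?x ?x"
    using P_tail_large[OF H\<^sub>1, of ?x] by (simp add: P_poly_eq[OF K])
  then show ?thesis by (intro exI[of _ ?x]) auto
qed

lemma rho_le:
  assumes "0 \<le> z" "0 \<le> w" "1 + \<delta> \<le> P_poly K z w" shows "rho K \<delta> \<le> z + w / 2"
  unfolding rho_def by (rule cInf_lower, use assms in blast, rule bdd_belowI[of _ 0], auto)

lemma rho_approx:
  assumes "0 < \<tau>"
  shows "\<exists>z w. 0 \<le> z \<and> 0 \<le> w \<and> 1 + \<delta> \<le> P_poly K z w \<and> z + w / 2 \<le> rho K \<delta> + \<tau>"
proof -
  let ?X = "{z + w / 2 | z w. 0 \<le> z \<and> 0 \<le> w \<and> 1 + \<delta> \<le> P_poly K z w}"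
  have lt: "Inf ?X < rho K \<delta> + \<tau>" using assms by (simp add: rho_def)
  have ne: "?X \<noteq> {}" using feasible_exists by blast
  obtain x where "x \<in> ?X" "x < rho K \<delta> + \<tau>" using cInf_lessD[OF ne lt] by blast
  then show ?thesis by fastforce
qed

text \<open>If both coordinates are at most \<open>x\<close> the tail stays below
  \<open>\<delta>\<close>, so a feasible point has a coordinate above \<open>x\<close> and a value
  above \<open>x / 2\<close>; the approximation error \<open>x / 4\<close> cannot close this gap.
  Positivity allows division by \<open>rho\<close>.\<close>

lemma rho_pos: "0 < rho K \<delta>"
proof -
  define N where "N = (\<Sum>H | contributing K H \<and> H \<noteq> {}. real (card {A. valid H A}))"
  have N: "0 \<le> N" unfolding N_def by (intro sum_nonneg) auto
  define x where "x = min 1 (\<delta> / (2 * (N + 1)))"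
  have x: "0 < x" "x \<le> 1" "x \<le> \<delta> / (2 * (N + 1))" using \<delta> N by (simp_all add: x_def)
  have "x * N \<le> \<delta> / (2 * (N + 1)) * (N + 1)" using x N \<delta> by (intro mult_mono) auto
  also have "\<dots> = \<delta> / 2" using N by (simp add: field_simps)
  finally have xN: "x * N < \<delta>" using \<delta> by linarith
  obtain z w where zw: "0 \<le> z" "0 \<le> w" "1 + \<delta> \<le> P_poly K z w" "z + w / 2 \<le> rho K \<delta> + x / 4"
    using rho_approx[of "x / 4"] x by auto
  have "\<not> (z \<le> x \<and> w \<le> x)"
  proof
    assume "z \<le> x \<and> w \<le> x"
    then have "P_tail K z w \<le> x * N" unfolding N_def using zw x by (intro P_tail_small) auto
    then show False using zw(3) xN by (simp add: P_poly_eq[OF K])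
  qed
  then have "x / 2 < z + w / 2" using zw x by auto
  then show ?thesis using zw(4) x by linarith
qed

text \<open>Near-optimal parameters, moved slightly into the interior to gain a little room in the
  constraint.\<close>

lemma parameter_choice:
  obtains z w :: "real \<Rightarrow> real" and M :: real where
    "((\<lambda>p. z p + w p / 2) \<longlongrightarrow> rho K \<delta>) (at_right 0)"
    "\<And>p. 0 < p \<Longrightarrow> p < exp (-1) \<Longrightarrow> 1 / ln (1 / p) \<le> z p \<and> z p \<le> M"
    "\<And>p. 0 < p \<Longrightarrow> p < exp (-1) \<Longrightarrow> 1 / ln (1 / p) \<le> w p \<and> w p \<le> M"
    "\<And>p. 0 < p \<Longrightarrow> p < exp (-1) \<Longrightarrow> 1 + \<delta> + \<delta> / ln (1 / p) \<le> P_poly K (z p) (w p)"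
    "1 \<le> M"
proof -
  let ?\<rho> = "rho K \<delta>"
  have "\<forall>\<tau>. \<exists>zw. 0 < \<tau> \<longrightarrow> 0 \<le> fst zw \<and> 0 \<le> snd zw \<and> 1 + \<delta> \<le> P_poly K (fst zw) (snd zw) \<and>
      fst zw + snd zw / 2 \<le> ?\<rho> + \<tau>"
  proof
    fix \<tau> :: real
    show "\<exists>zw. 0 < \<tau> \<longrightarrow> 0 \<le> fst zw \<and> 0 \<le> snd zw \<and> 1 + \<delta> \<le> P_poly K (fst zw) (snd zw) \<and>
      fst zw + snd zw / 2 \<le> ?\<rho> + \<tau>"
    proof (cases "0 < \<tau>")
      case True
      then obtain z w where "0 \<le> z" "0 \<le> w" "1 + \<delta> \<le> P_poly K z w" "z + w / 2 \<le> ?\<rho> + \<tau>"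
        using rho_approx by blast
      then show ?thesis by (intro exI[of _ "(z, w)"]) simp
    qed simp
  qed
  then obtain f where f: "\<And>\<tau>. 0 < \<tau> \<Longrightarrow> 0 \<le> fst (f \<tau>) \<and> 0 \<le> snd (f \<tau>) \<and>
      1 + \<delta> \<le> P_poly K (fst (f \<tau>)) (snd (f \<tau>)) \<and> fst (f \<tau>) + snd (f \<tau>) / 2 \<le> ?\<rho> + \<tau>"
    by metis
  \<comment> \<open>One scale serves as the error in the infimum, in the scaling factor
    \<open>1 + t\<close>, and as the amount added to keep \<open>z\<close> and \<open>w\<close>
    positive. It tends to 0, but more slowly than every positive power of \<open>p\<close>; for
    \<open>p < exp (-1)\<close> it is below 1.\<close>
  define t where "t p = 1 / ln (1 / p)" for p :: real
  define z where "z p = (1 + t p) * fst (f (t p)) + t p" for p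
  define w where "w p = (1 + t p) * snd (f (t p)) + t p" for p
  have t: "0 < t p" "t p < 1" if "0 < p" "p < exp (-1)" for p
  proof -
    have "ln p < ln (exp (-1))" using that by (subst ln_less_cancel_iff) auto
    then have "1 < ln (1 / p)" using that by (simp add: ln_div)
    then show "0 < t p" "t p < 1" by (simp_all add: t_def)
  qed
  have bounds: "t p \<le> z p \<and> z p \<le> 4 * ?\<rho> + 5 \<and> t p \<le> w p \<and> w p \<le> 4 * ?\<rho> + 5 \<and>
      1 + \<delta> + \<delta> * t p \<le> P_poly K (z p) (w p) \<and> ?\<rho> \<le> z p + w p / 2 \<and>
      z p + w p / 2 \<le> (1 + t p) * (?\<rho> + t p) + 3 / 2 * t p" if p: "0 < p" "p < exp (-1)" for p
  proof -
    note tp = t[OF p]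
    define z0 where "z0 = fst (f (t p))"
    define w0 where "w0 = snd (f (t p))"
    have zw0: "0 \<le> z0" "0 \<le> w0" "1 + \<delta> \<le> P_poly K z0 w0" "z0 + w0 / 2 \<le> ?\<rho> + t p"
      using f[OF tp(1)] by (simp_all add: z0_def w0_def)
    have zp: "z p = (1 + t p) * z0 + t p" and wp: "w p = (1 + t p) * w0 + t p"
      by (simp_all add: z_def w_def z0_def w0_def)
    have z1: "0 \<le> (1 + t p) * z0" "(1 + t p) * z0 \<le> 2 * (?\<rho> + 1)"
      by (rule mult_nonneg_nonneg mult_mono; use zw0 tp rho_pos in linarith)+
    have w1: "0 \<le> (1 + t p) * w0" "(1 + t p) * w0 \<le> 2 * (2 * ?\<rho> + 2)"
      by (rule mult_nonneg_nonneg mult_mono; use zw0 tp rho_pos in linarith)+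
    have "\<delta> \<le> P_tail K z0 w0" using zw0(3) by (simp add: P_poly_eq[OF K])
    then have "(1 + t p) * \<delta> \<le> (1 + t p) * P_tail K z0 w0" using tp by (intro mult_left_mono) auto
    also have "\<dots> \<le> P_tail K ((1 + t p) * z0) ((1 + t p) * w0)" using zw0 tp by (intro P_tail_scale) auto
    also have "\<dots> \<le> P_tail K (z p) (w p)" unfolding zp wp using z1 w1 tp by (intro P_tail_mono) auto
    finally have P: "1 + \<delta> + \<delta> * t p \<le> P_poly K (z p) (w p)"
      by (simp add: P_poly_eq[OF K] algebra_simps)
    have "0 < \<delta> * t p" using \<delta> tp by simp
    then have "?\<rho> \<le> z p + w p / 2" using P z1 w1 tp zp wp by (intro rho_le) auto
    have "z p + w p / 2 = (1 + t p) * (z0 + w0 / 2) + 3 / 2 * t p"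
      unfolding zp wp by (simp add: field_simps)
    moreover have "(1 + t p) * (z0 + w0 / 2) \<le> (1 + t p) * (?\<rho> + t p)"
      using zw0 tp by (intro mult_left_mono) auto
    ultimately have up: "z p + w p / 2 \<le> (1 + t p) * (?\<rho> + t p) + 3 / 2 * t p" by linarith
    have "z p \<le> 2 * (?\<rho> + 1) + t p" unfolding zp using z1(2) by (rule add_right_mono)
    moreover have "w p \<le> 2 * (2 * ?\<rho> + 2) + t p" unfolding wp using w1(2) by (rule add_right_mono)
    moreover have "2 * (?\<rho> + 1) + 1 \<le> 4 * ?\<rho> + 5" "2 * (2 * ?\<rho> + 2) + 1 \<le> 4 * ?\<rho> + 5"
      using rho_pos by simp_all
    ultimately have "z p \<le> 4 * ?\<rho> + 5" "w p \<le> 4 * ?\<rho> + 5" using tp(2) by linarith+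
    moreover have "t p \<le> z p" "t p \<le> w p" unfolding zp wp using z1 w1 by linarith+
    ultimately show ?thesis using P up \<open>?\<rho> \<le> z p + w p / 2\<close> by blast
  qed
  have ev: "eventually (\<lambda>p. 0 < p \<and> p < exp (-1::real)) (at_right 0)"
    unfolding eventually_at_right_field by (intro exI[of _ "exp (-1)"]) auto
  have "((\<lambda>p. z p + w p / 2) \<longlongrightarrow> ?\<rho>) (at_right 0)"
  proof (rule tendsto_sandwich)
    show "eventually (\<lambda>p. ?\<rho> \<le> z p + w p / 2) (at_right 0)"
      using ev by eventually_elim (use bounds in blast)
    show "eventually (\<lambda>p. z p + w p / 2 \<le> (1 + t p) * (?\<rho> + t p) + 3 / 2 * t p) (at_right 0)"
      using ev by eventually_elim (use bounds in blast)
    have "(t \<longlongrightarrow> 0) (at_right 0)" unfolding t_def by real_asymp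
    then have "((\<lambda>p. (1 + t p) * (?\<rho> + t p) + 3 / 2 * t p) \<longlongrightarrow> (1 + 0) * (?\<rho> + 0) + 3 / 2 * 0) (at_right 0)"
      by (intro tendsto_intros)
    then show "((\<lambda>p. (1 + t p) * (?\<rho> + t p) + 3 / 2 * t p) \<longlongrightarrow> ?\<rho>) (at_right 0)" by simp
  qed simp
  moreover have "1 \<le> 4 * ?\<rho> + 5" using rho_pos by simp
  ultimately show ?thesis
    using that[of z w "4 * ?\<rho> + 5"] bounds unfolding t_def by simp
qed

end

end

section \<open>The hub-clique graphon\<close>

definition block_idx :: "real \<Rightarrow> real \<Rightarrow> real \<Rightarrow> real \<Rightarrow> nat" where
  "block_idx p a b x = (if x < a then 1 else if x < a + b then 2 else if x < p then 3 else 4)"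

definition block_set :: "real \<Rightarrow> real \<Rightarrow> real \<Rightarrow> nat \<Rightarrow> real set" where
  "block_set p a b i =
    (if i = 1 then {0..<a} else if i = 2 then {a..<a + b} else if i = 3 then {a + b..<p} else {p..1})"

definition block_len :: "real \<Rightarrow> real \<Rightarrow> real \<Rightarrow> nat \<Rightarrow> real" where
  "block_len p a b i = (if i = 1 then a else if i = 2 then b else if i = 3 then p - a - b else 1 - p)"

text \<open>Block 1 is a hub joined completely to \<open>[0, p)\<close>, the union of blocks 1 to 3, and block 2 is
  a clique. The values towards block 4 are what \<open>p\<close>-regularity leaves.\<close>

definition block_weight :: "real \<Rightarrow> real \<Rightarrow> real \<Rightarrow> nat \<Rightarrow> nat \<Rightarrow> real" where
  "block_weight p a b i j =
    (if i = 4 \<and> j = 4 then p + (2 * p * a - a\<^sup>2 + b\<^sup>2) / (1 - p)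
     else if i = 4 \<and> j = 1 \<or> i = 1 \<and> j = 4 then 0
     else if i = 4 \<and> j = 2 \<or> i = 2 \<and> j = 4 then p - a - b
     else if i = 4 \<or> j = 4 then p - a
     else if i = 1 \<or> j = 1 \<or> i = 2 \<and> j = 2 then 1
     else p)"

definition hub_clique :: "real \<Rightarrow> real \<Rightarrow> real \<Rightarrow> real \<Rightarrow> real \<Rightarrow> real" where
  "hub_clique p a b x y = block_weight p a b (block_idx p a b x) (block_idx p a b y)"

text \<open>Reuses \<open>edge_value\<close> for block maps, by encoding block numbers as reals.\<close>

definition edge_weight :: "(nat \<Rightarrow> nat \<Rightarrow> real) \<Rightarrow> ('a \<Rightarrow> nat) \<Rightarrow> 'a set \<Rightarrow> real" where
  "edge_weight w B = edge_value (\<lambda>s t. w (nat \<lfloor>s\<rfloor>) (nat \<lfloor>t\<rfloor>)) (\<lambda>v. real (B v))"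

lemma edge_weight_doubleton: "w (B u) (B v) = w (B v) (B u) \<Longrightarrow> edge_weight w B {u, v} = w (B u) (B v)"
  unfolding edge_weight_def by (subst edge_value_doubleton) simp_all

lemma block_weight_sym: "block_weight p a b i j = block_weight p a b j i"
  by (simp add: block_weight_def)

lemma nat_1_to_4: "i \<in> {1..4::nat} \<longleftrightarrow> i = 1 \<or> i = 2 \<or> i = 3 \<or> i = 4" by auto

lemma sum_1_to_4: "(\<Sum>i\<in>{1..4::nat}. f i) = f 1 + f 2 + f 3 + (f 4 :: real)"
proof -
  have "{1..4::nat} = {1, 2, 3, 4}" by auto
  then show ?thesis by (simp add: add.assoc)
qed

locale hub_clique_params =
  fixes p a b :: real
  assumes p: "p < 1/4" and ab: "0 < a" "0 < b" "a + b < p"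
begin

lemma p_bounds: "0 < p" "p < 1" using p ab by auto

abbreviation "S \<equiv> block_set p a b"
abbreviation "m \<equiv> block_len p a b"
abbreviation "w \<equiv> block_weight p a b"
abbreviation "W \<equiv> hub_clique p a b"
abbreviation "idx \<equiv> block_idx p a b"

lemma idx_range: "idx x \<in> {1..4}"
  by (simp add: block_idx_def)

lemma mem_S_idx: "x \<in> {0..1} \<Longrightarrow> x \<in> S (idx x)"
  by (auto simp: block_idx_def block_set_def)

lemma S_subset: "S i \<subseteq> {0..1}"
  using p ab by (auto simp: block_set_def)

lemma idx_eq: "i \<in> {1..4} \<Longrightarrow> x \<in> S i \<Longrightarrow> idx x = i"
  using ab unfolding nat_1_to_4 by (elim disjE) (auto simp: block_idx_def block_set_def)

lemma S_borel: "S i \<in> sets borel"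
  by (auto simp: block_set_def)

lemma measure_S: "i \<in> {1..4} \<Longrightarrow> measure lborel (S i) = m i"
  using p ab unfolding nat_1_to_4 by (elim disjE) (auto simp: block_set_def block_len_def)

lemma m_pos: "0 < m i"
  using p ab by (auto simp: block_len_def)

lemma m_le_1: "m i \<le> 1"
  using p ab by (auto simp: block_len_def)

text \<open>Only the weight of block 4 with itself takes work: its increment has numerator at most
  \<open>3 * p * p\<close>, and \<open>p < 1/4\<close> makes this at most the square of
  \<open>1 - p\<close>.\<close>

lemma w_bounds: "0 \<le> w i j \<and> w i j \<le> 1"
proof -
  have "0 \<le> 2 * p * a - a\<^sup>2" using ab by (simp add: power2_eq_square)
  then have n: "0 \<le> 2 * p * a - a\<^sup>2 + b\<^sup>2" using zero_le_power2[of b] by linarith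
  have "a * p \<le> p * p" "b * b \<le> p * p" using ab by (auto intro!: mult_mono)
  moreover have "2 * p * a = 2 * (a * p)" "b\<^sup>2 = b * b" by (simp_all add: power2_eq_square)
  ultimately have "2 * p * a - a\<^sup>2 + b\<^sup>2 \<le> 3 * (p * p)" using zero_le_power2[of a] by linarith
  also have "\<dots> \<le> (1 - p) * (1 - p)"
  proof -
    have "p * p \<le> 1/4 * (1/4)" using p p_bounds by (intro mult_mono) auto
    moreover have "3/4 * (3/4) \<le> (1 - p) * (1 - p)" using p p_bounds by (intro mult_mono) auto
    ultimately show ?thesis by linarith
  qed
  finally have "(2 * p * a - a\<^sup>2 + b\<^sup>2) / (1 - p) \<le> 1 - p" using p_bounds by (simp add: divide_le_eq)
  moreover have "0 \<le> (2 * p * a - a\<^sup>2 + b\<^sup>2) / (1 - p)" using n p_bounds by simp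
  ultimately show ?thesis using p ab unfolding block_weight_def by auto
qed

lemma measure_unit_S: "measure unit_measure (S i) = measure lborel (S i)"
  using S_subset by (intro measure_restrict_space) auto

lemma sets_unit_S: "S i \<in> sets unit_measure"
  using S_subset[of i] S_borel[of i] by (auto simp: sets_restrict_space image_iff intro!: bexI[of _ "S i"])

lemma idx_measurable: "idx \<in> measurable unit_measure (count_space UNIV)"
proof -
  have "idx \<in> measurable borel (count_space UNIV)" unfolding block_idx_def[abs_def] by measurable
  then have "idx \<in> measurable lborel (count_space UNIV)" by simp
  then show ?thesis by (rule measurable_restrict_space1)
qed

lemma integral_idx: "(\<integral>x. f (idx x) \<partial>unit_measure) = (\<Sum>i\<in>{1..4}. m i * f i)" for f :: "nat \<Rightarrow> real"
proof -
  interpret prob_space unit_measure by (rule prob_space_unit)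
  have "(\<integral>x. f (idx x) \<partial>unit_measure) = (\<integral>x. (\<Sum>i\<in>{1..4}. f i * indicat_real (S i) x) \<partial>unit_measure)"
  proof (rule Bochner_Integration.integral_cong[OF refl])
    fix x assume "x \<in> space unit_measure"
    then have x: "x \<in> S (idx x)" using mem_S_idx by (simp add: space_unit)
    have "(\<Sum>i\<in>{1..4}. f i * indicat_real (S i) x) = (\<Sum>i\<in>{1..4}. if i = idx x then f i else 0)"
    proof (rule sum.cong[OF refl])
      fix i :: nat assume i: "i \<in> {1..4}"
      show "f i * indicat_real (S i) x = (if i = idx x then f i else 0)"
      proof (cases "i = idx x")
        case False
        then have "x \<notin> S i" using idx_eq[OF i, of x] by blast
        then show ?thesis using False by simp
      qed (use x in simp)
    qed
    also have "\<dots> = f (idx x)" using idx_range[of x] by (subst sum.delta) auto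
    finally show "f (idx x) = (\<Sum>i\<in>{1..4}. f i * indicat_real (S i) x)" by simp
  qed
  also have "\<dots> = (\<Sum>i\<in>{1..4}. \<integral>x. f i * indicat_real (S i) x \<partial>unit_measure)"
    using sets_unit_S by (intro Bochner_Integration.integral_sum integrable_mult_right integrable_real_indicator) (auto simp: emeasure_finite less_top[symmetric])
  also have "\<dots> = (\<Sum>i\<in>{1..4}. m i * f i)"
  proof (rule sum.cong[OF refl])
    fix i :: nat assume "i \<in> {1..4}"
    then have "measure unit_measure (S i) = m i" by (simp only: measure_unit_S measure_S)
    then show "(\<integral>x. f i * indicat_real (S i) x \<partial>unit_measure) = m i * f i"
      using sets_unit_S[of i] by (simp add: space_unit Int_absorb2[OF S_subset])
  qed
  finally show ?thesis .
qed

lemma graphon_W: "graphon W"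
  unfolding graphon_def
proof (intro conjI ballI)
  note idx_measurable[measurable]
  show "(\<lambda>(x, y). W x y) \<in> borel_measurable (unit_measure \<Otimes>\<^sub>M unit_measure)"
    unfolding hub_clique_def block_weight_def split_beta' by measurable
qed (use w_bounds block_weight_sym in \<open>auto simp: hub_clique_def\<close>)

lemma sum_m_w: "i \<in> {1..4} \<Longrightarrow> (\<Sum>j\<in>{1..4}. m j * w i j) = p"
proof -
  have *: "(1 - p) * (p + (2 * p * a - a\<^sup>2 + b\<^sup>2) / (1 - p)) = (1 - p) * p + (2 * p * a - a\<^sup>2 + b\<^sup>2)"
    using p_bounds by (subst distrib_left) simp
  assume "i \<in> {1..4}"
  then show ?thesis
    unfolding sum_1_to_4 nat_1_to_4
    by (elim disjE) (simp_all add: block_len_def block_weight_def *, simp_all add: algebra_simps power2_eq_square)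
qed

lemma p_regular_W: "p_regular p W"
  unfolding p_regular_def hub_clique_def using integral_idx sum_m_w idx_range by simp

lemma is_interval_S: "is_interval (S i)"
  by (simp add: block_set_def is_interval_io is_interval_cc is_interval_co)

lemma block_graphon_W: "block_graphon 4 S w W"
  unfolding block_graphon_def
proof (intro conjI ballI graphon_W is_interval_S)
  show "disjoint_family_on S {1..4}"
    unfolding disjoint_family_on_def
  proof (intro ballI impI)
    fix i j assume ij: "i \<in> {1..4::nat}" "j \<in> {1..4::nat}" "i \<noteq> j"
    show "S i \<inter> S j = {}" using idx_eq[OF ij(1)] idx_eq[OF ij(2)] ij(3) by blast
  qed
  show "(\<Union>i\<in>{1..4}. S i) = {0..1}"
    using S_subset mem_S_idx idx_range by blast
  show "W x y = w i j" if "i \<in> {1..4}" "j \<in> {1..4}" "x \<in> S i" "y \<in> S j" for i j x y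
    using idx_eq[OF that(1,3)] idx_eq[OF that(2,4)] by (simp add: hub_clique_def)
qed

lemma graphon_entropy_W:
  "graphon_entropy p W = (\<Sum>i\<in>{1..4}. m i * (\<Sum>j\<in>{1..4}. m j * entropy p (w i j)))"
proof -
  have "graphon_entropy p W = (\<integral>x. \<integral>y. entropy p (W x y) \<partial>unit_measure \<partial>unit_measure)"
  proof -
    have sf: "pair_sigma_finite unit_measure unit_measure"
      unfolding pair_sigma_finite_def using prob_space_imp_sigma_finite[OF prob_space_unit] by blast
    show ?thesis
      unfolding graphon_entropy_def
      using pair_sigma_finite.integral_fst'[OF sf entropy_integral(4)[OF graphon_W p_bounds]] by simp
  qed
  also have "\<dots> = (\<integral>x. (\<Sum>j\<in>{1..4}. m j * entropy p (w (idx x) j)) \<partial>unit_measure)"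
    unfolding hub_clique_def using integral_idx[of "\<lambda>j. entropy p (w _ j)"] by simp
  also have "\<dots> = (\<Sum>i\<in>{1..4}. m i * (\<Sum>j\<in>{1..4}. m j * entropy p (w i j)))"
    by (rule integral_idx)
  finally show ?thesis .
qed

lemma edge_value_on_box:
  assumes K: "simple_graph K" "e \<in> K" and B: "B \<in> verts K \<rightarrow> {1..4}"
    and x: "\<And>v. v \<in> verts K \<Longrightarrow> x v \<in> S (B v)"
  shows "edge_value W x e = edge_weight w B e"
proof -
  obtain u v where e: "e = {u, v}" "u \<in> verts K" "v \<in> verts K" using simple_graph_edgeE[OF K] by metis
  have "idx (x u) = B u" "idx (x v) = B v"
    using idx_eq[OF funcset_mem[OF B e(2)] x[OF e(2)]] idx_eq[OF funcset_mem[OF B e(3)] x[OF e(3)]] by auto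
  then have "W (x u) (x v) = w (B u) (B v)" "W (x v) (x u) = w (B v) (B u)" by (simp_all add: hub_clique_def)
  then show ?thesis
    unfolding e(1) using edge_value_doubleton[of W x u v] edge_weight_doubleton[of w B u v] block_weight_sym[of p a b "B u" "B v"]
    by simp
qed

lemma measure_box:
  assumes K: "simple_graph K" and B: "B \<in> verts K \<rightarrow> {1..4}"
  shows "measure (Pi\<^sub>M (verts K) (\<lambda>_. unit_measure)) (Pi\<^sub>E (verts K) (\<lambda>v. S (B v))) = (\<Prod>v\<in>verts K. m (B v))"
    and "Pi\<^sub>E (verts K) (\<lambda>v. S (B v)) \<in> sets (Pi\<^sub>M (verts K) (\<lambda>_. unit_measure))"
proof -
  interpret U: prob_space unit_measure by (rule prob_space_unit)
  interpret finite_product_prob_space "\<lambda>_. unit_measure" "verts K"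
    by unfold_locales (rule finite_verts[OF K])
  have "measure (Pi\<^sub>M (verts K) (\<lambda>_. unit_measure)) (Pi\<^sub>E (verts K) (\<lambda>v. S (B v))) =
      (\<Prod>v\<in>verts K. measure unit_measure (S (B v)))"
    using sets_unit_S by (intro prob_times) auto
  also have "\<dots> = (\<Prod>v\<in>verts K. m (B v))"
    using B by (intro prod.cong) (auto simp only: measure_unit_S measure_S Pi_iff)
  finally show "measure (Pi\<^sub>M (verts K) (\<lambda>_. unit_measure)) (Pi\<^sub>E (verts K) (\<lambda>v. S (B v))) = (\<Prod>v\<in>verts K. m (B v))" .
  show "Pi\<^sub>E (verts K) (\<lambda>v. S (B v)) \<in> sets (Pi\<^sub>M (verts K) (\<lambda>_. unit_measure))"
    using sets_unit_S by (intro sets_PiM_I_finite finite_verts[OF K]) auto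
qed

lemma Hom_block_W:
  assumes K: "simple_graph K" and B: "B \<in> verts K \<rightarrow> {1..4}"
  shows "Hom_block K W S B = (\<Prod>v\<in>verts K. m (B v)) * (\<Prod>e\<in>K. edge_weight w B e)"
proof -
  let ?P = "Pi\<^sub>M (verts K) (\<lambda>_. unit_measure)" and ?X = "Pi\<^sub>E (verts K) (\<lambda>v. S (B v))"
  interpret P: prob_space ?P by (rule prob_space_PiM) (rule prob_space_unit)
  have "Hom_block K W S B = (\<integral>x. (\<Prod>e\<in>K. edge_weight w B e) * indicat_real ?X x \<partial>?P)"
    unfolding Hom_block_def set_lebesgue_integral_def
  proof (rule Bochner_Integration.integral_cong[OF refl])
    fix x
    show "indicat_real ?X x *\<^sub>R (\<Prod>e\<in>K. edge_value W x e) = (\<Prod>e\<in>K. edge_weight w B e) * indicat_real ?X x"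
    proof (cases "x \<in> ?X")
      case True
      then have "edge_value W x e = edge_weight w B e" if "e \<in> K" for e
        by (intro edge_value_on_box[OF K that B]) auto
      then show ?thesis by simp
    qed simp
  qed
  also have "\<dots> = (\<Prod>e\<in>K. edge_weight w B e) * measure ?P ?X"
    using measure_box(2)[OF K B] by simp
  finally show ?thesis using measure_box(1)[OF K B] by simp
qed

lemma edge_weight_bounds:
  assumes "simple_graph K" "e \<in> K" shows "0 \<le> edge_weight w B e \<and> edge_weight w B e \<le> 1"
proof -
  obtain u v where e: "e = {u, v}" using simple_graph_edgeE[OF assms] by metis
  have "edge_weight w B e = w (B u) (B v)" unfolding e by (rule edge_weight_doubleton[OF block_weight_sym])
  then show ?thesis using w_bounds by simp
qed

text \<open>The boxes of different extensional block maps are disjoint, since a point determines the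
  block of each of its coordinates, and the integrand is nonnegative. Extensionality makes different
  maps differ at a vertex of \<open>K\<close>.\<close>

lemma sum_Hom_block_le:
  assumes K: "simple_graph K" and \<B>: "finite \<B>" "\<B> \<subseteq> verts K \<rightarrow>\<^sub>E {1..4}"
  shows "(\<Sum>B\<in>\<B>. Hom_block K W S B) \<le> Hom K W"
proof -
  let ?P = "Pi\<^sub>M (verts K) (\<lambda>_. unit_measure)" and ?X = "\<lambda>B. Pi\<^sub>E (verts K) (\<lambda>v. S (B v))"
  let ?f = "\<lambda>x. \<Prod>e\<in>K. edge_value W x e"
  interpret P: prob_space ?P by (rule prob_space_PiM) (rule prob_space_unit)
  note gD = graphonD[OF graphon_W]
  have ev: "0 \<le> edge_value W x e \<and> edge_value W x e \<le> 1" if "x \<in> space ?P" "e \<in> K" for x e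
    by (rule edge_value_bounds[where W = W and P = "\<lambda>r. 0 \<le> r \<and> r \<le> 1", OF K that(2) order_refl gD(2) gD(3) that(1)])
  have f: "0 \<le> ?f x \<and> ?f x \<le> 1" if "x \<in> space ?P" for x
    using ev[OF that] by (auto intro!: prod_nonneg prod_le_1)
  have fm: "?f \<in> borel_measurable ?P"
    by (intro borel_measurable_prod measurable_edge_value[where W = W, OF K _ order_refl gD(2) gD(1)])
  have fint: "integrable ?P ?f"
    using f fm by (intro P.integrable_const_bound[of _ 1] AE_I2) auto
  have \<B>': "B \<in> verts K \<rightarrow> {1..4}" if "B \<in> \<B>" for B using \<B>(2) that by blast
  have int: "integrable ?P (\<lambda>x. indicat_real (?X B) x *\<^sub>R ?f x)" if "B \<in> \<B>" for B
    using integrable_mult_indicator[OF measure_box(2)[OF K \<B>'[OF that]] fint] .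
  have "(\<Sum>B\<in>\<B>. Hom_block K W S B) = (\<integral>x. (\<Sum>B\<in>\<B>. indicat_real (?X B) x *\<^sub>R ?f x) \<partial>?P)"
    unfolding Hom_block_def set_lebesgue_integral_def
    by (rule Bochner_Integration.integral_sum[symmetric, OF int])
  also have "\<dots> \<le> (\<integral>x. ?f x \<partial>?P)"
  proof (rule integral_mono)
    show "integrable ?P (\<lambda>x. \<Sum>B\<in>\<B>. indicat_real (?X B) x *\<^sub>R ?f x)"
      using int by (rule Bochner_Integration.integrable_sum)
    show "integrable ?P ?f" by (rule fint)
    fix x assume x: "x \<in> space ?P"
    define B0 where "B0 = restrict (\<lambda>v. idx (x v)) (verts K)"
    have only: "B = B0" if "B \<in> \<B>" "x \<in> ?X B" for B
    proof (rule ext)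
      fix v
      show "B v = B0 v"
      proof (cases "v \<in> verts K")
        case True
        have "B v \<in> {1..4}" "x v \<in> S (B v)" using \<B>'[OF that(1)] that(2) True by blast+
        then show ?thesis using idx_eq True by (simp add: B0_def)
      next
        case False
        have "B \<in> extensional (verts K)" using \<B>(2) that(1) by (auto simp: PiE_def)
        then show ?thesis using False by (simp add: B0_def extensional_def)
      qed
    qed
    have "(\<Sum>B\<in>\<B>. indicat_real (?X B) x *\<^sub>R ?f x) \<le> (\<Sum>B\<in>\<B>. if B = B0 then ?f x else 0)"
    proof (rule sum_mono)
      fix B assume "B \<in> \<B>"
      then show "indicat_real (?X B) x *\<^sub>R ?f x \<le> (if B = B0 then ?f x else 0)"
        using only[of B] f[OF x] by (cases "x \<in> ?X B") simp_all
    qed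
    also have "\<dots> \<le> ?f x" using f[OF x] \<B>(1) by (simp add: sum.delta)
    finally show "(\<Sum>B\<in>\<B>. indicat_real (?X B) x *\<^sub>R ?f x) \<le> ?f x" .
  qed
  finally show ?thesis by (simp add: Hom_def)
qed

end

text \<open>The block map of a pair \<open>(H, A)\<close> with half-integral cover \<open>c\<close> sends level 1 to the hub, level
  1/2 to the clique, and to block 3 every further vertex of \<open>H\<close> or neighbour of the hub. Each
  neighbour outside \<open>H\<close> costs a factor \<open>p\<close> and saves one.\<close>

definition cover_map :: "'a set set \<Rightarrow> 'a set set \<Rightarrow> ('a \<Rightarrow> real) \<Rightarrow> 'a set \<Rightarrow> 'a \<Rightarrow> nat" where
  "cover_map K H c A = restrict (\<lambda>v. if v \<in> A then 1 else if v \<in> verts H \<and> c v = 1/2 then 2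
     else if v \<in> verts H \<or> (\<exists>u\<in>A. {u, v} \<in> K) then 3 else 4) (verts K)"

text \<open>The cover value encoded by a block. For the lengths in use, blocks 1 to 3 have length at
  most a constant times \<open>p powr (1 + gamma K * block_level B v)\<close>, which turns products
  of lengths into weights of covers.\<close>

definition block_level :: "('a \<Rightarrow> nat) \<Rightarrow> 'a \<Rightarrow> real" where
  "block_level B v = (if B v = 1 then 1 else if B v = 2 then 1/2 else 0)"

context hub_clique_params
begin

lemma edge_weight_W: "edge_weight w B {u, v} = w (B u) (B v)"
  by (rule edge_weight_doubleton[of w B u v, OF block_weight_sym])

lemma w44_bounds: "p \<le> w 4 4" "w 4 4 \<le> 2 * p"
proof -
  have 1: "a * p \<le> p * p" "b * b \<le> p * p" "p * p \<le> 1/4 * p" using ab p p_bounds by (auto intro!: mult_mono)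
  have 2: "2 * p * a = 2 * (a * p)" "b\<^sup>2 = b * b" by (simp_all add: power2_eq_square)
  have "a * a \<le> a * p" using ab by (intro mult_left_mono) auto
  moreover have "0 \<le> a * p" using ab p_bounds by simp
  ultimately have "a\<^sup>2 \<le> 2 * p * a" unfolding 2(1) power2_eq_square by linarith
  then have "0 \<le> (2 * p * a - a\<^sup>2 + b\<^sup>2) / (1 - p)" using p_bounds by simp
  then show "p \<le> w 4 4" by (simp add: block_weight_def)
  have "2 * p * a - a\<^sup>2 + b\<^sup>2 \<le> 3/4 * p" using 1 2 zero_le_power2[of a] by linarith
  also have "\<dots> \<le> p * (1 - p)" using p p_bounds mult_left_mono[of "3/4" "1 - p" p] by simp
  finally have "(2 * p * a - a\<^sup>2 + b\<^sup>2) / (1 - p) \<le> p" using p_bounds by (simp add: divide_le_eq)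
  then show "w 4 4 \<le> 2 * p" by (simp add: block_weight_def)
qed

lemma cover_map_eq:
  assumes "v \<in> verts K"
  shows "cover_map K H c A v = 1 \<longleftrightarrow> v \<in> A"
    and "cover_map K H c A v = 2 \<longleftrightarrow> v \<notin> A \<and> v \<in> verts H \<and> c v = 1/2"
  using assms by (simp_all add: cover_map_def del: Union_iff)

text \<open>The vertices split into \<open>A\<close>, the clique part \<open>Q\<close>, the rest
  \<open>Z\<close> of \<open>H\<close>, the neighbours \<open>N\<close> of the hub outside
  \<open>H\<close>, and the others \<open>R\<close>. The edges of weight 1 include \<open>H\<close>
  and one more for each vertex of \<open>N\<close>, which pays for the length of its block. What is
  left has exponent \<open>card K\<close> because \<open>H\<close> is contributing.\<close>

lemma Hom_block_cover_map_ge: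
  fixes z y \<gamma> \<epsilon> :: real
  assumes K: "simple_graph K" and H: "contributing K H" and A: "A \<subseteq> verts H"
    and c: "minimum_cover H c" and c1: "\<And>v. v \<in> A \<Longrightarrow> c v = 1"
    and c0: "\<And>v. v \<in> verts H - A \<Longrightarrow> c v \<in> {0, 1/2}"
    and zy: "0 < z" "0 < y" and a_eq: "a = z * p powr (1 + gamma K)" and b_eq: "b = sqrt y * p powr (1 + gamma K / 2)"
    and eps: "a + b = \<epsilon> * p" "\<epsilon> \<le> 1"
  shows "P_term H z y A * (p ^ card K * (1 - \<epsilon>) ^ (card (verts K) + card K) * (1 - p) ^ card (verts K))
    \<le> Hom_block K W S (cover_map K H c A)"
proof -
  let ?B = "cover_map K H c A" and ?V = "verts K" and ?g = "gamma K"
  have HK: "H \<subseteq> K" using H by (simp add: contributing_def)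
  have VHK: "verts H \<subseteq> ?V" using HK by auto
  note sgH = simple_graph_subset[OF K HK]
  have finK: "finite K" and finV: "finite ?V" and finH: "finite H" and finVH: "finite (verts H)"
    using K finite_verts[OF K] sgH finite_verts[OF sgH] by (simp_all add: simple_graph_def)
  have AV: "A \<subseteq> ?V" using A VHK by (rule subset_trans)
  have fc: "fractional_cover H c" using c by (simp add: minimum_cover_def)
  have vals: "c v \<in> {0, 1/2, 1}" if "v \<in> verts H" for v using c1 c0 that by blast
  have Brange: "?B \<in> ?V \<rightarrow> {1..4}" by (auto simp: cover_map_def)
  define Q where "Q = {v \<in> verts H. c v = 1/2}"
  define Z where "Z = verts H - A - Q"
  define N where "N = {v \<in> ?V - verts H. \<exists>u\<in>A. {u, v} \<in> K}"
  define R where "R = ?V - verts H - N"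
  have QA: "Q \<inter> A = {}" using c1 by (auto simp: Q_def)
  have QV: "Q \<subseteq> verts H" by (auto simp: Q_def)
  have parts: "?V = A \<union> (Q \<union> (Z \<union> (N \<union> R)))" using A VHK QV by (auto simp: Z_def N_def R_def)
  have fins: "finite A" "finite Q" "finite Z" "finite N" "finite R"
  proof -
    show "finite A" "finite Q" by (rule finite_subset[OF A finVH], rule finite_subset[OF QV finVH])
    show "finite Z" unfolding Z_def using finVH by blast
    show "finite N" unfolding N_def by (rule finite_subset[OF _ finV]) blast
    show "finite R" unfolding R_def using finV by blast
  qed
  have VHparts: "verts H = A \<union> (Q \<union> Z)" using A QV by (auto simp: Z_def)
  have B1: "?B v = 1" if "v \<in> A" for v using that AV by (auto simp: cover_map_def)
  have B2: "?B v = 2" if "v \<in> Q" for v using that QA VHK by (auto simp: cover_map_def Q_def)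
  have B3: "?B v = 3" if "v \<in> Z" for v using that VHK by (auto simp: cover_map_def Z_def Q_def)
  have B3': "?B v = 3" if "v \<in> N" for v using that A by (auto simp: cover_map_def N_def)
  have B4: "?B v = 4" if "v \<in> R" for v using that A by (auto simp: cover_map_def N_def R_def)
  have Bcases: "v \<in> A \<or> v \<in> Q \<or> v \<in> Z \<or> v \<in> N \<or> v \<in> R" if "v \<in> ?V" for v using that parts by blast
  have BA: "v \<in> A" if "v \<in> ?V" "?B v = 1" for v
    using Bcases[OF that(1)] B2[of v] B3[of v] B3'[of v] B4[of v] that(2) by auto
  have m3: "m 3 = p * (1 - \<epsilon>)" using eps by (simp add: block_len_def algebra_simps)
  let ?q = "p * (1 - \<epsilon>)"
  have q: "0 < ?q" "?q \<le> 1" using m_pos[of 3] m_le_1[of 3] m3 by auto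
  have eps0: "0 \<le> 1 - \<epsilon>" using eps by simp
  have prodV: "(\<Prod>v\<in>?V. m (?B v)) = a ^ card A * (b ^ card Q * (?q ^ card Z * (?q ^ card N * (1 - p) ^ card R)))"
  proof -
    have dj: "A \<inter> (Q \<union> (Z \<union> (N \<union> R))) = {}" "Q \<inter> (Z \<union> (N \<union> R)) = {}" "Z \<inter> (N \<union> R) = {}" "N \<inter> R = {}"
      using A QA QV by (auto simp: Z_def N_def R_def)
    have mm: "m 1 = a" "m 2 = b" "m 4 = 1 - p" by (simp_all add: block_len_def)
    have *: "(\<Prod>v\<in>X. m (?B v)) = t ^ card X" if "\<And>v. v \<in> X \<Longrightarrow> ?B v = i" "m i = t" for X i t
    proof -
      have "(\<Prod>v\<in>X. m (?B v)) = (\<Prod>v\<in>X. t)" using that by (intro prod.cong) simp_all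
      then show ?thesis by simp
    qed
    have "(\<Prod>v\<in>?V. m (?B v)) = (\<Prod>v\<in>A. m (?B v)) * ((\<Prod>v\<in>Q. m (?B v)) *
        ((\<Prod>v\<in>Z. m (?B v)) * ((\<Prod>v\<in>N. m (?B v)) * (\<Prod>v\<in>R. m (?B v)))))"
      unfolding parts using fins dj by (simp only: prod.union_disjoint finite_Un)
    moreover have "(\<Prod>v\<in>A. m (?B v)) = a ^ card A" by (rule *[OF _ mm(1)]) (rule B1)
    moreover have "(\<Prod>v\<in>Q. m (?B v)) = b ^ card Q" by (rule *[OF _ mm(2)]) (rule B2)
    moreover have "(\<Prod>v\<in>Z. m (?B v)) = ?q ^ card Z" by (rule *[OF _ m3]) (rule B3)
    moreover have "(\<Prod>v\<in>N. m (?B v)) = ?q ^ card N" by (rule *[OF _ m3]) (rule B3')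
    moreover have "(\<Prod>v\<in>R. m (?B v)) = (1 - p) ^ card R" by (rule *[OF _ mm(3)]) (rule B4)
    ultimately show ?thesis by (simp only:)
  qed
  \<comment> \<open>Edges that meet the hub or lie in the clique. Weight 1 in the first case relies
    on \<open>cover_map\<close> sending no neighbour of the hub to block 4.\<close>
  define E where "E = {e \<in> K. \<exists>u v. e = {u, v} \<and> (?B u = 1 \<or> ?B u = 2 \<and> ?B v = 2)}"
  have EK: "E \<subseteq> K" by (auto simp: E_def)
  have HE: "H \<subseteq> E"
  proof
    fix e assume e: "e \<in> H"
    obtain u v where uv: "e = {u, v}" "u \<in> verts H" "v \<in> verts H" using simple_graph_edgeE[OF sgH e] by metis
    have one: "x \<in> A" if "x \<in> verts H" "c x = 1" for x
    proof (rule ccontr)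
      assume "x \<notin> A"
      then have "c x \<in> {0, 1/2}" using c0 that by blast
      then show False using that(2) by simp
    qed
    consider "c u = 1" | "c v = 1" | "c u = 1/2" "c v = 1/2"
      using cover_edge_values[OF fc vals, of u v] e uv by blast
    then show "e \<in> E"
    proof cases
      case 1
      then show ?thesis using one[OF uv(2)] B1 uv(1) e HK unfolding E_def by blast
    next
      case 2
      then have "?B v = 1" "e = {v, u}" using one[OF uv(3)] B1 uv(1) by (auto simp: insert_commute)
      then show ?thesis using e HK unfolding E_def by blast
    next
      case 3
      then have "?B u = 2" "?B v = 2" using B2 uv unfolding Q_def by blast+
      then show ?thesis using uv(1) e HK unfolding E_def by blast
    qed
  qed
  have ewE: "edge_weight w ?B e = 1" if eE: "e \<in> E" for e
  proof -
    obtain u v where uv: "e = {u, v}" "e \<in> K" "?B u = 1 \<or> ?B u = 2 \<and> ?B v = 2" using eE unfolding E_def by blast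
    have uvV: "u \<in> ?V" "v \<in> ?V" using edge_in_verts[of u v K] uv by simp_all
    show ?thesis
    proof (cases "?B u = 1")
      case True
      then have uA: "u \<in> A" using BA uvV by blast
      have "?B v \<noteq> 4" using uA uv uvV by (auto simp: cover_map_def)
      moreover have "?B v \<in> {1..4}" using Brange uvV by blast
      ultimately show ?thesis using True by (simp add: uv(1) edge_weight_W block_weight_def)
    next
      case False
      then show ?thesis using uv(3) by (simp add: uv(1) edge_weight_W block_weight_def)
    qed
  qed
  have ewK: "?q \<le> edge_weight w ?B e" if "e \<in> K - E" for e
  proof -
    have eK: "e \<in> K" using that by simp
    obtain u v where uv: "e = {u, v}" "u \<in> ?V" "v \<in> ?V" using simple_graph_edgeE[OF K eK] by metis
    have "e = {v, u}" using uv by (simp add: insert_commute)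
    then have n: "?B u \<noteq> 1" "?B v \<noteq> 1" "\<not> (?B u = 2 \<and> ?B v = 2)" using that uv(1) unfolding E_def by blast+
    have r: "?B u \<in> {1..4}" "?B v \<in> {1..4}" using Brange uv by blast+
    have qe: "?q = p - a - b" using eps by (simp add: algebra_simps)
    have "p - a - b \<le> w i j" if "i \<in> {1..4}" "j \<in> {1..4}" "i \<noteq> 1" "j \<noteq> 1" "\<not> (i = 2 \<and> j = 2)" for i j
    proof (cases "i = 4 \<and> j = 4")
      case True
      then show ?thesis using w44_bounds(1) ab by simp
    next
      case False
      then show ?thesis using that ab by (auto simp: block_weight_def)
    qed
    from this[OF r n] show ?thesis by (simp add: uv(1) edge_weight_W qe)
  qed
  have prodE: "?q ^ (card K - card E) \<le> (\<Prod>e\<in>K. edge_weight w ?B e)"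
  proof -
    have "?q ^ (card K - card E) = (\<Prod>e\<in>K - E. ?q)" using EK finK by (simp add: card_Diff_subset finite_subset)
    also have "\<dots> \<le> (\<Prod>e\<in>K - E. edge_weight w ?B e)" using ewK q by (intro prod_mono) auto
    also have "\<dots> = (\<Prod>e\<in>K. edge_weight w ?B e)"
      using ewE EK finK by (intro prod.mono_neutral_left) auto
    finally show ?thesis .
  qed
  \<comment> \<open>Each vertex of \<open>N\<close> has a hub edge of its own: the other endpoint
    lies in \<open>A\<close>, so different vertices give different edges, and none of them is in
    \<open>H\<close>.\<close>
  have cardE: "card H + card N \<le> card E"
  proof -
    have "\<exists>u. u \<in> A \<and> {u, v} \<in> K" if "v \<in> N" for v using that by (auto simp: N_def)
    then obtain f where f: "\<And>v. v \<in> N \<Longrightarrow> f v \<in> A \<and> {f v, v} \<in> K" by metis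
    let ?h = "\<lambda>v. {f v, v}"
    have NH: "v \<notin> verts H" if "v \<in> N" for v using that by (simp add: N_def)
    have inj: "inj_on ?h N"
    proof (rule inj_onI)
      fix v v' assume v: "v \<in> N" "v' \<in> N" "?h v = ?h v'"
      have "v \<in> ?h v'" using v(3) by blast
      moreover have "v \<noteq> f v'" using f[OF v(2)] NH[OF v(1)] A by blast
      ultimately show "v = v'" by simp
    qed
    have "?h ` N \<subseteq> E" using f B1 unfolding E_def by blast
    moreover have "?h ` N \<inter> H = {}" using NH by blast
    ultimately have "card (?h ` N \<union> H) \<le> card E"
      using HE finK EK by (intro card_mono) (auto intro: finite_subset)
    then show ?thesis
      using \<open>?h ` N \<inter> H = {}\<close> fins finH card_image[OF inj] by (simp add: card_Un_disjoint)
  qed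
  have cEK: "card E \<le> card K" "card H \<le> card K" using EK HK finK by (auto intro: card_mono)
  have dj: "A \<inter> (Q \<union> Z) = {}" "Q \<inter> Z = {}" using QA by (auto simp: Z_def)
  have cVH: "card (verts H) = card A + (card Q + card Z)"
    unfolding VHparts using fins dj by (simp only: card_Un_disjoint finite_Un)
  have cH: "cover_number H = card A + card Q / 2"
  proof -
    have "cover_number H = (\<Sum>v\<in>verts H. c v)" using c by (simp add: minimum_cover_def)
    also have "\<dots> = (\<Sum>v\<in>A. c v) + ((\<Sum>v\<in>Q. c v) + (\<Sum>v\<in>Z. c v))"
      unfolding VHparts using fins dj by (simp only: sum.union_disjoint finite_Un)
    also have "(\<Sum>v\<in>A. c v) = (\<Sum>v\<in>A. 1)" using c1 by (intro sum.cong) auto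
    also have "(\<Sum>v\<in>Q. c v) = (\<Sum>v\<in>Q. 1/2)" by (intro sum.cong) (auto simp: Q_def)
    also have "(\<Sum>v\<in>Z. c v) = (\<Sum>v\<in>Z. 0)" using c0 by (intro sum.cong) (auto simp: Z_def Q_def)
    finally show ?thesis by simp
  qed
  have ex: "real (card H) - real (card (verts H)) = cover_number H * ?g"
    using H by (simp add: contributing_def excess_def)
  define k where "k = card Z + (card K - card H)"
  \<comment> \<open>The equality required of a contributing subgraph, written as an exponent of
    \<open>p\<close>.\<close>
  have expo: "(1 + ?g) * card A + (1 + ?g / 2) * card Q + k = card K"
    using ex cVH cH cEK unfolding k_def by (simp add: algebra_simps of_nat_diff)
  have k_le: "k \<le> card ?V + card K"
  proof -
    have "card Z \<le> card ?V" using VHK finV by (intro card_mono) (auto simp: Z_def)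
    then show ?thesis by (simp add: k_def)
  qed
  have trm: "P_term H z y A * p ^ card K = a ^ card A * b ^ card Q * p ^ k"
  proof -
    have "a ^ card A = z ^ card A * p powr ((1 + ?g) * card A)"
      unfolding a_eq using p_bounds by (simp only: power_mult_distrib powr_powr powr_realpow[symmetric] powr_gt_zero)
    moreover have "b ^ card Q = sqrt y ^ card Q * p powr ((1 + ?g / 2) * card Q)"
      unfolding b_eq using p_bounds by (simp only: power_mult_distrib powr_powr powr_realpow[symmetric] powr_gt_zero)
    moreover have "sqrt y ^ card Q = rpow y (cover_number H - real (card A))"
    proof (cases "card Q = 0")
      case False
      have "sqrt y ^ card Q = y powr (card Q / 2)"
        using zy by (simp add: powr_half_sqrt[symmetric] powr_realpow[symmetric] powr_powr)
      then show ?thesis using False cH by (simp add: rpow_def)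
    qed (simp add: rpow_def cH)
    moreover have "p ^ k = p powr real k" "p ^ card K = p powr real (card K)" using p_bounds by (simp_all add: powr_realpow)
    moreover have "p powr real (card K) = p powr ((1 + ?g) * card A) * p powr ((1 + ?g / 2) * card Q) * p powr real k"
      unfolding powr_add[symmetric] expo ..
    ultimately show ?thesis by (simp add: P_term_def mult_ac)
  qed
  let ?r = "(1 - \<epsilon>) ^ (card ?V + card K) * (1 - p) ^ card ?V"
  have "P_term H z y A * (p ^ card K * (1 - \<epsilon>) ^ (card ?V + card K) * (1 - p) ^ card ?V) =
      a ^ card A * b ^ card Q * (p ^ k * (1 - \<epsilon>) ^ (card ?V + card K) * (1 - p) ^ card ?V)"
    using trm by (simp add: mult.assoc[symmetric])
  also have "\<dots> \<le> a ^ card A * b ^ card Q * (?q ^ (card Z + card N + (card K - card E)) * (1 - p) ^ card R)"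
  proof (rule mult_left_mono)
    have "(1 - \<epsilon>) ^ (card ?V + card K) \<le> (1 - \<epsilon>) ^ k"
    proof -
      have "0 \<le> \<epsilon> * p" using eps(1) ab by linarith
      then have "0 \<le> \<epsilon>" using p_bounds by (simp add: zero_le_mult_iff)
      then show ?thesis using eps0 k_le by (intro power_decreasing) auto
    qed
    then have "p ^ k * (1 - \<epsilon>) ^ (card ?V + card K) \<le> ?q ^ k"
      using p_bounds by (simp add: power_mult_distrib mult_left_mono)
    also have "\<dots> \<le> ?q ^ (card Z + card N + (card K - card E))"
    proof (rule power_decreasing)
      show "card Z + card N + (card K - card E) \<le> k" using cardE cEK unfolding k_def by linarith
    qed (use q in auto)
    finally have 1: "p ^ k * (1 - \<epsilon>) ^ (card ?V + card K) \<le> ?q ^ (card Z + card N + (card K - card E))" .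
    have "card R \<le> card ?V" using finV by (intro card_mono) (auto simp: R_def)
    then have 2: "(1 - p) ^ card ?V \<le> (1 - p) ^ card R" using p_bounds by (intro power_decreasing) auto
    show "p ^ k * (1 - \<epsilon>) ^ (card ?V + card K) * (1 - p) ^ card ?V
        \<le> ?q ^ (card Z + card N + (card K - card E)) * (1 - p) ^ card R"
      by (rule mult_mono[OF 1 2]) (use q p_bounds in auto)
    show "0 \<le> a ^ card A * b ^ card Q" using ab by simp
  qed
  also have "\<dots> = (\<Prod>v\<in>?V. m (?B v)) * ?q ^ (card K - card E)"
    unfolding prodV by (simp add: power_add mult_ac)
  also have "\<dots> \<le> (\<Prod>v\<in>?V. m (?B v)) * (\<Prod>e\<in>K. edge_weight w ?B e)"
    using prodE m_pos by (intro mult_left_mono prod_nonneg) (auto intro: less_imp_le)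
  also have "\<dots> = Hom_block K W S ?B" by (rule Hom_block_W[OF K Brange, symmetric])
  finally show ?thesis .
qed

text \<open>Summing over all pairs requires distinct block maps: the hub recovers \<open>A\<close>,
  the clique recovers the vertices of value 1/2, and two contributing subgraphs with equal levels
  contain each other.\<close>

lemma Hom_W_ge:
  fixes z y \<epsilon> :: real
  assumes K: "simple_graph K" and g: "0 \<le> gamma K" and zy: "0 < z" "0 < y"
    and a_eq: "a = z * p powr (1 + gamma K)" and b_eq: "b = sqrt y * p powr (1 + gamma K / 2)"
    and eps: "a + b = \<epsilon> * p" "\<epsilon> \<le> 1"
  shows "P_poly K z y * (p ^ card K * (1 - \<epsilon>) ^ (card (verts K) + card K) * (1 - p) ^ card (verts K)) \<le> Hom K W"
proof -
  let ?r = "p ^ card K * (1 - \<epsilon>) ^ (card (verts K) + card K) * (1 - p) ^ card (verts K)"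
  let ?V = "verts K"
  define \<Lambda> where "\<Lambda> = (SIGMA H:{H. contributing K H}. {A. valid H A})"
  define good :: "'a set set \<Rightarrow> 'a set \<Rightarrow> ('a \<Rightarrow> real) \<Rightarrow> bool" where
    "good H A c \<longleftrightarrow> minimum_cover H c \<and> (\<forall>v\<in>A. c v = 1) \<and> (\<forall>v\<in>verts H - A. c v \<in> {0, 1/2})" for H A c
  \<comment> \<open>One cover per pair: a valid \<open>A\<close> may come from several minimum
    covers but counts once in \<open>P_poly\<close>.\<close>
  define cv where "cv H A = (SOME c. good H A c)" for H A
  have cv: "minimum_cover H (cv H A) \<and> (\<forall>v\<in>A. cv H A v = 1) \<and> (\<forall>v\<in>verts H - A. cv H A v \<in> {0, 1/2})"
    if HA: "valid H A" for H A
  proof -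
    have "\<exists>c. good H A c" using HA unfolding valid_def good_def by (rule conjunct2)
    then have "good H A (cv H A)" unfolding cv_def by (rule someI_ex)
    then show ?thesis unfolding good_def .
  qed
  define f where "f = (\<lambda>(H, A). cover_map K H (cv H A) A)"
  have AH: "A \<subseteq> verts H" if "valid H A" for H :: "'a set set" and A using that by (simp add: valid_def)
  have lev: "{v \<in> ?V. cover_map K H (cv H A) A v = 1} = A" 
     "{v \<in> ?V. cover_map K H (cv H A) A v = 2} = {v \<in> verts H. cv H A v = 1/2}"
    if HA: "contributing K H" "valid H A" for H A
  proof -
    have VH: "verts H \<subseteq> ?V" using HA(1) by (auto simp: contributing_def)
    have AV: "A \<subseteq> ?V" using AH[OF HA(2)] VH by (rule subset_trans)
    have "{v \<in> ?V. cover_map K H (cv H A) A v = 1} = {v \<in> ?V. v \<in> A}"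
      by (rule Collect_cong) (simp only: cover_map_eq cong: conj_cong)
    then show "{v \<in> ?V. cover_map K H (cv H A) A v = 1} = A" using AV by blast
    have n: "cv H A v \<noteq> 1/2" if "v \<in> A" for v using cv[OF HA(2)] that by simp
    have "{v \<in> ?V. cover_map K H (cv H A) A v = 2} = {v \<in> ?V. v \<notin> A \<and> v \<in> verts H \<and> cv H A v = 1/2}"
      by (rule Collect_cong) (simp only: cover_map_eq cong: conj_cong)
    then show "{v \<in> ?V. cover_map K H (cv H A) A v = 2} = {v \<in> verts H. cv H A v = 1/2}"
      using VH n by blast
  qed
  have sub: "H' \<subseteq> H" if HA: "contributing K H" "valid H A" and HA': "contributing K H'" "valid H' A"
    and eq: "cover_map K H (cv H A) A = cover_map K H' (cv H' A) A" for H H' A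
  proof -
    note c = cv[OF HA(2)] and c' = cv[OF HA'(2)]
    have h: "{v \<in> verts H'. cv H' A v = 1/2} = {v \<in> verts H. cv H A v = 1/2}"
      using lev(2)[OF HA] lev(2)[OF HA'] eq by simp
    show ?thesis
    proof (rule contributing_subset_of_same_levels[OF K g HA(1) HA'(1)])
      show "minimum_cover H (cv H A)" using c by simp
      show "fractional_cover H' (cv H' A)" using c' by (simp add: minimum_cover_def)
      show "cv H' A v \<in> {0, 1/2, 1}" if "v \<in> verts H'" for v using c' that by blast
      show "v \<in> verts H \<and> cv H A v = 1" if "v \<in> verts H'" "cv H' A v = 1" for v
      proof -
        have "v \<in> A"
        proof (rule ccontr)
          assume "v \<notin> A"
          then have "cv H' A v \<in> {0, 1/2}" using c' that(1) by blast
          then show False using that(2) by simp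
        qed
        then show ?thesis using c AH[OF HA(2)] by blast
      qed
      show "v \<in> verts H \<and> cv H A v = 1/2" if "v \<in> verts H'" "cv H' A v = 1/2" for v
        using h that by blast
    qed
  qed
  have inj: "inj_on f \<Lambda>"
  proof (rule inj_onI)
    fix s s' assume s: "s \<in> \<Lambda>" "s' \<in> \<Lambda>" "f s = f s'"
    obtain H A where HA: "s = (H, A)" "contributing K H" "valid H A" using s(1) by (auto simp: \<Lambda>_def)
    obtain H' A' where HA': "s' = (H', A')" "contributing K H'" "valid H' A'" using s(2) by (auto simp: \<Lambda>_def)
    have eq: "cover_map K H (cv H A) A = cover_map K H' (cv H' A') A'" using s(3) HA(1) HA'(1) by (simp add: f_def)
    have "A = A'" using lev(1)[OF HA(2,3)] lev(1)[OF HA'(2,3)] eq by simp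
    then show "s = s'" using sub[of H A H'] sub[of H' A H] HA HA' eq by auto
  qed
  have fin: "finite \<Lambda>"
    unfolding \<Lambda>_def using finite_contributing[OF K] finite_valid contributing_simple[OF K] by (intro finite_SigmaI) auto
  have "P_poly K z y * ?r = (\<Sum>H | contributing K H. \<Sum>A | valid H A. P_term H z y A * ?r)"
    by (simp add: P_poly_def P_term_def sum_distrib_right)
  also have "\<dots> = (\<Sum>(H, A)\<in>\<Lambda>. P_term H z y A * ?r)"
    unfolding \<Lambda>_def using finite_contributing[OF K] finite_valid contributing_simple[OF K] by (intro sum.Sigma) auto
  also have "\<dots> \<le> (\<Sum>s\<in>\<Lambda>. Hom_block K W S (f s))"
  proof (rule sum_mono)
    fix s assume "s \<in> \<Lambda>"
    then obtain H A where HA: "s = (H, A)" "contributing K H" "valid H A" by (auto simp: \<Lambda>_def)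
    note c = cv[OF HA(3)]
    have "P_term H z y A * ?r \<le> Hom_block K W S (cover_map K H (cv H A) A)"
      using c by (intro Hom_block_cover_map_ge[OF K HA(2) AH[OF HA(3)] _ _ _ zy a_eq b_eq eps]) auto
    then show "(case s of (H, A) \<Rightarrow> P_term H z y A * ?r) \<le> Hom_block K W S (f s)" by (simp add: HA(1) f_def)
  qed
  also have "\<dots> = (\<Sum>B\<in>f ` \<Lambda>. Hom_block K W S B)" using sum.reindex[OF inj, of "Hom_block K W S"] by simp
  also have "\<dots> \<le> Hom K W"
    using fin by (intro sum_Hom_block_le[OF K]) (auto simp: f_def cover_map_def split: if_splits)
  finally show ?thesis .
qed

text \<open>Two further edges at \<open>x\<close>, of weight about \<open>p\<close>, can be added to the edges of weight 1 at the
  price of raising the cover at \<open>x\<close> by \<open>\<Delta>\<close>; the definition of \<open>\<gamma>\<close> then gains \<open>p powr (2 - \<gamma> \<Delta>)\<close>.\<close>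

lemma Hom_block_le_of_adjacent:
  fixes M \<Delta> :: real
  assumes K: "simple_graph K" and g: "0 \<le> gamma K" and B: "B \<in> verts K \<rightarrow> {1..4}"
    and e: "{x, y1} \<in> K" "{x, y2} \<in> K" "y1 \<noteq> y2"
    and Bxy: "B x \<in> {2, 3}" "B y1 \<in> {2, 3}" "B y2 \<in> {2, 3}"
    and n22: "\<not> (B x = 2 \<and> B y1 = 2)" "\<not> (B x = 2 \<and> B y2 = 2)"
    and \<Delta>: "0 \<le> \<Delta>" "1 \<le> block_level B x + \<Delta> + block_level B y1" "1 \<le> block_level B x + \<Delta> + block_level B y2"
    and M: "1 \<le> M" "a \<le> M * p powr (1 + gamma K)" "b \<le> M * p powr (1 + gamma K / 2)"
  shows "Hom_block K W S B \<le> M ^ card (verts K) * 2 ^ card K * p powr (real (card K) + 2 - gamma K * \<Delta>)"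
\<comment> \<open>An edge from the hub to block 4 has weight 0 and makes the density vanish. Without
  such edges no vertex of \<open>F'\<close> lies in block 4, so all lengths over
  \<open>verts F'\<close> are governed by \<open>block_level\<close>.\<close>
proof (cases "\<exists>u v. {u, v} \<in> K \<and> B u = 1 \<and> B v = 4")
  case True
  then obtain u v where uv: "{u, v} \<in> K" "B u = 1" "B v = 4" by blast
  have "edge_weight w B {u, v} = 0" using uv by (simp add: edge_weight_W block_weight_def)
  then have "(\<Prod>e\<in>K. edge_weight w B e) = 0"
    using uv(1) K by (intro prod_zero) (auto simp: simple_graph_def intro!: bexI[of _ "{u, v}"])
  then show ?thesis using M by (simp add: Hom_block_W[OF K B])
next
  case False
  let ?V = "verts K" and ?g = "gamma K"
  have finK: "finite K" and finV: "finite ?V" using K finite_verts[OF K] by (simp_all add: simple_graph_def)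
  \<comment> \<open>The edges of weight 1, as hub edges into block 4 are now excluded.\<close>
  define F where "F = {e \<in> K. \<exists>u v. e = {u, v} \<and> (B u = 1 \<or> B u = 2 \<and> B v = 2)}"
  let ?e1 = "{x, y1}" and ?e2 = "{x, y2}"
  define F' where "F' = insert ?e1 (insert ?e2 F)"
  have FK: "F \<subseteq> K" "F' \<subseteq> K" using e by (auto simp: F_def F'_def)
  have finF: "finite F" using FK finK finite_subset by blast
  have nF: "?e1 \<notin> F" "?e2 \<notin> F" "?e1 \<noteq> ?e2"
    using Bxy n22 e(3) by (auto simp: F_def doubleton_eq_iff)
  have cF': "card F' = card F + 2" unfolding F'_def using nF finF by simp
  have cFK: "card F \<le> card K" using FK finK by (intro card_mono)
  have VF: "verts F' \<subseteq> ?V" using FK(2) by auto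
  have finVF: "finite (verts F')" using VF finV finite_subset by blast
  have not4: "B v \<noteq> 4" if vF: "v \<in> verts F'" for v
  proof -
    obtain e where e': "e \<in> F'" "v \<in> e" using vF by blast
    show ?thesis
    proof (cases "e \<in> F")
      case True
      then obtain s t where st: "e = {s, t}" "e \<in> K" "B s = 1 \<or> B s = 2 \<and> B t = 2" unfolding F_def by blast
      then show ?thesis using e'(2) False by auto
    next
      case False
      then have "e = ?e1 \<or> e = ?e2" using e'(1) by (simp add: F'_def)
      then show ?thesis using e'(2) Bxy by auto
    qed
  qed
  have lev0: "0 \<le> block_level B v" for v by (simp add: block_level_def)
  let ?c = "\<lambda>v. block_level B v + (if v = x then \<Delta> else 0)"
  have "fractional_cover F' ?c"
    unfolding fractional_cover_def
  proof (intro conjI ballI allI impI)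
    show "0 \<le> ?c v" for v using lev0[of v] \<Delta>(1) by simp
    fix s t assume st: "{s, t} \<in> F'"
    have l: "block_level B r \<le> ?c r" for r using \<Delta>(1) by simp
    show "1 \<le> ?c s + ?c t"
    proof (cases "{s, t} \<in> F")
      case True
      then obtain s' t' where "{s, t} = {s', t'}" "B s' = 1 \<or> B s' = 2 \<and> B t' = 2" unfolding F_def by blast
      then have "1 \<le> block_level B s + block_level B t" by (auto simp: doubleton_eq_iff block_level_def)
      then show ?thesis using l[of s] l[of t] by linarith
    next
      case False
      then have "{s, t} = ?e1 \<or> {s, t} = ?e2" using st by (simp add: F'_def)
      then show ?thesis using \<Delta> l[of y1] l[of y2] by (auto simp: doubleton_eq_iff add_ac)
    qed
  qed
  then have "cover_number F' \<le> (\<Sum>v\<in>verts F'. ?c v)" by (rule cover_number_le)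
  also have "\<dots> = (\<Sum>v\<in>verts F'. block_level B v) + \<Delta>"
  proof -
    have "x \<in> verts F'" by (simp add: F'_def)
    then show ?thesis using finVF by (simp add: sum.distrib del: Union_iff)
  qed
  finally have "?g * cover_number F' \<le> ?g * ((\<Sum>v\<in>verts F'. block_level B v) + \<Delta>)" using g by (rule mult_left_mono)
  \<comment> \<open>The levels, raised by \<open>\<Delta>\<close> at \<open>x\<close>, cover
    \<open>F'\<close>. Hence the lengths over \<open>verts F'\<close> multiply to at most a constant
    times \<open>p\<close> to the power \<open>card F + 2 - gamma K * \<Delta>\<close>.\<close>
  then have ex: "real (card F') - real (card (verts F')) \<le> ?g * (\<Sum>v\<in>verts F'. block_level B v) + ?g * \<Delta>"
    using excess_le_gamma[OF K FK(2)] by (simp add: excess_def distrib_left)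
  have "(\<Prod>v\<in>?V. m (B v)) = (\<Prod>v\<in>verts F'. m (B v)) * (\<Prod>v\<in>?V - verts F'. m (B v))"
    using prod.subset_diff[OF VF finV, of "\<lambda>v. m (B v)"] by (simp add: mult.commute)
  also have "\<dots> \<le> (\<Prod>v\<in>verts F'. m (B v)) * 1"
    using m_pos m_le_1 by (intro mult_left_mono prod_le_1 prod_nonneg) (auto intro: less_imp_le)
  also have "\<dots> \<le> (\<Prod>v\<in>verts F'. M * p powr (1 + ?g * block_level B v))"
    unfolding mult_1_right
  proof (rule prod_mono)
    fix v assume v: "v \<in> verts F'"
    have "B v \<in> {1..4}" using B VF v by blast
    then consider "B v = 1" | "B v = 2" | "B v = 3" using not4[OF v] unfolding nat_1_to_4 by blast
    then have "m (B v) \<le> M * p powr (1 + ?g * block_level B v)"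
    proof cases
      case 1 then show ?thesis using M by (simp add: block_len_def block_level_def)
    next
      case 2 then show ?thesis using M by (simp add: block_len_def block_level_def)
    next
      case 3
      have "p - a - b \<le> 1 * p" using ab by simp
      also have "\<dots> \<le> M * p" using M p_bounds by (intro mult_right_mono) auto
      finally show ?thesis using 3 p_bounds by (simp add: block_len_def block_level_def)
    qed
    then show "0 \<le> m (B v) \<and> m (B v) \<le> M * p powr (1 + ?g * block_level B v)" using m_pos[of "B v"] by simp
  qed
  also have "\<dots> = M ^ card (verts F') * p powr (\<Sum>v\<in>verts F'. 1 + ?g * block_level B v)"
    using p_bounds finVF by (simp add: prod.distrib powr_sum)
  also have "\<dots> \<le> M ^ card ?V * p powr (real (card F) + 2 - ?g * \<Delta>)"
  proof (intro mult_mono)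
    show "M ^ card (verts F') \<le> M ^ card ?V"
      using M VF finV by (intro power_increasing card_mono) auto
    have "(\<Sum>v\<in>verts F'. 1 + ?g * block_level B v) = real (card (verts F')) + ?g * (\<Sum>v\<in>verts F'. block_level B v)"
      by (simp add: sum.distrib sum_distrib_left)
    then show "p powr (\<Sum>v\<in>verts F'. 1 + ?g * block_level B v) \<le> p powr (real (card F) + 2 - ?g * \<Delta>)"
      using ex cF' p_bounds by (intro powr_mono') auto
  qed (use M in auto)
  finally have V: "(\<Prod>v\<in>?V. m (B v)) \<le> M ^ card ?V * p powr (real (card F) + 2 - ?g * \<Delta>)" .
  have "(\<Prod>e\<in>K. edge_weight w B e) = (\<Prod>e\<in>K - F. edge_weight w B e) * (\<Prod>e\<in>F. edge_weight w B e)"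
    by (rule prod.subset_diff[OF FK(1) finK])
  also have "\<dots> \<le> (\<Prod>e\<in>K - F. 2 * p) * 1"
  proof (intro mult_mono prod_mono prod_le_1)
    fix e assume eKF: "e \<in> K - F"
    then have eK: "e \<in> K" by simp
    obtain u v where uv: "e = {u, v}" "u \<in> ?V" "v \<in> ?V" using simple_graph_edgeE[OF K eK] by metis
    have "e = {v, u}" using uv by (simp add: insert_commute)
    then have n: "B u \<noteq> 1" "B v \<noteq> 1" "\<not> (B u = 2 \<and> B v = 2)" using eKF uv(1) unfolding F_def by blast+
    have "w i j \<le> 2 * p" if "i \<noteq> 1" "j \<noteq> 1" "\<not> (i = 2 \<and> j = 2)" for i j
    proof (cases "i = 4 \<and> j = 4")
      case True
      then show ?thesis using w44_bounds(2) by simp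
    next
      case False
      then show ?thesis using that ab p_bounds by (auto simp: block_weight_def)
    qed
    from this[OF n] show "0 \<le> edge_weight w B e \<and> edge_weight w B e \<le> 2 * p"
      using edge_weight_bounds[OF K eK, of B] by (simp add: uv(1) edge_weight_W)
  next
    fix e assume "e \<in> F"
    then have "e \<in> K" using FK by blast
    then show "0 \<le> edge_weight w B e \<and> edge_weight w B e \<le> 1" by (rule edge_weight_bounds[OF K])
  qed (use p_bounds edge_weight_bounds[OF K] FK in \<open>auto intro!: prod_nonneg\<close>)
  also have "\<dots> = (2 * p) ^ (card K - card F)" using FK finF by (simp add: card_Diff_subset)
  also have "\<dots> \<le> 2 ^ card K * p powr (real (card K) - real (card F))"
  proof -
    have "(2::real) ^ (card K - card F) \<le> 2 ^ card K" by (intro power_increasing) auto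
    moreover have "p ^ (card K - card F) = p powr (real (card K) - real (card F))"
      using p_bounds cFK by (simp add: powr_realpow[symmetric] of_nat_diff)
    ultimately show ?thesis by (simp add: power_mult_distrib mult_right_mono)
  qed
  finally have E: "(\<Prod>e\<in>K. edge_weight w B e) \<le> 2 ^ card K * p powr (real (card K) - real (card F))" .
  have "Hom_block K W S B \<le> (M ^ card ?V * p powr (real (card F) + 2 - ?g * \<Delta>)) * (2 ^ card K * p powr (real (card K) - real (card F)))"
    unfolding Hom_block_W[OF K B] using V E M edge_weight_bounds[OF K]
    by (intro mult_mono prod_nonneg) auto
  also have "\<dots> = M ^ card ?V * 2 ^ card K * (p powr (real (card F) + 2 - ?g * \<Delta>) * p powr (real (card K) - real (card F)))"
    by (simp add: mult_ac)
  also have "p powr (real (card F) + 2 - ?g * \<Delta>) * p powr (real (card K) - real (card F)) = p powr (real (card K) + 2 - ?g * \<Delta>)"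
    unfolding powr_add[symmetric] by (rule arg_cong[of _ _ "\<lambda>s. p powr s"]) simp
  finally show ?thesis .
qed

end

section \<open>Entropy and shifted density of the hub-clique graphon\<close>

lemma entropy_self: "0 < p \<Longrightarrow> p < 1 \<Longrightarrow> entropy p p = 0"
  by (simp add: entropy_def)

lemma entropy_one: "entropy p 1 = ln (1 / p)"
  by (simp add: entropy_def)

context hub_clique_params
begin

text \<open>The coefficient of \<open>ln (1 / p)\<close> is the area where the weight is 1: the two
  hub strips with their overlap counted once, and the clique. The bracket collects the price of
  regularity.\<close>

lemma graphon_entropy_W_eq:
  "graphon_entropy p W = (2 * p * a - a\<^sup>2 + b\<^sup>2) * ln (1 / p) +
    (2 * a * (1 - p) * entropy p 0 + 2 * b * (1 - p) * entropy p (p - a - b) +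
     2 * (p - a - b) * (1 - p) * entropy p (p - a) + (1 - p)\<^sup>2 * entropy p (w 4 4))"
  unfolding graphon_entropy_W sum_1_to_4
  using entropy_self[OF p_bounds]
  by (simp add: block_len_def block_weight_def entropy_one)
    (simp add: algebra_simps power2_eq_square)

text \<open>Every term of the bracket is bounded by the chi-square estimate and has order at most
  \<open>p powr (2 + g)\<close>, without the logarithm that the main term carries.\<close>

lemma entropy_sandwich:
  fixes M g :: real
  assumes g: "0 < g" and M: "1 \<le> M" and a_le: "a \<le> M * p powr (1 + g)" and b_le: "b \<le> M * p powr (1 + g / 2)"
  shows "(2 * p * a - a\<^sup>2 + b\<^sup>2) * ln (1 / p) \<le> graphon_entropy p W"
    and "graphon_entropy p W \<le> (2 * p * a - a\<^sup>2 + b\<^sup>2) * ln (1 / p) + 38 * M ^ 4 * p powr (2 + g)"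
proof -
  have q: "0 < 1 - p" using p_bounds by simp
  have x44: "0 \<le> w 4 4" "w 4 4 \<le> 1" using w_bounds by auto
  have nn: "0 \<le> entropy p 0" "0 \<le> entropy p (p - a - b)" "0 \<le> entropy p (p - a)" "0 \<le> entropy p (w 4 4)"
    using ab p_bounds x44 by (auto intro!: entropy_nonneg)
  have "0 \<le> 2 * a * (1 - p) * entropy p 0" "0 \<le> 2 * b * (1 - p) * entropy p (p - a - b)"
    "0 \<le> 2 * (p - a - b) * (1 - p) * entropy p (p - a)" "0 \<le> (1 - p)\<^sup>2 * entropy p (w 4 4)"
    using nn ab q by simp_all
  then show "(2 * p * a - a\<^sup>2 + b\<^sup>2) * ln (1 / p) \<le> graphon_entropy p W"
    unfolding graphon_entropy_W_eq by linarith
  let ?P = "p powr (2 + g)"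
  have mono: "p powr s \<le> ?P" if "2 + g \<le> s" for s using p_bounds that by (intro powr_mono') auto
  have M4: "1 \<le> M ^ 4" "M \<le> M ^ 4" "M\<^sup>2 \<le> M ^ 4" "M ^ 3 \<le> M ^ 4"
    using M power_increasing[of 1 4 M] power_increasing[of 2 4 M] power_increasing[of 3 4 M] by simp_all
  have pw: "p powr s = p * p powr (s - 1)" for s
    using p_bounds powr_add[of p 1 "s - 1"] by simp
  have chi: "entropy p x \<le> (x - p)\<^sup>2 / (p * (1 - p))" if "0 \<le> x" "x \<le> 1" for x
    using entropy_le_chi_square[OF p_bounds that] .
  have t1: "2 * a * (1 - p) * entropy p 0 \<le> 2 * M ^ 4 * ?P"
  proof -
    have "2 * a * (1 - p) * entropy p 0 \<le> 2 * a * (1 - p) * ((0 - p)\<^sup>2 / (p * (1 - p)))"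
      using ab q by (intro mult_left_mono chi) auto
    also have "\<dots> = 2 * a * p" using p_bounds by (simp add: field_simps power2_eq_square)
    also have "\<dots> \<le> 2 * (M * p powr (1 + g)) * p" using a_le p_bounds by simp
    also have "\<dots> = 2 * M * ?P" using pw[of "2 + g"] by (simp add: add.commute)
    also have "\<dots> \<le> 2 * M ^ 4 * ?P" using M4 by (intro mult_right_mono mult_left_mono) auto
    finally show ?thesis .
  qed
  have ab_le: "a + b \<le> 2 * M * p powr (1 + g / 2)"
  proof -
    have "p powr (1 + g) \<le> p powr (1 + g / 2)" using g p_bounds by (intro powr_mono') auto
    then have "M * p powr (1 + g) \<le> M * p powr (1 + g / 2)" using M by (intro mult_left_mono) auto
    then show ?thesis using a_le b_le by linarith
  qed
  have t2: "2 * b * (1 - p) * entropy p (p - a - b) \<le> 8 * M ^ 4 * ?P"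
  proof -
    have "2 * b * (1 - p) * entropy p (p - a - b) \<le> 2 * b * (1 - p) * ((p - a - b - p)\<^sup>2 / (p * (1 - p)))"
      using ab q p_bounds by (intro mult_left_mono chi) auto
    also have "\<dots> = 2 * b * (a + b)\<^sup>2 / p"
    proof -
      have "(p - a - b - p)\<^sup>2 = (a + b)\<^sup>2" by (simp add: power2_eq_square algebra_simps)
      then show ?thesis using p_bounds by (simp add: field_simps)
    qed
    also have "\<dots> \<le> 2 * (M * p powr (1 + g / 2)) * (2 * M * p powr (1 + g / 2))\<^sup>2 / p"
      using ab p_bounds b_le ab_le M by (intro divide_right_mono mult_mono power_mono) auto
    also have "\<dots> = 8 * M ^ 3 * p powr (2 + 3 * g / 2)"
    proof -
      have "(p powr (1 + g / 2)) * (p powr (1 + g / 2))\<^sup>2 = p powr (3 + 3 * g / 2)"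
        using p_bounds by (simp add: power2_eq_square powr_add[symmetric])
      also have "\<dots> = p * p powr (2 + 3 * g / 2)" using pw[of "3 + 3 * g / 2"] by simp
      finally show ?thesis using p_bounds by (simp add: power_mult_distrib power3_eq_cube power2_eq_square mult_ac)
    qed
    also have "\<dots> \<le> 8 * M ^ 4 * ?P" using M M4 g by (intro mult_mono mono) auto
    finally show ?thesis .
  qed
  have a2: "a\<^sup>2 \<le> M ^ 4 * ?P"
  proof -
    have "a\<^sup>2 \<le> (M * p powr (1 + g))\<^sup>2" using ab a_le by (intro power_mono) auto
    also have "\<dots> = M\<^sup>2 * p powr (2 + 2 * g)"
      using p_bounds by (simp add: power_mult_distrib power2_eq_square powr_add[symmetric])
    also have "\<dots> \<le> M ^ 4 * ?P" using M4 g by (intro mult_mono mono) auto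
    finally show ?thesis .
  qed
  have t3: "2 * (p - a - b) * (1 - p) * entropy p (p - a) \<le> 2 * M ^ 4 * ?P"
  proof -
    have "2 * (p - a - b) * (1 - p) * entropy p (p - a) \<le> 2 * p * (1 - p) * ((p - a - p)\<^sup>2 / (p * (1 - p)))"
      using ab q p_bounds nn by (intro mult_mono chi) auto
    also have "\<dots> = 2 * a\<^sup>2" using p_bounds by (simp add: field_simps)
    finally show ?thesis using a2 by simp
  qed
  let ?X = "2 * p * a - a\<^sup>2 + b\<^sup>2"
  have X: "0 \<le> ?X" "?X \<le> 3 * M\<^sup>2 * ?P"
  proof -
    have "a * a \<le> p * a" using ab by (intro mult_right_mono) auto
    moreover have "0 \<le> p * a" using ab p_bounds by simp
    ultimately have "a\<^sup>2 \<le> 2 * p * a" by (simp add: power2_eq_square)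
    then show "0 \<le> ?X" using zero_le_power2[of b] by linarith
    have "2 * p * a \<le> 2 * p * (M * p powr (1 + g))" using a_le p_bounds by (intro mult_left_mono) auto
    also have "\<dots> = 2 * M * ?P" using pw[of "2 + g"] by (simp add: add.commute)
    also have "\<dots> \<le> 2 * M\<^sup>2 * ?P" using M by (intro mult_right_mono) (auto simp: power2_eq_square)
    finally have 1: "2 * p * a \<le> 2 * M\<^sup>2 * ?P" .
    have "b\<^sup>2 \<le> (M * p powr (1 + g / 2))\<^sup>2" using ab b_le by (intro power_mono) auto
    also have "\<dots> = M\<^sup>2 * ?P" using p_bounds by (simp add: power_mult_distrib power2_eq_square powr_add[symmetric])
    finally show "?X \<le> 3 * M\<^sup>2 * ?P" using 1 zero_le_power2[of a] by linarith
  qed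
  have t4: "(1 - p)\<^sup>2 * entropy p (w 4 4) \<le> 18 * M ^ 4 * ?P"
  proof -
    have "(1 - p)\<^sup>2 * entropy p (w 4 4) \<le> (1 - p)\<^sup>2 * ((w 4 4 - p)\<^sup>2 / (p * (1 - p)))"
      using x44 by (intro mult_left_mono chi) auto
    also have "w 4 4 - p = ?X / (1 - p)" by (simp add: block_weight_def)
    also have "(1 - p)\<^sup>2 * ((?X / (1 - p))\<^sup>2 / (p * (1 - p))) = ?X\<^sup>2 / (p * (1 - p))"
      using p_bounds by (simp add: power_divide)
    also have "\<dots> \<le> ?X\<^sup>2 / (p * (1 / 2))"
      using p p_bounds by (intro divide_left_mono mult_left_mono mult_pos_pos) auto
    also have "\<dots> \<le> (3 * M\<^sup>2 * ?P)\<^sup>2 / (p * (1 / 2))"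
      using X p_bounds by (intro divide_right_mono power_mono) auto
    also have "\<dots> = 18 * M ^ 4 * p powr (3 + 2 * g)"
    proof -
      have "?P\<^sup>2 = p powr (4 + 2 * g)" using p_bounds by (simp add: power2_eq_square powr_add[symmetric])
      also have "\<dots> = p * p powr (3 + 2 * g)" using pw[of "4 + 2 * g"] by simp
      finally have "?P\<^sup>2 = p * p powr (3 + 2 * g)" .
      moreover have "(M\<^sup>2)\<^sup>2 = M ^ 4" by simp
      ultimately show ?thesis using p_bounds by (simp add: power_mult_distrib)
    qed
    also have "\<dots> \<le> 18 * M ^ 4 * ?P" using M g by (intro mult_left_mono mono) auto
    finally show ?thesis .
  qed
  \<comment> \<open>The four error terms have constants 2, 8, 2 and 18, whose sum is below
    38.\<close>
  have "0 \<le> M ^ 4 * ?P" using M by simp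
  then show "graphon_entropy p W \<le> ?X * ln (1 / p) + 38 * M ^ 4 * ?P"
    unfolding graphon_entropy_W_eq using t1 t2 t3 t4 by (simp only: mult.assoc)
qed

lemma w_1_or_small: "w i j = 1 \<or> w i j \<le> 2 * p"
proof (cases "i = 4 \<and> j = 4")
  case True
  then show ?thesis using w44_bounds by simp
next
  case False
  then show ?thesis using ab p_bounds by (auto simp: block_weight_def)
qed

text \<open>Weight 1 has entropy \<open>ln (1 / p)\<close>, so the region where \<open>W\<close> is
  1 has area at most \<open>graphon_entropy p W / ln (1 / p)\<close>. This removes the logarithm and
  gives the order \<open>p powr (2 + gamma K)\<close> needed for \<open>G\<close>. What remains of
  \<open>W + p\<close> is at most \<open>3 * p\<close>.\<close>

lemma Hom_plus_p_le:
  fixes C :: real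
  assumes K: "simple_graph K"
    and C: "1 \<le> C" and I: "graphon_entropy p W \<le> C * p powr (2 + gamma K) * ln (1 / p)"
  shows "Hom K (\<lambda>x y. W x y + p) \<le> (3 ^ card K + 6 ^ card K * C ^ card (verts K)) * p ^ card K"
proof -
  let ?U = unit_measure
  let ?P = "Pi\<^sub>M (verts K) (\<lambda>_. ?U)"
  note Wm = graphonD(1)[OF graphon_W] and Wsym = graphonD(2)[OF graphon_W] and Wbd = graphonD(3)[OF graphon_W]
  have m': "(\<lambda>z. W (fst z) (snd z)) \<in> borel_measurable (?U \<Otimes>\<^sub>M ?U)"
    using Wm by (simp add: split_beta')
  note m'[measurable]
  define G where "G x y = (if W x y = 1 then 1 else 0 :: real)" for x y
  define B where "B x y = W x y + p - G x y" for x y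
  have Um: "(\<lambda>(x, y). W x y + p) \<in> borel_measurable (?U \<Otimes>\<^sub>M ?U)" unfolding split_beta' by measurable
  have Gm: "(\<lambda>(x, y). G x y) \<in> borel_measurable (?U \<Otimes>\<^sub>M ?U)" unfolding G_def split_beta' by measurable
  have Bm: "(\<lambda>(x, y). B x y) \<in> borel_measurable (?U \<Otimes>\<^sub>M ?U)" unfolding B_def G_def split_beta' by measurable
  have Usym: "W x y + p = W y x + p" if "x \<in> {0..1}" "y \<in> {0..1}" for x y using Wsym[OF that] by simp
  have Gsym: "G x y = G y x" if "x \<in> {0..1}" "y \<in> {0..1}" for x y using Wsym[OF that] by (simp add: G_def)
  have Bsym: "B x y = B y x" if "x \<in> {0..1}" "y \<in> {0..1}" for x y using Wsym[OF that] by (simp add: B_def G_def)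
  have Gbd: "0 \<le> G x y \<and> G x y \<le> 1" for x y by (simp add: G_def)
  have GW: "G x y \<le> W x y" if "x \<in> {0..1}" "y \<in> {0..1}" for x y using Wbd[OF that] by (simp add: G_def)
  have Bbd: "0 \<le> B x y \<and> B x y \<le> 3 * p" if "x \<in> {0..1}" "y \<in> {0..1}" for x y
    using Wbd[OF that] p_bounds w_1_or_small[of "idx x" "idx y"] by (auto simp: B_def G_def hub_clique_def)
  interpret P: prob_space ?P by (rule prob_space_PiM) (rule prob_space_unit)
  have main: "(\<integral>\<^sup>+x. (\<Prod>e\<in>K. ennreal (edge_value B x e)) \<partial>?P) \<le> ennreal ((3 * p) ^ card K)"
  proof -
    have "(\<integral>\<^sup>+x. (\<Prod>e\<in>K. ennreal (edge_value B x e)) \<partial>?P) \<le> (\<integral>\<^sup>+x. ennreal ((3 * p) ^ card K) \<partial>?P)"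
    proof (rule nn_integral_mono)
      fix x assume x: "x \<in> space ?P"
      have ev: "0 \<le> edge_value B x e \<and> edge_value B x e \<le> 3 * p" if "e \<in> K" for e
        by (rule edge_value_bounds[where W = B and P = "\<lambda>r. 0 \<le> r \<and> r \<le> 3 * p", OF K that order_refl Bsym Bbd x])
      have "(\<Prod>e\<in>K. edge_value B x e) \<le> (\<Prod>e\<in>K. 3 * p)" using ev by (intro prod_mono) auto
      then have "ennreal (\<Prod>e\<in>K. edge_value B x e) \<le> ennreal ((3 * p) ^ card K)" by (intro ennreal_leI) simp
      then show "(\<Prod>e\<in>K. ennreal (edge_value B x e)) \<le> ennreal ((3 * p) ^ card K)"
        using ev by (subst prod_ennreal) auto
    qed
    then show ?thesis by (simp add: P.emeasure_space_1)
  qed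
  have L: "0 < ln (1 / p)" using p_bounds by simp
  have ln0: "0 < 1 / ln (1 / p)" using L by simp
  have rest: "(\<integral>\<^sup>+x. (\<Prod>e\<in>F. ennreal (edge_value G x e)) \<partial>?P) \<le> ennreal (C ^ card (verts K) * p ^ card F)"
    if F: "F \<subseteq> K" "F \<noteq> {}" for F
  proof -
    have deg: "(\<integral>\<^sup>+y. ennreal (G x y) \<partial>?U) \<le> ennreal p" if x: "x \<in> {0..1}" for x
    proof -
      have "(\<integral>\<^sup>+y. ennreal (G x y) \<partial>?U) \<le> (\<integral>\<^sup>+y. ennreal (W x y) \<partial>?U)"
        using GW[OF x] by (intro nn_integral_mono ennreal_leI) (simp add: space_unit)
      then show ?thesis using p_regular_nn_integral[OF graphon_W p_regular_W x] by simp
    qed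
    note Em = entropy_integral(2)[OF graphon_W p_bounds]
    let ?E = "\<lambda>x y. ennreal (entropy p (W x y))"
    have "(\<integral>\<^sup>+x. \<integral>\<^sup>+y. ennreal (G x y) \<partial>?U \<partial>?U) \<le> (\<integral>\<^sup>+x. \<integral>\<^sup>+y. ennreal (1 / ln (1 / p)) * ?E x y \<partial>?U \<partial>?U)"
    proof (intro nn_integral_mono)
      fix x y assume "x \<in> space ?U" "y \<in> space ?U"
      then have xy: "x \<in> {0..1}" "y \<in> {0..1}" by (simp_all add: space_unit)
      have e0: "0 \<le> entropy p (W x y)" using entropy_nonneg[OF p_bounds] Wbd[OF xy] by blast
      have "G x y \<le> 1 / ln (1 / p) * entropy p (W x y)"
        using L e0 by (simp add: G_def entropy_one)
      then have "ennreal (G x y) \<le> ennreal (1 / ln (1 / p) * entropy p (W x y))" by (rule ennreal_leI)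
      also have "\<dots> = ennreal (1 / ln (1 / p)) * ?E x y" using ln0 e0 by (intro ennreal_mult) auto
      finally show "ennreal (G x y) \<le> ennreal (1 / ln (1 / p)) * ?E x y" .
    qed
    also have "\<dots> = (\<integral>\<^sup>+x. ennreal (1 / ln (1 / p)) * (\<integral>\<^sup>+y. ?E x y \<partial>?U) \<partial>?U)"
      using measurable_Pair2[OF Em] by (intro nn_integral_cong nn_integral_cmult) simp
    also have "\<dots> = ennreal (1 / ln (1 / p)) * ennreal (graphon_entropy p W)"
      unfolding entropy_integral(1)[OF graphon_W p_bounds, symmetric]
      using sigma_finite_measure.borel_measurable_nn_integral_fst[OF prob_space_imp_sigma_finite[OF prob_space_unit] Em]
      by (intro nn_integral_cmult) simp
    also have "\<dots> = ennreal (1 / ln (1 / p) * graphon_entropy p W)"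
      using ln0 entropy_integral(3)[OF graphon_W p_bounds] by (intro ennreal_mult[symmetric]) auto
    also have "\<dots> \<le> ennreal (C * p powr (2 + gamma K))"
      using I L by (intro ennreal_leI) (simp add: divide_le_eq)
    finally have tot: "(\<integral>\<^sup>+x. \<integral>\<^sup>+y. ennreal (G x y) \<partial>?U \<partial>?U) \<le> ennreal (C * p powr (2 + gamma K))" .
    have p1: "p \<le> 1" and C0: "0 \<le> C" using p_bounds C by simp_all
    have VK: "verts F \<subseteq> verts K" using F(1) by auto
    obtain k where k: "k \<le> card (verts F)" "(\<integral>\<^sup>+x. (\<Prod>e\<in>F. ennreal (edge_value G x e)) \<partial>?P)
      \<le> ennreal (sqrt C ^ k * p ^ card F)"
      using edge_product_integral_le_gamma[OF K F finite_verts[OF K] VK Gm Gsym Gbd deg tot p_bounds(1) p1 C0] by metis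
    have "k \<le> card (verts K)" using k(1) card_mono[OF finite_verts[OF K] VK] by linarith
    have "sqrt C \<le> C"
    proof (rule real_le_lsqrt)
      show "C \<le> C\<^sup>2" using C by (simp add: power2_eq_square)
    qed (use C in auto)
    then have "sqrt C ^ k \<le> C ^ k" using C by (intro power_mono) auto
    also have "\<dots> \<le> C ^ card (verts K)" using C \<open>k \<le> card (verts K)\<close> by (intro power_increasing) auto
    finally have "sqrt C ^ k * p ^ card F \<le> C ^ card (verts K) * p ^ card F"
      using p_bounds by (intro mult_right_mono) auto
    then show ?thesis using k(2) by (meson ennreal_leI order_trans)
  qed
  have "Hom K (\<lambda>x y. W x y + p) \<le> (3 * p) ^ card K + (2 * 3) ^ card K * C ^ card (verts K) * p ^ card K"
  proof (rule Hom_le_split[OF K Um Bm Gm Usym Bsym Gsym _ Bbd Gbd main])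
    show "0 \<le> W x y + p \<and> W x y + p \<le> B x y + G x y" if "x \<in> {0..1}" "y \<in> {0..1}" for x y
      using Wbd[OF that] p_bounds by (simp add: B_def)
  qed (use p_bounds C rest in auto)
  then show ?thesis by (simp add: power_mult_distrib distrib_right)
qed

end

section \<open>Asymptotics\<close>

text \<open>The parameters are functions of \<open>p\<close>, and estimates are made as
  \<open>p\<close> tends to 0 from the right; sequences enter later by composition.\<close>

locale hub_clique_family =
  fixes K :: "'a set set" and \<delta> M :: real and z y :: "real \<Rightarrow> real"
  assumes K: "simple_graph K" and g_pos: "0 < gamma K" and g_le: "gamma K \<le> real (card K) - 3"
    and \<delta>: "0 < \<delta>" and rho: "0 < rho K \<delta>"
    and lim: "((\<lambda>p. z p + y p / 2) \<longlongrightarrow> rho K \<delta>) (at_right 0)"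
    and z: "\<And>p. 0 < p \<Longrightarrow> p < exp (-1) \<Longrightarrow> 1 / ln (1 / p) \<le> z p \<and> z p \<le> M"
    and y: "\<And>p. 0 < p \<Longrightarrow> p < exp (-1) \<Longrightarrow> 1 / ln (1 / p) \<le> y p \<and> y p \<le> M"
    and P: "\<And>p. 0 < p \<Longrightarrow> p < exp (-1) \<Longrightarrow> 1 + \<delta> + \<delta> / ln (1 / p) \<le> P_poly K (z p) (y p)"
    and M: "1 \<le> M"
begin

abbreviation "g \<equiv> gamma K"
definition a where "a p = z p * p powr (1 + g)"
definition b where "b p = sqrt (y p) * p powr (1 + g / 2)"
abbreviation "S p \<equiv> block_set p (a p) (b p)"
abbreviation "m p \<equiv> block_len p (a p) (b p)"
abbreviation "w p \<equiv> block_weight p (a p) (b p)"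
abbreviation "W p \<equiv> hub_clique p (a p) (b p)"
definition Ent where "Ent p = graphon_entropy p (W p)"

text \<open>The smallness conditions under which the estimates hold pointwise. The last one says
  that the polynomial losses in the density fit into the logarithmic slack of the
  parameters.\<close>

definition good :: "real \<Rightarrow> bool" where
  "good p \<longleftrightarrow> 0 < p \<and> p < exp (-1) \<and> p < 1/4 \<and> 4 * M * p powr (g / 2) \<le> 1 \<and> p powr (g / 2) * ln (1 / p) \<le> 1 \<and>
     (real (card (verts K) + card K) * (2 * M * p powr (g / 2) + p)) * ln (1 / p) * (1 + 2 * \<delta>) \<le> \<delta>"

text \<open>The pairs of blocks that are important; the condition on \<open>\<gamma>\<close> decides about the pairs of
  weight exactly \<open>p\<close>.\<close>

definition imp_pair :: "nat \<Rightarrow> nat \<Rightarrow> bool" where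
  "imp_pair i j \<longleftrightarrow> i \<in> {1..3} \<and> j \<in> {1..3} \<and>
     (i = 1 \<or> j = 1 \<or> i = 2 \<and> j = 2 \<or> g \<le> 1 \<or> g \<le> 2 \<and> \<not> (i = 3 \<and> j = 3))"

lemma powr_tendsto_0: "0 < s \<Longrightarrow> ((\<lambda>p::real. p powr s) \<longlongrightarrow> 0) (at_right 0)"
  by real_asymp

lemma powr_ln_tendsto_0: "0 < s \<Longrightarrow> ((\<lambda>p::real. p powr s * ln (1 / p)) \<longlongrightarrow> 0) (at_right 0)"
  by real_asymp

lemma eventually_at_right_less: "0 < c \<Longrightarrow> eventually (\<lambda>p::real. 0 < p \<and> p < c) (at_right 0)"
  unfolding eventually_at_right_field by (intro exI[of _ c]) auto

lemma eventually_good: "eventually good (at_right 0)"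
proof -
  have h: "0 < g / 2" using g_pos by simp
  have 1: "eventually (\<lambda>p. 4 * M * p powr (g / 2) < 1) (at_right 0)"
    using tendsto_mult_right_zero[OF powr_tendsto_0[OF h], of "4 * M"] by (rule order_tendstoD) simp
  have 2: "eventually (\<lambda>p. p powr (g / 2) * ln (1 / p) < 1) (at_right 0)"
    using powr_ln_tendsto_0[OF h] by (rule order_tendstoD) simp
  have p1: "((\<lambda>p::real. p * ln (1 / p)) \<longlongrightarrow> 0) (at_right 0)" by real_asymp
  define c where "c = real (card (verts K) + card K) * (1 + 2 * \<delta>)"
  have "((\<lambda>p. c * (2 * M * (p powr (g / 2) * ln (1 / p)) + p * ln (1 / p))) \<longlongrightarrow> c * (2 * M * 0 + 0)) (at_right 0)"
    by (intro tendsto_intros powr_ln_tendsto_0 h p1)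
  then have "eventually (\<lambda>p. c * (2 * M * (p powr (g / 2) * ln (1 / p)) + p * ln (1 / p)) < \<delta>) (at_right 0)"
    by (rule order_tendstoD) (simp add: \<delta>)
  moreover have "c * (2 * M * (p powr (g / 2) * ln (1 / p)) + p * ln (1 / p)) =
      (real (card (verts K) + card K) * (2 * M * p powr (g / 2) + p)) * ln (1 / p) * (1 + 2 * \<delta>)" for p
    unfolding c_def by (simp only: distrib_left distrib_right mult_ac)
  ultimately have 3: "eventually (\<lambda>p. (real (card (verts K) + card K) * (2 * M * p powr (g / 2) + p)) * ln (1 / p) * (1 + 2 * \<delta>) < \<delta>) (at_right 0)"
    by simp
  have 4: "eventually (\<lambda>p::real. 0 < p \<and> p < exp (-1)) (at_right 0)" "eventually (\<lambda>p::real. 0 < p \<and> p < 1/4) (at_right 0)"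
    by (rule eventually_at_right_less, simp)+
  from 1 2 3 4 show ?thesis by eventually_elim (simp only: good_def less_imp_le simp_thms)
qed

context
  fixes p :: real
  assumes good: "good p"
begin

lemma p0: "0 < p" "p < exp (-1)" "p < 1/4" "p < 1"
  using good by (auto simp: good_def)

lemma h_small: "4 * M * p powr (g / 2) \<le> 1" "p powr (g / 2) * ln (1 / p) \<le> 1" "p powr (g / 2) \<le> 1/4"
proof -
  show 1: "4 * M * p powr (g / 2) \<le> 1" "p powr (g / 2) * ln (1 / p) \<le> 1" using good by (auto simp: good_def)
  have "1 * p powr (g / 2) \<le> M * p powr (g / 2)" using M by (intro mult_right_mono) auto
  then show "p powr (g / 2) \<le> 1/4" using 1 by simp
qed

lemma L_gt_1: "1 < ln (1 / p)"
proof -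
  have "ln p < ln (exp (-1))" using p0 by (subst ln_less_cancel_iff) auto
  then show ?thesis using p0 by (simp add: ln_div)
qed

lemma t_bounds: "p \<le> 1 / ln (1 / p)" "p powr (g / 2) \<le> 1 / ln (1 / p)" "1 / ln (1 / p) \<le> 1" "0 < 1 / ln (1 / p)"
proof -
  have "ln (1 / p) \<le> 1 / p - 1" using p0 by (intro ln_le_minus_one) auto
  then have "p * ln (1 / p) \<le> p * (1 / p - 1)" using p0 by (intro mult_left_mono) auto
  also have "\<dots> \<le> 1" using p0 by (simp add: right_diff_distrib)
  finally show "p \<le> 1 / ln (1 / p)" using L_gt_1 by (simp add: le_divide_eq)
  show "p powr (g / 2) \<le> 1 / ln (1 / p)" using h_small(2) L_gt_1 by (simp add: le_divide_eq)
qed (use L_gt_1 in auto)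

lemma zy_bounds: "1 / ln (1 / p) \<le> z p" "z p \<le> M" "1 / ln (1 / p) \<le> y p" "y p \<le> M" "0 < z p" "0 < y p"
  using z[OF p0(1,2)] y[OF p0(1,2)] t_bounds(4) by linarith+

lemma pw_split: "p powr (1 + s) = p * p powr s" "p powr (2 + s) = p * (p * p powr s)"
  using p0(1) by (simp_all add: powr_add power2_eq_square)

lemma a_bounds: "1 / ln (1 / p) * p powr (1 + g) \<le> a p" "a p \<le> M * p powr (1 + g)"
  unfolding a_def by (rule mult_right_mono[OF zy_bounds(1)], simp) (rule mult_right_mono[OF zy_bounds(2)], simp)

lemma b_bounds: "1 / ln (1 / p) * p powr (1 + g / 2) \<le> b p" "b p \<le> M * p powr (1 + g / 2)"
proof -
  have "1 / ln (1 / p) \<le> sqrt (1 / ln (1 / p))"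
  proof (rule real_le_rsqrt)
    show "(1 / ln (1 / p))\<^sup>2 \<le> 1 / ln (1 / p)"
      unfolding power2_eq_square using t_bounds(3,4) mult_right_mono[of "1 / ln (1 / p)" 1 "1 / ln (1 / p)"] by linarith
  qed
  also have "\<dots> \<le> sqrt (y p)" using zy_bounds by simp
  finally show "1 / ln (1 / p) * p powr (1 + g / 2) \<le> b p" unfolding b_def by (rule mult_right_mono) simp
  have "sqrt (y p) \<le> sqrt M" using zy_bounds by simp
  also have "\<dots> \<le> M"
  proof (rule real_le_lsqrt)
    show "M \<le> M\<^sup>2" using M by (simp add: power2_eq_square)
  qed (use M in auto)
  finally show "b p \<le> M * p powr (1 + g / 2)" unfolding b_def by (rule mult_right_mono) simp
qed

lemma pw_mono: "s \<le> s' \<Longrightarrow> p powr s' \<le> p powr s"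
  using p0 by (intro powr_mono') auto

lemma ab_le: "a p + b p \<le> 2 * M * p powr (1 + g / 2)" "a p \<le> M * p powr (1 + g / 2)"
proof -
  have "M * p powr (1 + g) \<le> M * p powr (1 + g / 2)"
    using M g_pos by (intro mult_left_mono pw_mono) auto
  then show "a p + b p \<le> 2 * M * p powr (1 + g / 2)" "a p \<le> M * p powr (1 + g / 2)"
    using a_bounds(2) b_bounds(2) by linarith+
qed

lemma ab_half: "a p + b p \<le> p / 2"
proof -
  have "2 * M * p powr (1 + g / 2) = p / 2 * (4 * M * p powr (g / 2))" by (simp add: pw_split)
  also have "\<dots> \<le> p / 2 * 1" using h_small(1) p0 by (intro mult_left_mono) auto
  finally show ?thesis using ab_le by linarith
qed

lemma ab_pos: "0 < a p" "0 < b p"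
  using zy_bounds p0 by (simp_all add: a_def b_def)

lemma params: "hub_clique_params p (a p) (b p)"
  using p0 ab_pos ab_half by unfold_locales linarith+


text \<open>Bernoulli's inequality bounds all losses by a factor \<open>1 - x\<close> with
  \<open>x\<close> of polynomial size, and the slack \<open>\<delta> / ln (1 / p)\<close> in the
  constraint absorbs it.\<close>

lemma Hom_ge: "(1 + \<delta>) * p ^ card K \<le> Hom K (W p)"
proof -
  let ?n = "card (verts K) + card K" and ?v = "card (verts K)"
  define \<epsilon> where "\<epsilon> = (a p + b p) / p"
  have eps: "a p + b p = \<epsilon> * p" using p0 by (simp add: \<epsilon>_def)
  have e1: "\<epsilon> \<le> 2 * M * p powr (g / 2)"
    using ab_le(1) p0 unfolding \<epsilon>_def by (simp add: divide_le_eq pw_split mult_ac)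
  have e2: "0 \<le> \<epsilon>" "\<epsilon> \<le> 1" using ab_half ab_pos p0 by (simp_all add: \<epsilon>_def divide_le_eq)
  define x where "x = real ?n * (2 * M * p powr (g / 2) + p)"
  have x0: "0 \<le> x" using M p0 by (simp add: x_def)
  have good6: "x * ln (1 / p) * (1 + 2 * \<delta>) \<le> \<delta>" using good by (simp add: good_def x_def)
  define t where "t = 1 / ln (1 / p)"
  have t: "0 < t" "t \<le> 1" using t_bounds by (simp_all add: t_def)
  have xt: "x * (1 + 2 * \<delta>) \<le> \<delta> * t"
    using good6 L_gt_1 by (simp add: t_def le_divide_eq mult_ac)
  have AB: "1 - x \<le> (1 - \<epsilon>) ^ ?n * (1 - p) ^ ?v"
  proof -
    have 1: "1 - real ?n * \<epsilon> \<le> (1 - \<epsilon>) ^ ?n" using Bernoulli_inequality[of "- \<epsilon>" ?n] e2 by simp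
    have 2: "1 - real ?v * p \<le> (1 - p) ^ ?v" using Bernoulli_inequality[of "- p" ?v] p0 by simp
    have 3: "(1 - \<epsilon>) ^ ?n \<le> 1" "0 \<le> (1 - \<epsilon>) ^ ?n" "(1 - p) ^ ?v \<le> 1" using e2 p0 by (auto intro!: power_le_one)
    have "(1 - \<epsilon>) ^ ?n * (1 - (1 - p) ^ ?v) \<le> 1 * (1 - (1 - p) ^ ?v)" using 3 by (intro mult_right_mono) auto
    then have "(1 - \<epsilon>) ^ ?n - (1 - (1 - p) ^ ?v) \<le> (1 - \<epsilon>) ^ ?n * (1 - p) ^ ?v" by (simp add: right_diff_distrib)
    moreover have "real ?n * \<epsilon> + real ?v * p \<le> x"
    proof -
      have "real ?n * \<epsilon> \<le> real ?n * (2 * M * p powr (g / 2))" using e1 by (intro mult_left_mono) auto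
      moreover have "real ?v * p \<le> real ?n * p" using p0 by (intro mult_right_mono) auto
      ultimately show ?thesis unfolding x_def distrib_left by linarith
    qed
    ultimately show ?thesis using 1 2 by linarith
  qed
  have Pp: "1 + \<delta> + \<delta> * t \<le> P_poly K (z p) (y p)" using P[OF p0(1,2)] by (simp add: t_def)
  have dt: "0 < \<delta> * t" "\<delta> * t \<le> \<delta>" using \<delta> t by simp_all
  have "x * (1 + \<delta> + \<delta> * t) \<le> x * (1 + 2 * \<delta>)" using x0 dt by (intro mult_left_mono) auto
  then have "1 + \<delta> \<le> (1 + \<delta> + \<delta> * t) * (1 - x)" using xt by (simp add: algebra_simps)
  also have "\<dots> \<le> (1 + \<delta> + \<delta> * t) * ((1 - \<epsilon>) ^ ?n * (1 - p) ^ ?v)"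
    using AB \<delta> dt by (intro mult_left_mono) auto
  also have "\<dots> \<le> P_poly K (z p) (y p) * ((1 - \<epsilon>) ^ ?n * (1 - p) ^ ?v)"
    using Pp e2 p0 by (intro mult_right_mono) auto
  finally have "(1 + \<delta>) * p ^ card K \<le> P_poly K (z p) (y p) * ((1 - \<epsilon>) ^ ?n * (1 - p) ^ ?v) * p ^ card K"
    using p0 by (intro mult_right_mono) auto
  also have "\<dots> = P_poly K (z p) (y p) * (p ^ card K * (1 - \<epsilon>) ^ ?n * (1 - p) ^ ?v)" by (simp add: mult_ac)
  also have "\<dots> \<le> Hom K (W p)"
    using g_pos zy_bounds by (intro hub_clique_params.Hom_W_ge[OF params K _ _ _ a_def b_def eps e2(2)]) auto
  finally show ?thesis .
qed

text \<open>After division by \<open>p powr (2 + g) * ln (1 / p)\<close> the hub strips, of area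
  about \<open>2 * p * a p\<close>, give \<open>2 * z p\<close>, and the clique gives
  \<open>y p\<close>. This is the source of the objective of \<open>rho\<close> and of the factor 2
  in front of it.\<close>

lemma Ent_ratio:
  "2 * (z p + y p / 2) - M\<^sup>2 * p powr g \<le> Ent p / (p powr (2 + g) * ln (1 / p))"
  "Ent p / (p powr (2 + g) * ln (1 / p)) \<le> 2 * (z p + y p / 2) + 38 * M ^ 4 * (1 / ln (1 / p))"
proof -
  let ?Q = "p powr (2 + g)" and ?L = "ln (1 / p)"
  have Q: "0 < ?Q" and L: "0 < ?L" using p0 L_gt_1 by simp_all
  define c where "c = 2 * z p - (z p)\<^sup>2 * p powr g + y p"
  have X: "2 * p * a p - (a p)\<^sup>2 + (b p)\<^sup>2 = c * ?Q"
  proof -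
    have "(p powr (1 + g / 2))\<^sup>2 = p powr (1 + g / 2 + (1 + g / 2))" unfolding power2_eq_square powr_add[symmetric] ..
    also have "1 + g / 2 + (1 + g / 2) = 2 + g" by simp
    finally have "(b p)\<^sup>2 = y p * ?Q" using zy_bounds by (simp add: b_def power_mult_distrib)
    moreover have "2 * p * a p = 2 * z p * ?Q" by (simp add: a_def pw_split)
    moreover have "(a p)\<^sup>2 = (z p)\<^sup>2 * p powr g * ?Q"
      by (simp add: a_def pw_split power_mult_distrib power2_eq_square)
    ultimately show ?thesis by (simp add: c_def algebra_simps)
  qed
  note s = hub_clique_params.entropy_sandwich[OF params g_pos M a_bounds(2) b_bounds(2), folded Ent_def, unfolded X]
  have "c * (?Q * ?L) \<le> Ent p" using s(1) by (simp add: mult.assoc)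
  then have lo: "c \<le> Ent p / (?Q * ?L)" using Q L by (simp add: le_divide_eq)
  have "Ent p \<le> (c + 38 * M ^ 4 * (1 / ?L)) * (?Q * ?L)"
  proof -
    have "(c + 38 * M ^ 4 * (1 / ?L)) * (?Q * ?L) = c * ?Q * ?L + 38 * M ^ 4 * ?Q" using L by (simp add: field_simps)
    then show ?thesis using s(2) by (simp only:)
  qed
  then have hi: "Ent p / (?Q * ?L) \<le> c + 38 * M ^ 4 * (1 / ?L)" using Q L by (simp add: divide_le_eq)
  have "(z p)\<^sup>2 * p powr g \<le> M\<^sup>2 * p powr g" using zy_bounds by (intro mult_right_mono power_mono) auto
  moreover have "0 \<le> (z p)\<^sup>2 * p powr g" by simp
  ultimately have "2 * (z p + y p / 2) - M\<^sup>2 * p powr g \<le> c" "c \<le> 2 * (z p + y p / 2)"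
  proof -
    assume *: "(z p)\<^sup>2 * p powr g \<le> M\<^sup>2 * p powr g" "0 \<le> (z p)\<^sup>2 * p powr g"
    have "2 * (z p + y p / 2) = 2 * z p + y p" by simp
    then show "2 * (z p + y p / 2) - M\<^sup>2 * p powr g \<le> c" "c \<le> 2 * (z p + y p / 2)"
      using * unfolding c_def by simp_all
  qed
  then show "2 * (z p + y p / 2) - M\<^sup>2 * p powr g \<le> Ent p / (?Q * ?L)"
    "Ent p / (?Q * ?L) \<le> 2 * (z p + y p / 2) + 38 * M ^ 4 * (1 / ?L)"
    using lo hi by linarith+
qed

lemma m3: "p / 2 \<le> m p 3" "m p 3 \<le> p" and m4: "1/2 \<le> m p 4" "m p 4 \<le> 1"
proof -
  have "m p 3 = p - a p - b p" "m p 4 = 1 - p" by (simp_all add: block_len_def)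
  then show "p / 2 \<le> m p 3" "m p 3 \<le> p" "1/2 \<le> m p 4" "m p 4 \<le> 1"
    using ab_half ab_pos p0(1,3) by linarith+
qed

lemma m_le_p: "i \<in> {1..3} \<Longrightarrow> m p i \<le> p"
proof -
  assume "i \<in> {1..3::nat}"
  then consider "i = 1" | "i = 2" | "i = 3" by fastforce
  then show ?thesis
    using ab_half ab_pos p0(1) m3(2) by cases (simp_all add: block_len_def)
qed

lemma m_nonneg: "0 < m p i"
  by (rule hub_clique_params.m_pos[OF params])

lemma w_le_1: "0 \<le> w p i j" "w p i j \<le> 1"
  using hub_clique_params.w_bounds[OF params] by blast+

lemma w_ge_p: "i \<in> {1..3} \<Longrightarrow> j \<in> {1..3} \<Longrightarrow> p \<le> w p i j"
  using p0 by (auto simp: block_weight_def)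

text \<open>A crude bound, sufficient for the lower bounds on \<open>m(S_i)\<close> and
  \<open>w_ij m(S_i)\<close> because \<open>ln n / n\<close> is of smaller order than
  \<open>p powr (2 + g)\<close>. For the hub it uses
  \<open>p <= 1 / ln (1 / p) <= z p\<close>.\<close>

lemma p_powr_le_m_w: "i \<in> {1..3} \<Longrightarrow> j \<in> {1..3} \<Longrightarrow> p powr (2 + g) \<le> w p i j * m p i"
proof -
  assume ij: "i \<in> {1..3}" "j \<in> {1..3::nat}"
  then consider "i = 1" | "i = 2" | "i = 3" by fastforce
  then show ?thesis
  proof cases
    case 1
    have "p * p powr (1 + g) \<le> 1 / ln (1 / p) * p powr (1 + g)" using t_bounds by (intro mult_right_mono) auto
    then have "p powr (2 + g) \<le> a p" using a_bounds(1) by (simp add: pw_split)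
    moreover have "w p i j = 1" using 1 ij by (auto simp: block_weight_def)
    ultimately show ?thesis using 1 by (simp add: block_len_def)
  next
    case 2
    have "p powr (2 + g) = p * (p powr (g / 2) * p powr (1 + g / 2))"
    proof -
      have "p powr (g / 2) * p powr (1 + g / 2) = p powr (g / 2 + (1 + g / 2))" by (rule powr_add[symmetric])
      also have "g / 2 + (1 + g / 2) = 1 + g" by simp
      finally have r: "p powr (g / 2) * p powr (1 + g / 2) = p powr (1 + g)" .
      have "p powr (2 + g) = p * p powr (1 + g)" by (simp add: pw_split)
      then show ?thesis unfolding r .
    qed
    also have "\<dots> \<le> p * (1 / ln (1 / p) * p powr (1 + g / 2))"
      using t_bounds p0 by (intro mult_left_mono mult_right_mono) auto
    also have "\<dots> \<le> p * b p" using b_bounds p0 by (intro mult_left_mono) auto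
    also have "\<dots> \<le> w p i j * b p" using w_ge_p[OF ij] ab_pos by (intro mult_right_mono) auto
    finally show ?thesis using 2 by (simp add: block_len_def)
  next
    case 3
    have "p powr g \<le> p powr (g / 2)" using g_pos by (intro pw_mono) simp
    then have "p * (p * p powr g) \<le> p * (p * (1/2))" using h_small(3) p0 by (intro mult_left_mono) auto
    also have "\<dots> \<le> w p i j * m p 3" using w_ge_p[OF ij] m3 p0 by (intro mult_mono) auto
    finally show ?thesis using 3 by (simp add: pw_split)
  qed
qed

lemma p_powr_le_m: "i \<in> {1..4} \<Longrightarrow> p powr (2 + g) \<le> m p i"
proof -
  assume "i \<in> {1..4::nat}"
  then consider "i \<in> {1..3}" | "i = 4" by fastforce
  then show ?thesis
  proof cases
    case 1
    have "p powr (2 + g) \<le> w p i i * m p i" by (rule p_powr_le_m_w[OF 1 1])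
    also have "\<dots> \<le> 1 * m p i" using w_le_1 m_nonneg[of i] by (intro mult_right_mono) auto
    finally show ?thesis by simp
  next
    case 2
    have "p powr (2 + g) \<le> p powr 1" using g_pos by (intro pw_mono) simp
    then show ?thesis using 2 m4 p0 by simp
  qed
qed

text \<open>Pairs of weight \<open>p\<close> have mass at most a constant times
  \<open>p powr (3 + g / 2)\<close> for blocks 2 and 3, and \<open>p ^ 3\<close> within block 3.
  This is of order at most \<open>p powr (2 + g)\<close> if \<open>g <= 2\<close> and if
  \<open>g <= 1\<close>, respectively; pairs of weight 1 have that order for every
  \<open>g\<close>.\<close>

lemma imp_le: "imp_pair i j \<Longrightarrow> m p i * m p j * w p i j \<le> M\<^sup>2 * p powr (2 + g)"
proof -
  assume ij: "imp_pair i j"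
  have m0: "0 \<le> m p i" for i using m_nonneg by (rule less_imp_le)
  have MM: "M \<le> M\<^sup>2" "1 \<le> M\<^sup>2" using M power_increasing[of 1 2 M] one_le_power[of M 2] by simp_all
  have r: "i \<in> {1..3}" "j \<in> {1..3}" using ij by (simp_all add: imp_pair_def)
  have ap: "a p * p \<le> M\<^sup>2 * p powr (2 + g)"
  proof -
    have "a p * p \<le> M * p powr (1 + g) * p" using a_bounds p0 by (intro mult_right_mono) auto
    also have "\<dots> = M * p powr (2 + g)" by (simp add: pw_split mult_ac)
    also have "\<dots> \<le> M\<^sup>2 * p powr (2 + g)" using MM by (intro mult_right_mono) auto
    finally show ?thesis .
  qed
  have m1: "m p 1 = a p" by (simp add: block_len_def)
  have w1: "m p i * m p j * w p i j \<le> m p i * m p j * 1" using w_le_1 m0 by (intro mult_left_mono mult_nonneg_nonneg)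
  have bp: "m p i * m p j * p \<le> M\<^sup>2 * p powr (2 + g)" if "g \<le> 2" "i = 2 \<and> j = 3 \<or> i = 3 \<and> j = 2"
  proof -
    have "m p i * m p j * p = b p * m p 3 * p" using that(2) by (auto simp: block_len_def)
    also have "\<dots> \<le> (M * p powr (1 + g / 2)) * p * p"
      using b_bounds m3 m0 p0 M by (intro mult_mono) auto
    also have "\<dots> = M * p powr (3 + g / 2)"
      using p0 powr_add[of p 2 "1 + g / 2"] by (simp add: power2_eq_square mult_ac)
    also have "\<dots> \<le> M\<^sup>2 * p powr (2 + g)" using MM M that(1) by (intro mult_mono pw_mono) auto
    finally show ?thesis .
  qed
  consider "i = 1" | "j = 1" | "i = 2" "j = 2" | "i = 2 \<and> j = 3 \<or> i = 3 \<and> j = 2" "g \<le> 2" | "i = 3" "j = 3" "g \<le> 1"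
  proof -
    have "i = 1 \<or> i = 2 \<or> i = 3" "j = 1 \<or> j = 2 \<or> j = 3" using r by auto
    then show ?thesis using ij that unfolding imp_pair_def by fastforce
  qed
  then show ?thesis
  proof cases
    case 1
    have "a p * m p j \<le> a p * p" using m_le_p[OF r(2)] ab_pos by (intro mult_left_mono) auto
    then show ?thesis using w1 ap unfolding 1 m1 by linarith
  next
    case 2
    have "m p i * a p \<le> p * a p" using m_le_p[OF r(1)] ab_pos by (intro mult_right_mono) auto
    then show ?thesis using w1 ap unfolding 2 m1 mult.commute[of p "a p"] by linarith
  next
    case 3
    have "b p * b p \<le> (M * p powr (1 + g / 2)) * (M * p powr (1 + g / 2))"
      using b_bounds ab_pos by (intro mult_mono) auto
    also have "\<dots> = M\<^sup>2 * (p powr (1 + g / 2) * p powr (1 + g / 2))" by (simp add: power2_eq_square mult_ac)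
    also have "p powr (1 + g / 2) * p powr (1 + g / 2) = p powr (2 + g)" using p0 by (simp add: powr_add[symmetric])
    finally show ?thesis using w1 3 by (simp add: block_len_def)
  next
    case 4
    then have "w p i j = p" by (auto simp: block_weight_def)
    then show ?thesis using bp[OF 4(2,1)] by simp
  next
    case 5
    have "m p 3 * m p 3 * p \<le> p * p * p" using m3 m0 p0 by (intro mult_mono) auto
    also have "\<dots> = 1 * p powr 3" using p0 by (simp add: powr_numeral power3_eq_cube)
    also have "\<dots> \<le> M\<^sup>2 * p powr (2 + g)" using MM 5(3) by (intro mult_mono pw_mono) auto
    finally show ?thesis using 5 by (simp add: block_weight_def)
  qed
qed

end

end

lemma Hom_nonneg:
  assumes K: "simple_graph K"
    and sym: "\<And>a b. a \<in> {0..1} \<Longrightarrow> b \<in> {0..1} \<Longrightarrow> U a b = U b a"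
    and nn: "\<And>a b. a \<in> {0..1} \<Longrightarrow> b \<in> {0..1} \<Longrightarrow> 0 \<le> U a b"
  shows "0 \<le> Hom K U"
  unfolding Hom_def
proof (rule Bochner_Integration.integral_nonneg)
  fix x assume x: "x \<in> space (Pi\<^sub>M (verts K) (\<lambda>_. unit_measure))"
  have "0 \<le> edge_value U x e" if "e \<in> K" for e
    by (rule edge_value_bounds[where W = U and P = "\<lambda>r. 0 \<le> r", OF K that order_refl sym nn x])
  then show "0 \<le> (\<Prod>e\<in>K. edge_value U x e)" by (rule prod_nonneg)
qed

section \<open>The entropy against block masses as p tends to 0\<close>

context hub_clique_family
begin

lemma Ent_lim: "((\<lambda>p. Ent p / (p powr (2 + g) * ln (1 / p))) \<longlongrightarrow> 2 * rho K \<delta>) (at_right 0)"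
proof (rule tendsto_sandwich)
  show "eventually (\<lambda>p. 2 * (z p + y p / 2) - M\<^sup>2 * p powr g \<le> Ent p / (p powr (2 + g) * ln (1 / p))) (at_right 0)"
    using eventually_good by eventually_elim (rule Ent_ratio)
  show "eventually (\<lambda>p. Ent p / (p powr (2 + g) * ln (1 / p)) \<le> 2 * (z p + y p / 2) + 38 * M ^ 4 * (1 / ln (1 / p))) (at_right 0)"
    using eventually_good by eventually_elim (rule Ent_ratio)
  have "((\<lambda>p. 2 * (z p + y p / 2) - M\<^sup>2 * p powr g) \<longlongrightarrow> 2 * rho K \<delta> - M\<^sup>2 * 0) (at_right 0)"
    by (intro tendsto_intros lim powr_tendsto_0 g_pos)
  then show "((\<lambda>p. 2 * (z p + y p / 2) - M\<^sup>2 * p powr g) \<longlongrightarrow> 2 * rho K \<delta>) (at_right 0)" by simp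
  have l: "((\<lambda>p::real. 1 / ln (1 / p)) \<longlongrightarrow> 0) (at_right 0)" by real_asymp
  have "((\<lambda>p. 2 * (z p + y p / 2) + 38 * M ^ 4 * (1 / ln (1 / p))) \<longlongrightarrow> 2 * rho K \<delta> + 38 * M ^ 4 * 0) (at_right 0)"
    by (intro tendsto_add tendsto_mult tendsto_const lim l)
  then show "((\<lambda>p. 2 * (z p + y p / 2) + 38 * M ^ 4 * (1 / ln (1 / p))) \<longlongrightarrow> 2 * rho K \<delta>) (at_right 0)" by simp
qed

lemma eventually_denominator: "eventually (\<lambda>p. 0 < p powr (2 + g) * ln (1 / p)) (at_right 0)"
  using eventually_good
proof eventually_elim
  case (elim p)
  show ?case
    by (rule mult_pos_pos) (use L_gt_1[OF elim] p0(1)[OF elim] in simp, use L_gt_1[OF elim] in linarith)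
qed

lemma Ent_bigo: "Ent \<in> O[at_right 0](\<lambda>p. p powr (2 + g) * ln (1 / p))"
  by (rule bigoI_tendsto[OF Ent_lim], rule eventually_mono[OF eventually_denominator]) (metis less_irrefl)

lemma eventually_Ent_pos: "eventually (\<lambda>p. 0 < Ent p) (at_right 0)"
proof -
  have "eventually (\<lambda>p. 0 < Ent p / (p powr (2 + g) * ln (1 / p))) (at_right 0)"
    using Ent_lim by (rule order_tendstoD) (simp add: rho)
  with eventually_denominator show ?thesis by eventually_elim (simp add: zero_less_divide_iff)
qed

lemma bigo_Ent: "(\<lambda>p. p powr (2 + g) * ln (1 / p)) \<in> O[at_right 0](Ent)"
proof (rule bigoI_tendsto)
  have "((\<lambda>p. inverse (Ent p / (p powr (2 + g) * ln (1 / p)))) \<longlongrightarrow> inverse (2 * rho K \<delta>)) (at_right 0)"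
    using rho by (intro tendsto_inverse Ent_lim) simp
  then show "((\<lambda>p. p powr (2 + g) * ln (1 / p) / Ent p) \<longlongrightarrow> inverse (2 * rho K \<delta>)) (at_right 0)" by simp
  show "eventually (\<lambda>p. Ent p \<noteq> 0) (at_right 0)" using eventually_Ent_pos by eventually_elim simp
qed

lemma powr_bigo_Ent: "(\<lambda>p. p powr (2 + g)) \<in> O[at_right 0](Ent)"
proof (rule landau_o.big_trans[OF _ bigo_Ent], rule bigoI[of _ 1])
  show "eventually (\<lambda>p. norm (p powr (2 + g)) \<le> 1 * norm (p powr (2 + g) * ln (1 / p))) (at_right 0)"
    using eventually_good
  proof eventually_elim
    case (elim p)
    have "p powr (2 + g) * 1 \<le> p powr (2 + g) * ln (1 / p)"
      using L_gt_1[OF elim] by (intro mult_left_mono) auto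
    then show ?case using L_gt_1[OF elim] by simp
  qed
qed

text \<open>\<open>Ent\<close> exceeds \<open>p powr (2 + g)\<close> by a factor of order
  \<open>ln (1 / p)\<close>, far more than the triple logarithm that is demanded.\<close>

lemma smallo_Ent_lnlnln:
  assumes "f \<in> O[at_right 0](\<lambda>p. p powr (2 + g))"
  shows "f \<in> o[at_right 0](\<lambda>p. Ent p / ln (ln (ln (1 / p))))"
proof -
  have "(\<lambda>_::real. 1::real) \<in> o[at_right 0](\<lambda>p. ln (1 / p) * (1 / ln (ln (ln (1 / p)))))" by real_asymp
  then have "(\<lambda>p. p powr (2 + g) * 1) \<in> o[at_right 0](\<lambda>p. p powr (2 + g) * (ln (1 / p) * (1 / ln (ln (ln (1 / p))))))"
    by (rule landau_o.big_small_mult[OF landau_o.big_refl])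
  moreover have "(\<lambda>p. (p powr (2 + g) * ln (1 / p)) * (1 / ln (ln (ln (1 / p))))) \<in> O[at_right 0](\<lambda>p. Ent p * (1 / ln (ln (ln (1 / p)))))"
    by (rule landau_o.big_mult[OF bigo_Ent landau_o.big_refl])
  ultimately have "(\<lambda>p. p powr (2 + g)) \<in> o[at_right 0](\<lambda>p. Ent p * (1 / ln (ln (ln (1 / p)))))"
    by (simp only: mult.assoc mult_1_right) (rule landau_o.small_big_trans)
  then have "f \<in> o[at_right 0](\<lambda>p. Ent p * (1 / ln (ln (ln (1 / p)))))"
    by (rule landau_o.big_small_trans[OF assms])
  then show ?thesis by simp
qed

text \<open>The unimportant pairs other than \<open>(1, 4)\<close>, whose weight is 0.\<close>

definition wide :: "nat \<Rightarrow> nat \<Rightarrow> bool" where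
  "wide i j \<longleftrightarrow> i \<in> {2..4} \<and> j \<in> {2..4} \<and> \<not> imp_pair i j"

definition len_exp :: "nat \<Rightarrow> real" where
  "len_exp i = (if i = 2 then 1 + g / 2 else if i = 3 then 1 else 0)"

text \<open>For blocks 2 to 4 the thresholds on \<open>g\<close> in \<open>imp_pair\<close> are
  those at which \<open>len_exp i + len_exp j + 1\<close> drops below \<open>2 + g\<close>: always
  if block 4 takes part, for \<open>g > 2\<close> with blocks 2 and 3, for \<open>g > 1\<close>
  within block 3, and never within block 2.\<close>

lemma wide_cases:
  assumes "wide i j"
  shows "len_exp i + len_exp j < 1 + g" "\<not> (i = 2 \<and> j = 2)"
proof -
  have "(i = 2 \<or> i = 3 \<or> i = 4) \<and> (j = 2 \<or> j = 3 \<or> j = 4)" using assms by (auto simp: wide_def)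
  then show "len_exp i + len_exp j < 1 + g" "\<not> (i = 2 \<and> j = 2)"
    using assms g_pos by (auto simp: wide_def imp_pair_def len_exp_def)
qed

text \<open>Block 2 is the one that may be shorter than its power of \<open>p\<close> by a
  logarithm, and it cannot occur twice, so one factor \<open>1 / ln (1 / p)\<close> is
  enough.\<close>

lemma wide_len_ge:
  assumes p: "good p" and ij: "wide i j"
  shows "1/4 * (p powr (len_exp i + len_exp j + 1) * (1 / ln (1 / p))) \<le> m p i * m p j * p"
proof -
  define t where "t = 1 / ln (1 / p)"
  have t: "0 < t" "t \<le> 1" using t_bounds[OF p] by (simp_all add: t_def)
  have pp: "0 < p" "p < 1" using p0[OF p] by simp_all
  have l2: "1/2 * p powr len_exp 2 * t \<le> m p 2"
  proof -
    have "1/2 * p powr len_exp 2 * t \<le> t * p powr (1 + g / 2)" using t by (simp add: len_exp_def)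
    also have "\<dots> \<le> m p 2" using b_bounds(1)[OF p] by (simp add: block_len_def t_def)
    finally show ?thesis .
  qed
  have l34: "1/2 * p powr len_exp k \<le> m p k" if "k = 3 \<or> k = 4" for k
    using that m3(1)[OF p] m4(1)[OF p] pp by (auto simp: len_exp_def)
  have l34t: "1/2 * p powr len_exp k * t \<le> m p k" if "k = 3 \<or> k = 4" for k
  proof -
    have "1/2 * p powr len_exp k * t \<le> 1/2 * p powr len_exp k * 1" using t by (intro mult_left_mono) auto
    then show ?thesis using l34[OF that] by simp
  qed
  have "1/4 * (p powr (len_exp i + len_exp j) * t) \<le> m p i * m p j"
  proof -
    have c: "(i = 3 \<or> i = 4) \<and> (j = 2 \<or> j = 3 \<or> j = 4) \<or> i = 2 \<and> (j = 3 \<or> j = 4)"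
      using ij wide_cases(2)[OF ij] by (auto simp: wide_def)
    have eq: "1/4 * (p powr (len_exp i + len_exp j) * t) = (1/2 * p powr len_exp i) * (1/2 * p powr len_exp j * t)"
      "1/4 * (p powr (len_exp i + len_exp j) * t) = (1/2 * p powr len_exp i * t) * (1/2 * p powr len_exp j)"
      by (simp_all add: powr_add)
    show ?thesis
    proof (cases "i = 2")
      case True
      then show ?thesis unfolding eq(2) using c l2 l34 t m_nonneg[OF p, of i]
        by (intro mult_mono) (auto simp: less_imp_le)
    next
      case False
      then show ?thesis unfolding eq(1) using c l2 l34 l34t t m_nonneg[OF p, of i]
        by (intro mult_mono) (auto simp: less_imp_le)
    qed
  qed
  then have "1/4 * (p powr (len_exp i + len_exp j) * t) * p \<le> m p i * m p j * p"
    using pp by (intro mult_right_mono) auto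
  then show ?thesis using pp by (simp add: powr_add t_def mult_ac)
qed

text \<open>The strict gap between the exponents beats every power of the logarithm. The result
  yields the area bound demanded of unimportant pairs, and it also shows that a pair of weight
  \<open>p\<close> of this kind is not small.\<close>

lemma Ent_smallo_wide:
  assumes ij: "wide i j"
  shows "Ent \<in> o[at_right 0](\<lambda>p. m p i * m p j * p)"
proof -
  define s where "s = len_exp i + len_exp j + 1"
  define d where "d = 2 + g - s"
  have d: "0 < d" using wide_cases(1)[OF ij] by (simp add: d_def s_def)
  have "(\<lambda>p::real. p powr d * ln (1 / p)) \<in> o[at_right 0](\<lambda>p. 1 / ln (1 / p))" using d by real_asymp
  then have "(\<lambda>p. p powr s * (p powr d * ln (1 / p))) \<in> o[at_right 0](\<lambda>p. p powr s * (1 / ln (1 / p)))"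
    by (rule landau_o.big_small_mult[OF landau_o.big_refl])
  moreover have "p powr s * (p powr d * ln (1 / p)) = p powr (2 + g) * ln (1 / p)" for p :: real
    by (simp add: mult.assoc[symmetric] powr_add[symmetric] d_def)
  ultimately have 1: "(\<lambda>p. p powr (2 + g) * ln (1 / p)) \<in> o[at_right 0](\<lambda>p. p powr s * (1 / ln (1 / p)))" by simp
  have 2: "(\<lambda>p. p powr s * (1 / ln (1 / p))) \<in> O[at_right 0](\<lambda>p. m p i * m p j * p)"
  proof (rule bigoI[of _ 4])
    show "eventually (\<lambda>p. norm (p powr s * (1 / ln (1 / p))) \<le> 4 * norm (m p i * m p j * p)) (at_right 0)"
      using eventually_good
    proof eventually_elim
      case (elim p)
      have "0 \<le> p powr s * (1 / ln (1 / p))" using t_bounds(4)[OF elim] by (intro mult_nonneg_nonneg) auto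
      moreover have "0 \<le> m p i * m p j * p" using m_nonneg[OF elim] p0(1)[OF elim] by (simp add: less_imp_le)
      ultimately show ?case using wide_len_ge[OF elim ij] unfolding s_def by simp
    qed
  qed
  show ?thesis
    using landau_o.big_small_trans[OF Ent_bigo landau_o.small_big_trans[OF 1 2]] .
qed

lemma wide_weight:
  assumes p: "good p" and ij: "wide i j"
  shows "\<bar>w p i j - p\<bar> \<le> 6 * M\<^sup>2 * p powr (1 + g / 2)"
proof -
  have pp: "0 < p" "p < 1/4" using p0[OF p] by simp_all
  let ?Q = "p powr (1 + g / 2)"
  have Q: "0 \<le> ?Q" by simp
  have MM: "M \<le> M\<^sup>2" using M power_increasing[of 1 2 M] by simp
  have ab: "a p + b p \<le> 2 * M * ?Q" "a p \<le> M * ?Q" "0 < a p" "0 < b p"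
    using ab_le[OF p] ab_pos[OF p] by simp_all
  have MQ: "M * ?Q \<le> M\<^sup>2 * ?Q" using MM by (intro mult_right_mono) auto
  have MQ0: "0 \<le> M\<^sup>2 * ?Q" by simp
  have w44: "\<bar>w p 4 4 - p\<bar> \<le> 6 * M\<^sup>2 * ?Q"
  proof -
    let ?X = "2 * p * a p - (a p)\<^sup>2 + (b p)\<^sup>2"
    have "a p * a p \<le> p * a p" using ab_half[OF p] ab pp by (intro mult_right_mono) linarith+
    then have X0: "0 \<le> ?X" using ab pp by (simp add: power2_eq_square)
    have "b p * b p \<le> 1 * b p" using ab_half[OF p] ab pp by (intro mult_right_mono) linarith+
    moreover have "2 * p * a p \<le> 1 * a p" using ab pp by (intro mult_right_mono) linarith+
    ultimately have "?X \<le> a p + b p" using zero_le_power2[of "a p"] by (simp only: power2_eq_square)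
    then have X1: "?X \<le> 2 * (M\<^sup>2 * ?Q)" using ab(1) MQ by linarith
    have "X / (1 - p) \<le> 6 * r" if "0 \<le> X" "X \<le> 2 * r" for X r
    proof -
      have "X / (1 - p) \<le> X / (1/2)" using that pp by (intro divide_left_mono) auto
      then show ?thesis using that by simp
    qed
    from this[OF X0 X1] have "?X / (1 - p) \<le> 6 * M\<^sup>2 * ?Q" by (simp only: mult.assoc)
    moreover have "0 \<le> ?X / (1 - p)" using X0 pp by simp
    moreover have "w p 4 4 - p = ?X / (1 - p)" by (simp add: block_weight_def)
    ultimately show ?thesis by (simp only: abs_of_nonneg)
  qed
  have c: "(i = 2 \<or> i = 3 \<or> i = 4) \<and> (j = 2 \<or> j = 3 \<or> j = 4)" using ij by (auto simp: wide_def)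
  show ?thesis
  proof (cases "i = 4 \<and> j = 4")
    case True
    then show ?thesis using w44 by simp
  next
    case False
    then have "w p i j = p \<or> w p i j = p - a p - b p \<or> w p i j = p - a p"
      using c wide_cases(2)[OF ij] by (auto simp: block_weight_def)
    then show ?thesis using ab MQ MQ0 by (elim disjE) auto
  qed
qed

lemma Hom_block_nonneg:
  assumes "good p" "B \<in> verts K \<rightarrow> {1..4}"
  shows "0 \<le> Hom_block K (W p) (S p) B"
  unfolding hub_clique_params.Hom_block_W[OF params[OF assms(1)] K assms(2)]
  using m_nonneg[OF assms(1)] hub_clique_params.edge_weight_bounds[OF params[OF assms(1)] K]
  by (intro mult_nonneg_nonneg prod_nonneg) (auto intro: less_imp_le)

lemma Hom_block_adjacent_le:
  assumes p: "good p" and B: "B \<in> verts K \<rightarrow> {1..4}"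
    and e: "{x, y1} \<in> K" "{x, y2} \<in> K" "y1 \<noteq> y2"
    and i1: "imp_pair (B x) (B y1)" "w p (B x) (B y1) < 1" and i2: "imp_pair (B x) (B y2)" "w p (B x) (B y2) < 1"
  shows "Hom_block K (W p) (S p) B \<le> M ^ card (verts K) * 2 ^ card K * p powr (real (card K) + 1)"
proof -
  have r: "B x \<in> {2, 3} \<and> B u \<in> {2, 3} \<and> \<not> (B x = 2 \<and> B u = 2)"
    if "imp_pair (B x) (B u)" "w p (B x) (B u) < 1" for u
  proof -
    have "B x \<in> {1, 2, 3}" "B u \<in> {1, 2, 3}" using that(1) by (auto simp: imp_pair_def)
    then show ?thesis using that(2) by (auto simp: block_weight_def)
  qed
  note r1 = r[OF i1] and r2 = r[OF i2]
  have g2: "g \<le> 2" using i1(1) r1 by (auto simp: imp_pair_def)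
  \<comment> \<open>The least raise at \<open>x\<close> that covers both edges: 1 when one of them
    joins block 3 to itself, which forces \<open>g <= 1\<close>, and 1/2 otherwise, where
    \<open>g <= 2\<close>. Either way \<open>g * \<Delta>\<close> is at most 1 and a factor
    \<open>p\<close> is gained.\<close>
  define \<Delta> :: real where "\<Delta> = (if B x = 3 \<and> (B y1 = 3 \<or> B y2 = 3) then 1 else 1/2)"
  have \<Delta>: "0 \<le> \<Delta>" "1 \<le> block_level B x + \<Delta> + block_level B y1" "1 \<le> block_level B x + \<Delta> + block_level B y2"
    using r1 r2 by (auto simp: \<Delta>_def block_level_def)
  have g\<Delta>: "g * \<Delta> \<le> 1" using g2 i1(1) i2(1) by (auto simp: \<Delta>_def imp_pair_def)
  have "Hom_block K (W p) (S p) B \<le> M ^ card (verts K) * 2 ^ card K * p powr (real (card K) + 2 - g * \<Delta>)"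
    using g_pos r1 r2 \<Delta> M a_bounds(2)[OF p] b_bounds(2)[OF p]
    by (intro hub_clique_params.Hom_block_le_of_adjacent[OF params[OF p] K _ B e]) auto
  also have "\<dots> \<le> M ^ card (verts K) * 2 ^ card K * p powr (real (card K) + 1)"
    using M g\<Delta> by (intro mult_left_mono pw_mono[OF p]) auto
  finally show ?thesis .
qed

section \<open>Verification of the block conditions along a sequence\<close>

context
  fixes q :: "nat \<Rightarrow> real"
  assumes q: "filterlim q (at_right 0) sequentially"
    and growth: "(\<lambda>n. (ln (real n) / real n) powr (1 / (2 * real (card K) - 2 - g))) \<in> o(q)"
begin

lemma eventually_q: "eventually P (at_right 0) \<Longrightarrow> eventually (\<lambda>n. P (q n)) sequentially"
  by (rule eventually_compose_filterlim[OF _ q])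

lemma good_q: "eventually (\<lambda>n. good (q n)) sequentially"
  by (rule eventually_q[OF eventually_good])

lemma smallo_q: "f \<in> o[at_right 0](h) \<Longrightarrow> (\<lambda>n. f (q n)) \<in> o(\<lambda>n. h (q n))"
  by (rule landau_o.small.compose[OF _ q])

lemma bigo_q: "f \<in> O[at_right 0](h) \<Longrightarrow> (\<lambda>n. f (q n)) \<in> O(\<lambda>n. h (q n))"
  by (rule landau_o.big.compose[OF _ q])

abbreviation "qq \<equiv> 2 * real (card K) - 2 - g"

lemma qq_bounds: "1 \<le> qq" "2 + g \<le> qq"
  using g_pos g_le by linarith+

text \<open>The growth hypothesis raised to the power \<open>qq\<close>.\<close>

lemma ln_div_smallo: "(\<lambda>n. ln (real n) / real n) \<in> o(\<lambda>n. q n powr qq)"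
proof (rule smalloI_tendsto)
  have "((\<lambda>n. (ln (real n) / real n) powr (1 / qq) / q n) \<longlongrightarrow> 0) sequentially"
    by (rule smalloD_tendsto[OF growth])
  then have "((\<lambda>n. ((ln (real n) / real n) powr (1 / qq) / q n) powr qq) \<longlongrightarrow> 0) sequentially"
  proof (rule tendsto_zero_powrI[where b = qq])
    show "eventually (\<lambda>n. 0 \<le> (ln (real n) / real n) powr (1 / qq) / q n) sequentially"
      using good_q
    proof eventually_elim
      case (elim n)
      show ?case using p0(1)[OF elim] by (intro divide_nonneg_nonneg powr_ge_zero) linarith
    qed
  qed (use qq_bounds in auto)
  moreover have "eventually (\<lambda>n. ((ln (real n) / real n) powr (1 / qq) / q n) powr qq = ln (real n) / real n / q n powr qq) sequentially"
    using good_q eventually_ge_at_top[of 1]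
  proof eventually_elim
    case (elim n)
    have "0 \<le> ln (real n) / real n" using elim(2) by simp
    moreover have "(r powr (1 / s) / c) powr s = r / c powr s" if "0 \<le> r" "0 < c" "1 \<le> s" for r c s :: real
      using that by (simp add: powr_divide powr_powr)
    ultimately show ?case using p0(1)[OF elim(1)] qq_bounds(1) by blast
  qed
  ultimately show "((\<lambda>n. ln (real n) / real n / q n powr qq) \<longlongrightarrow> 0) sequentially"
    using tendsto_cong by fast
  show "eventually (\<lambda>n. q n powr qq \<noteq> 0) sequentially"
    using good_q by eventually_elim (use p0(1) in force)
qed

lemma ln_div_smallo_powr: "(\<lambda>n. ln (real n) / real n) \<in> o(\<lambda>n. q n powr (2 + g))"
proof (rule landau_o.small_big_trans[OF ln_div_smallo], rule bigoI[of _ 1])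
  show "eventually (\<lambda>n. norm (q n powr qq) \<le> 1 * norm (q n powr (2 + g))) sequentially"
    using good_q by eventually_elim (use pw_mono qq_bounds in simp)
qed

lemma ln_div_smallo_of_ge:
  assumes "\<And>p. good p \<Longrightarrow> p powr (2 + g) \<le> f p"
  shows "(\<lambda>n. ln (real n) / real n) \<in> o(\<lambda>n. f (q n))"
proof (rule landau_o.small_big_trans[OF ln_div_smallo_powr], rule bigoI[of _ 1])
  show "eventually (\<lambda>n. norm (q n powr (2 + g)) \<le> 1 * norm (f (q n))) sequentially"
    using good_q
  proof eventually_elim
    case (elim n)
    show ?case using assms[OF elim] by simp
  qed
qed

lemma inverse_bigo_ln_div: "(\<lambda>n. 1 / real n) \<in> O(\<lambda>n. ln (real n) / real n)"
  by real_asymp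

text \<open>The growth hypothesis with \<open>qq >= 1\<close> makes \<open>q n\<close> at least
  \<open>1 / n\<close> eventually, as \<open>ln n >= 1\<close>.\<close>

lemma ln_inverse_le: "eventually (\<lambda>n. ln (1 / q n) \<le> ln (real n)) sequentially"
proof -
  have "eventually (\<lambda>n. norm ((ln (real n) / real n) powr (1 / qq)) \<le> 1 * norm (q n)) sequentially"
    using growth by (rule landau_o.smallD) simp
  moreover have "eventually (\<lambda>n. 1 \<le> ln (real n)) sequentially" by real_asymp
  ultimately show ?thesis
    using good_q eventually_ge_at_top[of 1]
  proof eventually_elim
    case (elim n)
    have qn: "0 < q n" using p0(1)[OF elim(3)] .
    have n: "0 < real n" "1 \<le> real n" using elim(4) by simp_all
    have "1 / real n = (1 / real n) powr 1" using n by simp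
    also have "\<dots> \<le> (1 / real n) powr (1 / qq)" using n qq_bounds(1) by (intro powr_mono') auto
    also have "\<dots> \<le> (ln (real n) / real n) powr (1 / qq)"
      using n elim(2) qq_bounds(1) by (intro powr_mono2 divide_right_mono) auto
    also have "\<dots> \<le> q n" using elim(1) qn by simp
    finally have "1 / q n \<le> real n" using n qn by (simp add: field_simps)
    then show ?case using qn n by (subst ln_le_cancel_iff) auto
  qed
qed

text \<open>The exponent in the growth hypothesis originates here: after \<open>ln (1 / q n)\<close>
  is replaced by \<open>ln n\<close>, which is \<open>n\<close> times \<open>ln n / n\<close>, the
  bound \<open>q n powr qq\<close> for the last quotient completes the exponent \<open>2 + g\<close>
  to \<open>2 * card K\<close>.\<close>

lemma Ent_smallo_q: "(\<lambda>n. Ent (q n)) \<in> o(\<lambda>n. q n ^ (2 * card K) * real n)"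
proof -
  have 1: "(\<lambda>n. Ent (q n)) \<in> O(\<lambda>n. q n powr (2 + g) * ln (1 / q n))" by (rule bigo_q[OF Ent_bigo])
  have 2: "(\<lambda>n. q n powr (2 + g) * ln (1 / q n)) \<in> O(\<lambda>n. q n powr (2 + g) * real n * (ln (real n) / real n))"
  proof (rule bigoI[of _ 1])
    show "eventually (\<lambda>n. norm (q n powr (2 + g) * ln (1 / q n)) \<le> 1 * norm (q n powr (2 + g) * real n * (ln (real n) / real n))) sequentially"
      using good_q ln_inverse_le eventually_ge_at_top[of 1]
    proof eventually_elim
      case (elim n)
      have "0 < ln (1 / q n)" using L_gt_1[OF elim(1)] by linarith
      then have "\<bar>ln (1 / q n)\<bar> \<le> \<bar>ln (real n)\<bar>" using elim(2) by linarith
      moreover have "q n powr (2 + g) * real n * (ln (real n) / real n) = q n powr (2 + g) * ln (real n)"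
        using elim(3) by simp
      ultimately show ?case by (simp add: abs_mult mult_left_mono)
    qed
  qed
  have 3: "(\<lambda>n. q n powr (2 + g) * real n * (ln (real n) / real n)) \<in> o(\<lambda>n. q n powr (2 + g) * real n * q n powr qq)"
    by (rule landau_o.big_small_mult[OF landau_o.big_refl ln_div_smallo])
  have 4: "eventually (\<lambda>n. q n powr (2 + g) * real n * q n powr qq = q n ^ (2 * card K) * real n) sequentially"
    using good_q
  proof eventually_elim
    case (elim n)
    have "q n powr (2 + g) * q n powr qq = q n powr real (2 * card K)" by (simp add: powr_add[symmetric])
    also have "\<dots> = q n ^ (2 * card K)" using p0(1)[OF elim] by (rule powr_realpow)
    finally show ?case by (simp add: mult_ac)
  qed
  have "(\<lambda>n. Ent (q n)) \<in> o(\<lambda>n. q n powr (2 + g) * real n * q n powr qq)"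
    by (rule landau_o.big_small_trans[OF 1 landau_o.big_small_trans[OF 2 3]])
  then show ?thesis using landau_o.small.cong[OF 4] by simp
qed

lemma measure_q: "i \<in> {1..4} \<Longrightarrow> eventually (\<lambda>n. measure lborel (S (q n) i) = m (q n) i) sequentially"
  using good_q by eventually_elim (rule hub_clique_params.measure_S[OF params])

lemma small_block_iff:
  assumes "i \<in> {1..4}" "j \<in> {1..4}"
  shows "small_block q (\<lambda>n. W (q n)) (\<lambda>n. S (q n)) (\<lambda>n. w (q n)) i j \<longleftrightarrow>
    (\<lambda>n. m (q n) i * m (q n) j * w (q n) i j) \<in> o(\<lambda>n. Ent (q n) / ln (ln (ln (1 / q n))))"
  unfolding small_block_def Ent_def[symmetric]
proof (rule landau_o.small.in_cong)
  show "eventually (\<lambda>n. measure lborel (S (q n) i) * measure lborel (S (q n) j) * w (q n) i j =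
      m (q n) i * m (q n) j * w (q n) i j) sequentially"
    using measure_q[OF assms(1)] measure_q[OF assms(2)] by eventually_elim simp
qed

lemma small_block_of_imp:
  assumes ij: "imp_pair i j"
  shows "small_block q (\<lambda>n. W (q n)) (\<lambda>n. S (q n)) (\<lambda>n. w (q n)) i j"
proof -
  have r: "i \<in> {1..4}" "j \<in> {1..4}" using ij by (auto simp: imp_pair_def)
  have "(\<lambda>p. m p i * m p j * w p i j) \<in> O[at_right 0](\<lambda>p. p powr (2 + g))"
  proof (rule bigoI[of _ "M\<^sup>2"])
    show "eventually (\<lambda>p. norm (m p i * m p j * w p i j) \<le> M\<^sup>2 * norm (p powr (2 + g))) (at_right 0)"
      using eventually_good
    proof eventually_elim
      case (elim p)
      have "0 \<le> m p i * m p j * w p i j"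
        using m_nonneg[OF elim] w_le_1(1)[OF elim] by (intro mult_nonneg_nonneg) (auto intro: less_imp_le)
      then show ?case using imp_le[OF elim ij] by simp
    qed
  qed
  from smallo_q[OF smallo_Ent_lnlnln[OF this]] show ?thesis by (simp add: small_block_iff[OF r])
qed

text \<open>A pair of blocks 1 to 3 outside \<open>imp_pair\<close> has weight \<open>p\<close> and
  is \<open>wide\<close>; smallness would then make \<open>Ent\<close> of smaller order than itself,
  although it is eventually positive.\<close>

lemma imp_of_small_block:
  assumes ij: "i \<in> {1..3}" "j \<in> {1..3}"
    and small: "small_block q (\<lambda>n. W (q n)) (\<lambda>n. S (q n)) (\<lambda>n. w (q n)) i j"
  shows "imp_pair i j"
proof (rule ccontr)
  assume "\<not> imp_pair i j"
  then have wide: "wide i j" using ij by (auto simp: wide_def imp_pair_def)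
  have w: "w p i j = p" for p using ij wide_cases(2)[OF wide] wide by (auto simp: block_weight_def wide_def)
  have r: "i \<in> {1..4}" "j \<in> {1..4}" using ij by auto
  have "(\<lambda>n. Ent (q n)) \<in> o(\<lambda>n. m (q n) i * m (q n) j * q n)" by (rule smallo_q[OF Ent_smallo_wide[OF wide]])
  moreover have "(\<lambda>n. m (q n) i * m (q n) j * q n) \<in> o(\<lambda>n. Ent (q n) * (1 / ln (ln (ln (1 / q n)))))"
    using small by (simp add: small_block_iff[OF r] w)
  moreover have "(\<lambda>n. Ent (q n) * (1 / ln (ln (ln (1 / q n))))) \<in> O(\<lambda>n. Ent (q n) * 1)"
  proof (rule landau_o.big_mult[OF landau_o.big_refl])
    have "(\<lambda>p::real. 1 / ln (ln (ln (1 / p)))) \<in> O[at_right 0](\<lambda>_. 1)" by real_asymp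
    from bigo_q[OF this] show "(\<lambda>n. 1 / ln (ln (ln (1 / q n)))) \<in> O(\<lambda>_. 1)" .
  qed
  ultimately have "(\<lambda>n. Ent (q n)) \<in> o(\<lambda>n. Ent (q n) * 1)"
    by (blast intro: landau_o.small_trans landau_o.small_big_trans)
  then have "eventually (\<lambda>n. Ent (q n) = 0) sequentially" by (simp add: landau_o.small_refl_iff)
  moreover have "eventually (\<lambda>n. 0 < Ent (q n)) sequentially" by (rule eventually_q[OF eventually_Ent_pos])
  ultimately have "eventually (\<lambda>n::nat. False) sequentially" by eventually_elim simp
  then show False by simp
qed

lemma important_iff:
  "important q (\<lambda>n. W (q n)) 4 (\<lambda>n. S (q n)) (\<lambda>n. w (q n)) i j \<longleftrightarrow> imp_pair i j"
proof -
  have *: "{1..<4} = {1..3::nat}" by auto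
  have "imp_pair i j \<Longrightarrow> i \<in> {1..3} \<and> j \<in> {1..3}" by (simp only: imp_pair_def simp_thms)
  then show ?thesis
    unfolding important_def * using small_block_of_imp[of i j] imp_of_small_block[of i j] by blast
qed

text \<open>Weights between blocks 1 to 3 are 1 or \<open>p\<close>, so a weight below 1 at the
  single index \<open>n0\<close> is below 1 at all large \<open>n\<close>. This lets the matching
  condition be proved at every \<open>n\<close> separately.\<close>

lemma negligible_of_adjacent:
  assumes B: "B \<in> verts K \<rightarrow> {1..4}" and e: "{x, y1} \<in> K" "{x, y2} \<in> K" "y1 \<noteq> y2"
    and imp_pair: "imp_pair (B x) (B y1)" "imp_pair (B x) (B y2)"
    and lt: "w (q n0) (B x) (B y1) < 1" "w (q n0) (B x) (B y2) < 1"
  shows "(\<lambda>n. Hom_block K (W (q n)) (S (q n)) B) \<in> o(\<lambda>n. q n ^ card K)"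
proof -
  have lt': "w p (B x) (B u) < 1" if "good p" "imp_pair (B x) (B u)" "w (q n0) (B x) (B u) < 1" for p u
  proof -
    have "B x \<in> {1, 2, 3}" "B u \<in> {1, 2, 3}" using that(2) by (auto simp: imp_pair_def)
    then show ?thesis using that(3) p0(4)[OF that(1)] by (auto simp: block_weight_def)
  qed
  define c where "c = M ^ card (verts K) * 2 ^ card K"
  have "(\<lambda>n. Hom_block K (W (q n)) (S (q n)) B) \<in> O(\<lambda>n. q n ^ card K * q n)"
  proof (rule bigoI[of _ c])
    show "eventually (\<lambda>n. norm (Hom_block K (W (q n)) (S (q n)) B) \<le> c * norm (q n ^ card K * q n)) sequentially"
      using good_q
    proof eventually_elim
      case (elim n)
      have "q n powr (real (card K) + 1) = q n ^ card K * q n"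
        using p0(1)[OF elim] by (simp add: powr_add powr_realpow)
      then show ?case
        using Hom_block_adjacent_le[OF elim B e imp_pair(1) lt'[OF elim imp_pair(1) lt(1)] imp_pair(2) lt'[OF elim imp_pair(2) lt(2)]]
          Hom_block_nonneg[OF elim B] p0(1)[OF elim] by (simp add: c_def)
    qed
  qed
  moreover have "(\<lambda>n. q n ^ card K * q n) \<in> o(\<lambda>n. q n ^ card K * 1)"
  proof (rule landau_o.big_small_mult[OF landau_o.big_refl])
    have "(\<lambda>p::real. p) \<in> o[at_right 0](\<lambda>_. 1)" by real_asymp
    from smallo_q[OF this] show "q \<in> o(\<lambda>_. 1)" .
  qed
  ultimately show ?thesis using landau_o.big_small_trans by force
qed

lemma negligible_of_hub_rest:
  assumes B: "B \<in> verts K \<rightarrow> {1..4}" and e: "{u, v} \<in> K" "B u = 1" "B v = 4"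
  shows "(\<lambda>n. Hom_block K (W (q n)) (S (q n)) B) \<in> o(\<lambda>n. q n ^ card K)"
proof -
  have "eventually (\<lambda>n. Hom_block K (W (q n)) (S (q n)) B = 0) sequentially"
    using good_q
  proof eventually_elim
    case (elim n)
    interpret P: hub_clique_params "q n" "a (q n)" "b (q n)" by (rule params[OF elim])
    have "edge_weight (block_weight (q n) (a (q n)) (b (q n))) B {u, v} = 0"
      unfolding P.edge_weight_W using e by (simp add: block_weight_def)
    then have "(\<Prod>e\<in>K. edge_weight (block_weight (q n) (a (q n)) (b (q n))) B e) = 0"
      using e(1) K by (intro prod_zero) (auto simp: simple_graph_def intro!: bexI[of _ "{u, v}"])
    then show ?case unfolding P.Hom_block_W[OF K B] by simp
  qed
  then show ?thesis using landau_o.small.in_cong[of "\<lambda>n. Hom_block K (W (q n)) (S (q n)) B" "\<lambda>_. 0"] by simp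
qed

text \<open>The area bound holds without an error term; the summand 0 matches the constant witness
  for the vanishing sequence in the block conditions.\<close>

lemma wide_conclusion:
  assumes ij: "wide i j"
  shows "eventually (\<lambda>n. (1 + 0) * (Ent (q n) / q n) \<le> measure lborel (S (q n) i) * measure lborel (S (q n) j)) sequentially"
    and "(\<lambda>n. w (q n) i j - q n) \<in> o(q)"
proof -
  have r: "i \<in> {1..4}" "j \<in> {1..4}" using ij by (auto simp: wide_def)
  have "eventually (\<lambda>n. norm (Ent (q n)) \<le> 1 * norm (m (q n) i * m (q n) j * q n)) sequentially"
    using smallo_q[OF Ent_smallo_wide[OF ij]] by (rule landau_o.smallD) simp
  then show "eventually (\<lambda>n. (1 + 0) * (Ent (q n) / q n) \<le> measure lborel (S (q n) i) * measure lborel (S (q n) j)) sequentially"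
    using good_q measure_q[OF r(1)] measure_q[OF r(2)]
  proof eventually_elim
    case (elim n)
    have "0 \<le> m (q n) i * m (q n) j * q n"
      using m_nonneg[OF elim(2)] p0(1)[OF elim(2)] by (simp add: less_imp_le)
    then have "Ent (q n) \<le> m (q n) i * m (q n) j * q n" using elim(1) by simp
    then show ?case using p0(1)[OF elim(2)] elim(3,4) by (simp add: divide_le_eq)
  qed
  have "(\<lambda>p. w p i j - p) \<in> O[at_right 0](\<lambda>p. p powr (1 + g / 2))"
  proof (rule bigoI[of _ "6 * M\<^sup>2"])
    show "eventually (\<lambda>p. norm (w p i j - p) \<le> 6 * M\<^sup>2 * norm (p powr (1 + g / 2))) (at_right 0)"
      using eventually_good by eventually_elim (use wide_weight[OF _ ij] in simp)
  qed
  moreover have "(\<lambda>p::real. p powr (1 + g / 2)) \<in> o[at_right 0](\<lambda>p. p)" using g_pos by real_asymp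
  ultimately have "(\<lambda>p. w p i j - p) \<in> o[at_right 0](\<lambda>p. p)" by (rule landau_o.big_small_trans)
  from smallo_q[OF this] show "(\<lambda>n. w (q n) i j - q n) \<in> o(q)" .
qed

lemma Hom_plus_bigo: "(\<lambda>n. Hom K (\<lambda>x y. W (q n) x y + q n)) \<in> O(\<lambda>n. q n ^ card K)"
proof -
  obtain C0 where C0: "eventually (\<lambda>p. norm (Ent p) \<le> C0 * norm (p powr (2 + g) * ln (1 / p))) (at_right 0)"
    using Ent_bigo by (rule landau_o.bigE)
  define C where "C = max 1 C0"
  show ?thesis
  proof (rule bigoI[of _ "3 ^ card K + 6 ^ card K * C ^ card (verts K)"])
    show "eventually (\<lambda>n. norm (Hom K (\<lambda>x y. W (q n) x y + q n)) \<le>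
        (3 ^ card K + 6 ^ card K * C ^ card (verts K)) * norm (q n ^ card K)) sequentially"
      using good_q eventually_q[OF C0]
    proof eventually_elim
      case (elim n)
      interpret P: hub_clique_params "q n" "a (q n)" "b (q n)" by (rule params[OF elim(1)])
      have D: "0 \<le> q n powr (2 + g) * ln (1 / q n)" using L_gt_1[OF elim(1)] by simp
      have "Ent (q n) \<le> C0 * (q n powr (2 + g) * ln (1 / q n))" using elim(2) D by simp
      also have "\<dots> \<le> C * (q n powr (2 + g) * ln (1 / q n))" using D by (intro mult_right_mono) (auto simp: C_def)
      finally have I: "graphon_entropy (q n) (W (q n)) \<le> C * q n powr (2 + g) * ln (1 / q n)"
        by (simp add: Ent_def mult.assoc)
      have "1 \<le> C" by (simp add: C_def)
      from P.Hom_plus_p_le[OF K this I]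
      have "Hom K (\<lambda>x y. W (q n) x y + q n) \<le> (3 ^ card K + 6 ^ card K * C ^ card (verts K)) * q n ^ card K" .
      moreover have "0 \<le> Hom K (\<lambda>x y. W (q n) x y + q n)"
      proof (rule Hom_nonneg[OF K])
        fix s t :: real assume st: "s \<in> {0..1}" "t \<in> {0..1}"
        show "W (q n) s t + q n = W (q n) t s + q n" using graphonD(2)[OF P.graphon_W st] by simp
        show "0 \<le> W (q n) s t + q n" using graphonD(3)[OF P.graphon_W st] P.p_bounds by simp
      qed
      ultimately show ?case using P.p_bounds by simp
    qed
  qed
qed

lemma block_conditions_q: "block_conditions K q (\<lambda>n. W (q n)) 4 (\<lambda>n. S (q n)) (\<lambda>n. w (q n))"
  unfolding block_conditions_def Ent_def[symmetric] important_iff somewhat_important_at_def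
proof (intro conjI allI ballI impI)
  show "eventually (\<lambda>n. p_regular (q n) (W (q n))) sequentially"
    using good_q by eventually_elim (rule hub_clique_params.p_regular_W[OF params])
  have "eventually (\<lambda>n. measure lborel (S (q n) 4) = m (q n) 4) sequentially" by (rule measure_q) simp
  then show "eventually (\<lambda>n. 1 - q n \<le> measure lborel (S (q n) 4)) sequentially"
    by eventually_elim (simp add: block_len_def)
  show "\<exists>\<eta>>0. eventually (\<lambda>n. (1 + \<eta>) * q n ^ card K \<le> Hom K (W (q n))) sequentially"
  proof (intro exI[of _ \<delta>] conjI \<delta>)
    show "eventually (\<lambda>n. (1 + \<delta>) * q n ^ card K \<le> Hom K (W (q n))) sequentially"
      using good_q by eventually_elim (rule Hom_ge)
  qed
  show "(\<lambda>n. ln (real n) / real n) \<in> o(\<lambda>n. Ent (q n))"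
    by (rule landau_o.small_big_trans[OF ln_div_smallo_powr bigo_q[OF powr_bigo_Ent]])
  show "(\<lambda>n. Ent (q n)) \<in> o(\<lambda>n. q n ^ (2 * card K) * real n)" by (rule Ent_smallo_q)
  show "(\<lambda>n. 1 / real n) \<in> o(\<lambda>n. measure lborel (S (q n) i))" if i: "i \<in> {1..4}" for i
  proof -
    have "(\<lambda>n. ln (real n) / real n) \<in> o(\<lambda>n. m (q n) i)"
      by (rule ln_div_smallo_of_ge[OF p_powr_le_m[OF _ i]])
    then have "(\<lambda>n. 1 / real n) \<in> o(\<lambda>n. m (q n) i)" by (rule landau_o.big_small_trans[OF inverse_bigo_ln_div])
    then show ?thesis using landau_o.small.cong[OF measure_q[OF i]] by simp
  qed
  show "(\<lambda>n. Hom K (\<lambda>x y. W (q n) x y + q n)) \<in> O(\<lambda>n. q n ^ card K)" by (rule Hom_plus_bigo)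
next
  fix i j :: nat assume "i \<in> {1..<4}" "j \<in> {1..<4}"
  then have ij: "i \<in> {1..3}" "j \<in> {1..3}" by auto
  show "eventually (\<lambda>n. q n \<le> w (q n) i j) sequentially"
    using good_q by eventually_elim (rule w_ge_p[OF _ ij])
  show "eventually (\<lambda>n. w (q n) i j = q n) sequentially \<or> small_block q (\<lambda>n. W (q n)) (\<lambda>n. S (q n)) (\<lambda>n. w (q n)) i j"
  proof (cases "imp_pair i j")
    case True
    then show ?thesis using small_block_of_imp by blast
  next
    case False
    then have "w p i j = p" for p using ij by (auto simp: block_weight_def imp_pair_def)
    then show ?thesis by simp
  qed
next
  fix B :: "'a \<Rightarrow> nat"
  assume nn: "nonnegligible K q (\<lambda>n. W (q n)) 4 (\<lambda>n. S (q n)) B"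
  have B: "B \<in> verts K \<rightarrow> {1..4}" and nn': "(\<lambda>n. Hom_block K (W (q n)) (S (q n)) B) \<notin> o(\<lambda>n. q n ^ card K)"
    using nn by (simp_all add: nonnegligible_def)
  have imp_sym: "imp_pair j i" if "imp_pair i j" for i j using that by (auto simp: imp_pair_def)
  show "eventually (\<lambda>n. is_matching {e \<in> K. \<exists>u v. e = {u, v} \<and> imp_pair (B u) (B v) \<and> w (q n) (B u) (B v) < 1}) sequentially"
  proof (intro always_eventually allI)
    fix n
    \<comment> \<open>Either endpoint of such an edge can be listed first, by symmetry of importance
      and of the weights; two edges sharing \<open>x\<close> can thus both be written from
      \<open>x\<close>.\<close>
    have edge: "\<exists>s. e = {x, s} \<and> imp_pair (B x) (B s) \<and> w (q n) (B x) (B s) < 1"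
      if "e = {u, v}" "imp_pair (B u) (B v)" "w (q n) (B u) (B v) < 1" "x \<in> e" for e x u v
    proof (cases "x = u")
      case False
      then have "x = v" using that(1,4) by auto
      then show ?thesis using that imp_sym block_weight_sym[of "q n" "a (q n)" "b (q n)" "B u" "B v"]
        by (intro exI[of _ u]) (auto simp: insert_commute)
    qed (use that in auto)
    show "is_matching {e \<in> K. \<exists>u v. e = {u, v} \<and> imp_pair (B u) (B v) \<and> w (q n) (B u) (B v) < 1}"
      unfolding is_matching_def
    proof (intro ballI impI, rule ccontr)
      fix e f
      assume e: "e \<in> {e \<in> K. \<exists>u v. e = {u, v} \<and> imp_pair (B u) (B v) \<and> w (q n) (B u) (B v) < 1}"
        and f: "f \<in> {e \<in> K. \<exists>u v. e = {u, v} \<and> imp_pair (B u) (B v) \<and> w (q n) (B u) (B v) < 1}"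
        and ef: "e \<noteq> f" "e \<inter> f \<noteq> {}"
      obtain x where x: "x \<in> e" "x \<in> f" using ef(2) by auto
      obtain s where s: "e = {x, s}" "imp_pair (B x) (B s)" "w (q n) (B x) (B s) < 1" using e edge x(1) by blast
      obtain t where t: "f = {x, t}" "imp_pair (B x) (B t)" "w (q n) (B x) (B t) < 1" using f edge x(2) by blast
      have "{x, s} \<in> K" "{x, t} \<in> K" "s \<noteq> t" using e f s(1) t(1) ef(1) by auto
      from negligible_of_adjacent[OF B this s(2) t(2) s(3) t(3)] nn' show False by blast
    qed
  qed
next
  fix B :: "'a \<Rightarrow> nat" and u v
  assume nn: "nonnegligible K q (\<lambda>n. W (q n)) 4 (\<lambda>n. S (q n)) B" and e: "{u, v} \<in> K" and ni: "\<not> imp_pair (B u) (B v)"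
  have B: "B \<in> verts K \<rightarrow> {1..4}" and nn': "(\<lambda>n. Hom_block K (W (q n)) (S (q n)) B) \<notin> o(\<lambda>n. q n ^ card K)"
    using nn by (simp_all add: nonnegligible_def)
  have e': "{v, u} \<in> K" using e by (simp add: insert_commute)
  have r: "B u \<in> {1..4}" "B v \<in> {1..4}"
    using funcset_mem[OF B edge_in_verts(1)[OF e]] funcset_mem[OF B edge_in_verts(2)[OF e]] by simp_all
  \<comment> \<open>Hub and block 4 have weight 0 between them, so a map using this pair is
    negligible; the unimportant pair at hand is therefore \<open>wide\<close>.\<close>
  have "\<not> (B u = 1 \<and> B v = 4)" "\<not> (B v = 1 \<and> B u = 4)"
    using negligible_of_hub_rest[OF B e] negligible_of_hub_rest[OF B e'] nn' by blast+
  then have wd: "wide (B u) (B v)" using r ni by (auto simp: wide_def imp_pair_def)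
  show "\<exists>\<epsilon>. \<epsilon> \<longlonglongrightarrow> 0 \<and> eventually (\<lambda>n. (1 + \<epsilon> n) * (Ent (q n) / q n) \<le>
      measure lborel (S (q n) (B u)) * measure lborel (S (q n) (B v))) sequentially"
    using wide_conclusion(1)[OF wd] by (intro exI[of _ "\<lambda>_. 0"]) simp
  show "(\<lambda>n. w (q n) (B u) (B v) - q n) \<in> o(q)" by (rule wide_conclusion(2)[OF wd])
next
  fix i j assume "imp_pair i j"
  then have ij: "i \<in> {1..3}" "j \<in> {1..3}" by (auto simp: imp_pair_def)
  show "(\<lambda>n. ln (real n) / real n) \<in> o(\<lambda>n. w (q n) i j * measure lborel (S (q n) i))"
  proof -
    have i: "i \<in> {1..4}" using ij by auto
    have ev: "eventually (\<lambda>n. w (q n) i j * measure lborel (S (q n) i) = w (q n) i j * m (q n) i) sequentially"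
      using measure_q[OF i] by eventually_elim simp
    have "(\<lambda>n. ln (real n) / real n) \<in> o(\<lambda>n. w (q n) i j * m (q n) i)"
      by (rule ln_div_smallo_of_ge[OF p_powr_le_m_w[OF _ ij]])
    then show ?thesis using landau_o.small.cong[OF ev] by simp
  qed
qed

end

end

theorem theorem2p20:
  fixes K :: "'a set set" and \<delta> :: real
  assumes "\<delta> > 0"
    and "simple_graph K"
    and "\<not> is_forest K"
    and "\<not> disjoint_union_of_cycles (two_core K)"
  shows
    "(\<exists>C>0. \<forall>\<^sub>F p in at_right 0.
        ereal (p powr (2 + gamma K)) \<le> ereal C * min_entropy K \<delta> p) \<and>
     (\<exists>\<epsilon> :: real \<Rightarrow> real. (\<epsilon> \<longlongrightarrow> 0) (at_right 0) \<and>
        (\<forall>\<^sub>F p in at_right 0.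
           min_entropy K \<delta> p
             \<le> ereal ((2 + \<epsilon> p) * rho K \<delta> * p powr (2 + gamma K) * ln (1 / p)))) \<and>
     (\<forall>p :: nat \<Rightarrow> real.
        filterlim p (at_right 0) sequentially \<longrightarrow>
        (\<lambda>n. (ln (real n) / real n) powr (1 / (2 * real (card K) - 2 - gamma K))) \<in> o(p) \<longrightarrow>
        (\<exists>k W S w.
           (\<forall>\<^sub>F n in sequentially. block_graphon k (S n) (w n) (W n)) \<and>
           block_conditions K p W k S w \<and>
           (\<forall>\<^sub>F n in sequentially. (1 + \<delta>) * p n ^ card K \<le> Hom K (W n)) \<and>
           (\<exists>\<epsilon>. \<epsilon> \<longlonglongrightarrow> 0 \<and> (\<forall>\<^sub>F n in sequentially.
              graphon_entropy (p n) (W n)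
                = (2 + \<epsilon> n) * rho K \<delta> * p n powr (2 + gamma K) * ln (1 / p n)))))"
proof -
  note \<delta> = assms(1) and K = assms(2)
  have sub: "two_core K \<subseteq> K" by (rule two_core_subset)
  have pos: "0 < excess (two_core K)" by (rule two_core_excess_pos[OF K assms(4)])
  have g: "0 < gamma K" by (rule gamma_pos[OF K sub pos])
  obtain H where H: "contributing K H" "H \<noteq> {}" using exists_contributing[OF K sub pos] by metis
  obtain z y :: "real \<Rightarrow> real" and M :: real where zy:
    "((\<lambda>p. z p + y p / 2) \<longlongrightarrow> rho K \<delta>) (at_right 0)"
    "\<And>p. 0 < p \<Longrightarrow> p < exp (-1) \<Longrightarrow> 1 / ln (1 / p) \<le> z p \<and> z p \<le> M"
    "\<And>p. 0 < p \<Longrightarrow> p < exp (-1) \<Longrightarrow> 1 / ln (1 / p) \<le> y p \<and> y p \<le> M"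
    "\<And>p. 0 < p \<Longrightarrow> p < exp (-1) \<Longrightarrow> 1 + \<delta> + \<delta> / ln (1 / p) \<le> P_poly K (z p) (y p)"
    "1 \<le> M"
  proof (rule parameter_choice[OF K \<delta> H])
    fix z w :: "real \<Rightarrow> real" and M :: real
    assume h: "((\<lambda>p. z p + w p / 2) \<longlongrightarrow> rho K \<delta>) (at_right 0)"
      "\<And>p. 0 < p \<Longrightarrow> p < exp (-1) \<Longrightarrow> 1 / ln (1 / p) \<le> z p \<and> z p \<le> M"
      "\<And>p. 0 < p \<Longrightarrow> p < exp (-1) \<Longrightarrow> 1 / ln (1 / p) \<le> w p \<and> w p \<le> M"
      "\<And>p. 0 < p \<Longrightarrow> p < exp (-1) \<Longrightarrow> 1 + \<delta> + \<delta> / ln (1 / p) \<le> P_poly K (z p) (w p)" "1 \<le> M"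
    show thesis by (rule that[OF h])
  qed
  interpret F: hub_clique_family K \<delta> M z y
    by (rule hub_clique_family.intro[OF K g gamma_le[OF K sub pos] \<delta> rho_pos[OF K \<delta> H] zy])
  \<comment> \<open>Chosen so that the entropy identity holds exactly for small \<open>p\<close>; it
    tends to 0 by \<open>F.Ent_lim\<close>. The same function serves the upper bound and, composed
    with the sequence, the attainment.\<close>
  define \<epsilon> where "\<epsilon> p = F.Ent p / (p powr (2 + gamma K) * ln (1 / p)) / rho K \<delta> - 2" for p
  have eps: "(\<epsilon> \<longlongrightarrow> 0) (at_right 0)"
  proof -
    have "(\<epsilon> \<longlongrightarrow> 2 * rho K \<delta> / rho K \<delta> - 2) (at_right 0)"
      unfolding \<epsilon>_def using F.rho by (intro tendsto_diff tendsto_divide F.Ent_lim tendsto_const) simp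
    then show ?thesis using F.rho by simp
  qed
  have Ent_eq: "eventually (\<lambda>p. graphon_entropy p (F.W p) = (2 + \<epsilon> p) * rho K \<delta> * p powr (2 + gamma K) * ln (1 / p)) (at_right 0)"
    using F.eventually_denominator
  proof eventually_elim
    case (elim p)
    have "(2 + \<epsilon> p) * rho K \<delta> = F.Ent p / (p powr (2 + gamma K) * ln (1 / p))"
      unfolding \<epsilon>_def using F.rho by simp
    moreover have "x / d * d = x" if "0 < d" for x d :: real using that by simp
    ultimately have "(2 + \<epsilon> p) * rho K \<delta> * (p powr (2 + gamma K) * ln (1 / p)) = F.Ent p"
      using elim by presburger
    then show ?case by (simp only: F.Ent_def mult.assoc)
  qed
  have lower: "\<exists>C>0. \<forall>\<^sub>F p in at_right 0. ereal (p powr (2 + gamma K)) \<le> ereal C * min_entropy K \<delta> p"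
  proof -
    obtain \<eta> where \<eta>: "0 < \<eta>" "\<forall>p W. 0 < p \<longrightarrow> p < 1 \<longrightarrow> graphon W \<longrightarrow> p_regular p W \<longrightarrow>
      (1 + \<delta>) * p ^ card K \<le> Hom K W \<longrightarrow> \<eta> * p powr (2 + gamma K) \<le> graphon_entropy p W"
      using entropy_lower_bound[OF K less_imp_le[OF g] \<delta>] by blast
    have "eventually (\<lambda>p. ereal (p powr (2 + gamma K)) \<le> ereal (1 / \<eta>) * min_entropy K \<delta> p) (at_right 0)"
      using F.eventually_good
    proof eventually_elim
      case (elim p)
      note p = F.p0[OF elim]
      have "ereal (\<eta> * p powr (2 + gamma K)) \<le> min_entropy K \<delta> p"
        unfolding min_entropy_def using \<eta>(2)[rule_format, OF p(1,4)] by (intro INF_greatest) simp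
      then have "ereal (1 / \<eta>) * ereal (\<eta> * p powr (2 + gamma K)) \<le> ereal (1 / \<eta>) * min_entropy K \<delta> p"
        using \<eta>(1) by (intro ereal_mult_left_mono) auto
      then show ?case using \<eta>(1) by simp
    qed
    then show ?thesis using \<eta>(1) by (intro exI[of _ "1 / \<eta>"]) simp
  qed
  have upper: "\<forall>\<^sub>F p in at_right 0. min_entropy K \<delta> p
      \<le> ereal ((2 + \<epsilon> p) * rho K \<delta> * p powr (2 + gamma K) * ln (1 / p))"
    using F.eventually_good Ent_eq
  proof eventually_elim
    case (elim p)
    interpret P: hub_clique_params p "F.a p" "F.b p" by (rule F.params[OF elim(1)])
    have "min_entropy K \<delta> p \<le> ereal (graphon_entropy p (F.W p))"
      unfolding min_entropy_def
      using P.graphon_W P.p_regular_W F.Hom_ge[OF elim(1)] by (intro INF_lower) simp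
    then show ?case unfolding elim(2) .
  qed
  have attained: "\<exists>k W S w.
           (\<forall>\<^sub>F n in sequentially. block_graphon k (S n) (w n) (W n)) \<and>
           block_conditions K p W k S w \<and>
           (\<forall>\<^sub>F n in sequentially. (1 + \<delta>) * p n ^ card K \<le> Hom K (W n)) \<and>
           (\<exists>\<epsilon>. \<epsilon> \<longlonglongrightarrow> 0 \<and> (\<forall>\<^sub>F n in sequentially.
              graphon_entropy (p n) (W n)
                = (2 + \<epsilon> n) * rho K \<delta> * p n powr (2 + gamma K) * ln (1 / p n)))"
    if p: "filterlim p (at_right 0) sequentially"
      and growth: "(\<lambda>n. (ln (real n) / real n) powr (1 / (2 * real (card K) - 2 - gamma K))) \<in> o(p)"
    for p :: "nat \<Rightarrow> real"
  proof (intro exI conjI)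
    show "\<forall>\<^sub>F n in sequentially. block_graphon 4 (F.S (p n)) (F.w (p n)) (F.W (p n))"
      using F.good_q[OF p growth] by eventually_elim (rule hub_clique_params.block_graphon_W[OF F.params])
    show "block_conditions K p (\<lambda>n. F.W (p n)) 4 (\<lambda>n. F.S (p n)) (\<lambda>n. F.w (p n))"
      by (rule F.block_conditions_q[OF p growth])
    show "\<forall>\<^sub>F n in sequentially. (1 + \<delta>) * p n ^ card K \<le> Hom K (F.W (p n))"
      using F.good_q[OF p growth] by eventually_elim (rule F.Hom_ge)
    show "(\<lambda>n. \<epsilon> (p n)) \<longlonglongrightarrow> 0" by (rule filterlim_compose[OF eps p])
    show "\<forall>\<^sub>F n in sequentially. graphon_entropy (p n) (F.W (p n))
                = (2 + \<epsilon> (p n)) * rho K \<delta> * p n powr (2 + gamma K) * ln (1 / p n)"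
      by (rule eventually_compose_filterlim[OF Ent_eq p])
  qed
  show ?thesis using lower eps upper attained by blast
qed

end
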